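(* Let $W\subset\mathbb{R}^2$ be a convex compact polygon with non-empty interior and let $\Lambda$ be a non-zero, locally finite, translation-invariant measure on the space of lines in $\mathbb{R}^2$ which is not concentrated on one direction. Let $(Y^S(t,W):t\ge0)$ be the STIT process in $W$ and let $(Y^M_c(t,W):t\ge0)$ be the Mecke process in continuous time in $W$. Then $$(Y^S(t,W):t\ge0)\stackrel{D}{=}(Y^M_c(t,W):t\ge0),$$ i.e. the two processes of random closed sets have the same distribution.
   Context: Let $\mathcal H$ be the space of lines in $\mathbb{R}^2$ with the $\sigma$-algebra induced by the Borel $\sigma$-algebra of a parameter space. For $A\subset\mathbb{R}^2$, $[A]=\{g\in\mathcal H: g\cap A\ne\emptyset\}$; one has $0<\Lambda([W])<\infty$. $\mathcal E(\lambda)$ denotes the exponential distribution with parameter (rate) $\lambda$. $\partial$ denotes the boundary and the bar the closure. STIT process: it starts at time $0$ with the single cell $W$. Every cell $C$, from its birth on, has a lifetime distributed as $\mathcal E(\Lambda([C]))$, the lifetimes being (conditionally on the cells) independent of each other. At the end of its lifetime the cell $C$ is divided into two cells by the segment inside $C$ of a random line with law $\Lambda([C])^{-1}\Lambda(\cdot\cap[C])$; the two new cells then evolve independently by the same rule. If $C_1,\dots,C_m$ are the cells at time $t$, then $Y^S(t,W)=\overline{\bigcup_{j=1}^m\partial C_j\setminus\partial W}$. Mecke process in discrete time: let $\gamma_1,\gamma_2,\dots$ be i.i.d. lines with law $\Lambda([W])^{-1}\Lambda(\cdot\cap[W])$ and, independently of them, let $\alpha_1,\alpha_2,\dots$ be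 independent with $\alpha_j$ uniform on $\{1,\dots,j\}$. For a line $\gamma$ not containing the origin (almost surely the case), $\gamma^+$ is the open half-plane bounded by $\gamma$ containing the origin and $\gamma^-$ the other open half-plane. Put $\tilde C_{0,1}=W$, $\tilde C_{1,1}=W\cap\gamma_1^+$, $\tilde C_{1,2}=W\cap\gamma_1^-$, and for $n\ge2$: $\tilde C_{n,j}=\tilde C_{n-1,j}$ if $j\in\{1,\dots,n\}$, $j\neq\alpha_n$; $\tilde C_{n,\alpha_n}=\tilde C_{n-1,\alpha_n}\cap\gamma_n^-$; $\tilde C_{n,n+1}=\tilde C_{n-1,\alpha_n}\cap\gamma_n^+$. Put $Y^M_d(n,W)=\overline{\bigcup_{j=1}^{n+1}\partial\tilde C_{n,j}\setminus\partial W}$ for $n=0,1,2,\dots$. Process of the number of jumps in Cowan's equally-likely model (with parameter $\Lambda([W])$): let $T^C_1,T^C_2,\dots$ be independent with $T^C_k\sim\mathcal E(k\,\Lambda([W]))$ and put $N^C_t=\max\{n\ge0:\sum_{k=1}^nT^C_k\le t\}$, $t\ge0$. (In this model each cell has an independent $\mathcal E(\Lambda([W]))$ lifetime, at the end of which it is divided in two.) Mecke process in continuous time: with $(N^C_t)_{t\ge0}$ independent of all $\gamma_j,\alpha_j$, put $Y^M_c(t,W)=Y^M_d(N^C_t,W)$ for $t\ge0$. *)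

theory Defs
  imports "HOL-Probability.Probability"
begin

section \<open>The space of lines in the plane\<close>

definition lines :: "(real^2) set set" where
  "lines = {g. affine g \<and> aff_dim g = 1}"

text \<open>Each line is \<open>line_of (\<theta>, r)\<close> for exactly one pair in the parameter space
  \<open>[0,\<pi>) \<times> \<real>\<close>: \<open>\<theta>\<close> is the angle of a normal vector, \<open>r\<close> the signed distance
  from the origin.\<close>

definition line_of :: "real \<times> real \<Rightarrow> (real^2) set" where
  "line_of = (\<lambda>(\<theta>, r). {x. vector [cos \<theta>, sin \<theta>] \<bullet> x = r})"

text \<open>Only the underlying measurable space of \<open>line_space\<close> is used.\<close>

definition line_space :: "(real^2) set measure" where
  "line_space = embed_measure (restrict_space borel ({0..<pi} \<times> UNIV)) line_of"

lemma line_of_in_lines: "line_of p \<in> lines"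
proof -
  obtain t r where p: "p = (t, r)" by force
  let ?a = "vector [cos t, sin t] :: real^2"
  have "?a \<bullet> ?a = 1"
    by (simp add: inner_vec_def sum_2 flip: power2_eq_square)
  then have "?a \<noteq> 0" by force
  then show ?thesis
    by (auto simp: p line_of_def lines_def affine_hyperplane)
qed

lemma space_line_space: "space line_space = lines"
proof
  show "space line_space \<subseteq> lines"
    by (auto simp: line_space_def space_embed_measure line_of_in_lines)
  show "lines \<subseteq> space line_space"
  proof
    fix g assume "g \<in> lines"
    then have "affine g" and "aff_dim g = DIM(real^2) - 1"
      by (auto simp: lines_def)
    then obtain a b where a: "a \<noteq> 0" and g: "g = {x. a \<bullet> x = b}"
      by (metis aff_dim_eq_hyperplane affine_hull_eq)
    define n where "n = norm a"
    have n: "n > 0" using a by (simp add: n_def)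
    have "(a$1)\<^sup>2 + (a$2)\<^sup>2 = n\<^sup>2"
      unfolding n_def power2_norm_eq_inner by (simp add: inner_vec_def sum_2 power2_eq_square)
    then have "(a$1/n)\<^sup>2 + (a$2/n)\<^sup>2 = 1"
      using n by (simp add: power_divide flip: add_divide_distrib)
    then obtain t where t: "0 \<le> t" "t < 2*pi" "a$1/n = cos t" "a$2/n = sin t"
      using sincos_total_2pi by metis
    have g1: "g = line_of (t, b/n)"
    proof -
      have "(a \<bullet> x = b) = (vector [cos t, sin t] \<bullet> x = b/n)" for x :: "real^2"
      proof -
        have "vector [cos t, sin t] \<bullet> x = (a \<bullet> x)/n"
          by (simp add: inner_vec_def sum_2 flip: t(3,4)) (simp add: add_divide_distrib)
        then show ?thesis using n by (simp add: field_simps)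
      qed
      then show ?thesis by (simp add: g line_of_def)
    qed
    show "g \<in> space line_space"
    proof (cases "t < pi")
      case True
      then show ?thesis
        using t g1 by (auto simp: line_space_def space_embed_measure space_restrict_space)
    next
      case False
      have "vector [cos t, sin t] \<bullet> x = - (vector [cos (t-pi), sin (t-pi)] \<bullet> x)" for x :: "real^2"
        by (simp add: inner_vec_def sum_2)
      then have "g = line_of (t - pi, - (b/n))"
        by (auto simp: g1 line_of_def)
      then show ?thesis
        using t False by (auto simp: line_space_def space_embed_measure space_restrict_space)
    qed
  qed
qed

text \<open>The set \<open>[A]\<close> of lines meeting \<open>A\<close>.\<close>

definition hitting :: "(real^2) set \<Rightarrow> (real^2) set set" where
  "hitting A = {g \<in> lines. g \<inter> A \<noteq> {}}"

text \<open>The law \<open>\<Lambda>([A])\<^sup>-\<^sup>1 \<Lambda>(\<cdot> \<inter> [A])\<close> of a random line hitting \<open>A\<close> is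
  \<open>uniform_measure \<Lambda> (hitting A)\<close>. Local finiteness refers to the topology of the space of
  lines, in which the sets \<open>hitting K\<close> with \<open>K\<close> compact are compact and every compact set is
  contained in one of them.\<close>

definition locally_finite_lines :: "(real^2) set measure \<Rightarrow> bool" where
  "locally_finite_lines \<Lambda> \<longleftrightarrow> (\<forall>K. compact K \<longrightarrow> emeasure \<Lambda> (hitting K) < \<infinity>)"

definition translation_invariant_lines :: "(real^2) set measure \<Rightarrow> bool" where
  "translation_invariant_lines \<Lambda> \<longleftrightarrow>
     (\<forall>v. \<forall>A\<in>sets \<Lambda>. emeasure \<Lambda> ((\<lambda>g. (+) v ` g) ` A) = emeasure \<Lambda> A)"

definition concentrated_on_one_direction :: "(real^2) set measure \<Rightarrow> bool" where
  "concentrated_on_one_direction \<Lambda> \<longleftrightarrow> (\<exists>h\<in>lines. AE g in \<Lambda>. affine_parallel h g)"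

text \<open>The open half-planes bounded by the line \<open>g\<close>: the one containing the origin, and the
  other one. Both are empty if \<open>g\<close> contains the origin.\<close>

definition plus_side :: "(real^2) set \<Rightarrow> (real^2) set" where
  "plus_side g = {x. \<exists>a b. g = {y. a \<bullet> y = b} \<and> a \<bullet> 0 < b \<and> a \<bullet> x < b}"

definition minus_side :: "(real^2) set \<Rightarrow> (real^2) set" where
  "minus_side g = {x. \<exists>a b. g = {y. a \<bullet> y = b} \<and> a \<bullet> 0 < b \<and> a \<bullet> x > b}"

section \<open>Random closed sets\<close>

definition closed_set_space :: "(real^2) set measure" where
  "closed_set_space = sigma {F. closed F} {{F. closed F \<and> F \<inter> K \<noteq> {}} |K. compact K}"

section \<open>STIT process\<close>

text \<open>All cells that ever occur are indexed by the nodes of the infinite binary tree: a node is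
  the list of the choices of sides leading to it, latest choice first, and \<open>[]\<close> is the initial
  cell \<open>W\<close>. The cell \<open>w\<close> has lifetime \<open>l w\<close> and is divided by the line \<open>g w\<close> into the two cells
  \<open>True # w\<close> and \<open>False # w\<close>. These are taken without the dividing segment, which affects neither
  their boundaries nor the values \<open>\<Lambda>([C])\<close>, since a translation-invariant, locally finite \<open>\<Lambda>\<close>
  gives measure zero to the lines that meet a convex polygon only in its boundary.\<close>

primrec stit_cell :: "(real^2) set \<Rightarrow> (bool list \<Rightarrow> (real^2) set) \<Rightarrow> bool list \<Rightarrow> (real^2) set" where
  "stit_cell W g [] = W"
| "stit_cell W g (s # w) = stit_cell W g w \<inter> (if s then plus_side (g w) else minus_side (g w))"

primrec stit_birth :: "(bool list \<Rightarrow> real) \<Rightarrow> bool list \<Rightarrow> real" where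
  "stit_birth l [] = 0"
| "stit_birth l (s # w) = stit_birth l w + l w"

definition stit_alive :: "(bool list \<Rightarrow> real) \<Rightarrow> real \<Rightarrow> bool list set" where
  "stit_alive l t = {w. stit_birth l w \<le> t \<and> t < stit_birth l w + l w}"

definition stit ::
  "(real^2) set \<Rightarrow> (bool list \<Rightarrow> real) \<Rightarrow> (bool list \<Rightarrow> (real^2) set) \<Rightarrow> real \<Rightarrow> (real^2) set" where
  "stit W l g t = closure ((\<Union>w\<in>stit_alive l t. frontier (stit_cell W g w)) - frontier W)"

text \<open>The \<open>\<sigma>\<close>-algebra generated by the lifetimes and dividing lines of the cells of the
  generations before the \<open>n\<close>-th.\<close>

definition stit_history ::
  "'a measure \<Rightarrow> (bool list \<Rightarrow> 'a \<Rightarrow> real) \<Rightarrow> (bool list \<Rightarrow> 'a \<Rightarrow> (real^2) set) \<Rightarrow> nat \<Rightarrow> 'a measure" where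
  "stit_history M L G n =
     vimage_algebra (space M) (\<lambda>\<omega>. \<lambda>w\<in>{w. length w < n}. (L w \<omega>, G w \<omega>))
       (Pi\<^sub>M {w. length w < n} (\<lambda>_. borel \<Otimes>\<^sub>M line_space))"

text \<open>The random evolution of the cells: conditionally on the earlier generations, which determine
  the cells \<open>C\<close> of the \<open>n\<close>-th generation, all lifetimes and dividing lines of the \<open>n\<close>-th generation
  are independent, a cell \<open>C\<close> having an exponential lifetime of rate \<open>\<Lambda>([C])\<close> and a dividing
  line with law \<open>\<Lambda>([C])\<^sup>-\<^sup>1 \<Lambda>(\<cdot> \<inter> [C])\<close>.\<close>

definition stit_data ::
  "(real^2) set measure \<Rightarrow> (real^2) set \<Rightarrow> 'a measure \<Rightarrow>
     (bool list \<Rightarrow> 'a \<Rightarrow> real) \<Rightarrow> (bool list \<Rightarrow> 'a \<Rightarrow> (real^2) set) \<Rightarrow> bool" where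
  "stit_data \<Lambda> W M L G \<longleftrightarrow>
     prob_space M \<and>
     (\<forall>w. L w \<in> borel_measurable M) \<and>
     (\<forall>w. G w \<in> measurable M line_space) \<and>
     (\<forall>n I B.
        (\<forall>w. length w = n \<longrightarrow> I w \<in> sets borel \<and> B w \<in> sets line_space) \<longrightarrow>
        (AE \<omega> in M.
           real_cond_exp M (stit_history M L G n)
             (indicator {\<omega> \<in> space M. \<forall>w. length w = n \<longrightarrow> L w \<omega> \<in> I w \<and> G w \<omega> \<in> B w}) \<omega> =
           (\<Prod>w | length w = n.
              let H = hitting (stit_cell W (\<lambda>u. G u \<omega>) w) in
                measure (density lborel (exponential_density (measure \<Lambda> H))) (I w) *
                measure (uniform_measure \<Lambda> H) (B w))))"

section \<open>Mecke process\<close>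

text \<open>The library's \<open>indep_var\<close> requires both random variables to have the same type.\<close>

definition indep_rvs ::
  "'a measure \<Rightarrow> 'b measure \<Rightarrow> ('a \<Rightarrow> 'b) \<Rightarrow> 'c measure \<Rightarrow> ('a \<Rightarrow> 'c) \<Rightarrow> bool" where
  "indep_rvs M S X R Y \<longleftrightarrow>
     X \<in> measurable M S \<and> Y \<in> measurable M R \<and>
     prob_space.indep_set M {X -` A \<inter> space M |A. A \<in> sets S} {Y -` B \<inter> space M |B. B \<in> sets R}"

text \<open>The index \<open>j\<close> of a cell runs through \<open>1..n+1\<close>; all other entries are empty.\<close>

fun mecke_cell ::
  "(real^2) set \<Rightarrow> (nat \<Rightarrow> (real^2) set) \<Rightarrow> (nat \<Rightarrow> nat) \<Rightarrow> nat \<Rightarrow> nat \<Rightarrow> (real^2) set" where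
  "mecke_cell W g a 0 j = (if j = 1 then W else {})"
| "mecke_cell W g a (Suc 0) j =
     (if j = 1 then W \<inter> plus_side (g 1) else if j = 2 then W \<inter> minus_side (g 1) else {})"
| "mecke_cell W g a (Suc (Suc m)) j =
     (let n = Suc (Suc m) in
        if j = n + 1 then mecke_cell W g a (Suc m) (a n) \<inter> plus_side (g n)
        else if j = a n then mecke_cell W g a (Suc m) (a n) \<inter> minus_side (g n)
        else mecke_cell W g a (Suc m) j)"

definition mecke_discrete ::
  "(real^2) set \<Rightarrow> (nat \<Rightarrow> (real^2) set) \<Rightarrow> (nat \<Rightarrow> nat) \<Rightarrow> nat \<Rightarrow> (real^2) set" where
  "mecke_discrete W g a n =
     closure ((\<Union>j\<in>{1..n+1}. frontier (mecke_cell W g a n j)) - frontier W)"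

definition cowan_jumps :: "(nat \<Rightarrow> real) \<Rightarrow> real \<Rightarrow> nat" where
  "cowan_jumps T t = Max {n. (\<Sum>k=1..n. T k) \<le> t}"

definition mecke_continuous ::
  "(real^2) set \<Rightarrow> (nat \<Rightarrow> (real^2) set) \<Rightarrow> (nat \<Rightarrow> nat) \<Rightarrow> (nat \<Rightarrow> real) \<Rightarrow> real \<Rightarrow> (real^2) set" where
  "mecke_continuous W g a T t = mecke_discrete W g a (cowan_jumps T t)"

definition mecke_data ::
  "(real^2) set measure \<Rightarrow> (real^2) set \<Rightarrow> 'a measure \<Rightarrow>
     (nat \<Rightarrow> 'a \<Rightarrow> (real^2) set) \<Rightarrow> (nat \<Rightarrow> 'a \<Rightarrow> nat) \<Rightarrow> (nat \<Rightarrow> 'a \<Rightarrow> real) \<Rightarrow> bool" where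
  "mecke_data \<Lambda> W M \<gamma> \<alpha> T \<longleftrightarrow>
     prob_space M \<and>
     prob_space.indep_vars M (\<lambda>_. line_space) \<gamma> {1..} \<and>
     (\<forall>j\<ge>1. distr M line_space (\<gamma> j) = uniform_measure \<Lambda> (hitting W)) \<and>
     prob_space.indep_vars M (\<lambda>_. count_space UNIV) \<alpha> {1..} \<and>
     (\<forall>j\<ge>1. distr M (count_space UNIV) (\<alpha> j) = measure_pmf (pmf_of_set {1..j})) \<and>
     indep_rvs M
       (Pi\<^sub>M {1..} (\<lambda>_. line_space)) (\<lambda>\<omega>. \<lambda>j\<in>{1..}. \<gamma> j \<omega>)
       (Pi\<^sub>M {1..} (\<lambda>_. count_space UNIV)) (\<lambda>\<omega>. \<lambda>j\<in>{1..}. \<alpha> j \<omega>) \<and>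
     prob_space.indep_vars M (\<lambda>_. borel) T {1..} \<and>
     (\<forall>k\<ge>1. distributed M lborel (T k)
        (exponential_density (real k * measure \<Lambda> (hitting W)))) \<and>
     indep_rvs M
       (Pi\<^sub>M {0..} (\<lambda>_. count_space UNIV)) (\<lambda>\<omega>. \<lambda>t\<in>{0..}. cowan_jumps (\<lambda>k. T k \<omega>) t)
       (Pi\<^sub>M {1..} (\<lambda>_. line_space) \<Otimes>\<^sub>M Pi\<^sub>M {1..} (\<lambda>_. count_space UNIV))
       (\<lambda>\<omega>. (\<lambda>j\<in>{1..}. \<gamma> j \<omega>, \<lambda>j\<in>{1..}. \<alpha> j \<omega>))"

section \<open>Equality in distribution\<close>

definition eq_in_distribution ::
  "'c measure \<Rightarrow> 'a measure \<Rightarrow> ('a \<Rightarrow> 'c) \<Rightarrow> 'b measure \<Rightarrow> ('b \<Rightarrow> 'c) \<Rightarrow> bool" where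
  "eq_in_distribution S M X N Y \<longleftrightarrow>
     X \<in> measurable M S \<and> Y \<in> measurable N S \<and> distr M S X = distr N S Y"

end

theory Submission
  imports Defs
begin

text \<open>The law of a process of random closed sets is determined by the probabilities that
  it misses an open set \<open>U\<close> at time \<open>t\<close> for all \<open>(t, U)\<close> in a finite set \<open>F\<close>. For both processes this
  event is a condition on each cell separately, so its probability, as a function \<open>surv C r\<close> of a
  single initial cell \<open>C\<close> and the starting time \<open>r\<close>, satisfies a backward equation in which the
  solutions for the two parts of a divided cell are multiplied.

  In the STIT process the cell \<open>C\<close> is divided at rate \<open>\<Lambda>([C])\<close> by a line hitting it. In the Mecke
  process every cell, the empty ones included, is chosen at rate \<open>\<Lambda>([W])\<close> and a line hitting \<open>W\<close> is
  drawn. If it misses \<open>C\<close>, then \<open>C\<close> is replaced by itself and an empty cell; so the effective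
  divisions again have rate \<open>\<Lambda>([C])\<close>, and the two backward equations have the same solutions.

  The product of \<open>surv\<close> over the current cells is a martingale along the generations of the STIT
  tree and along the jumps of the Mecke process. As neither process explodes, both
  probabilities equal \<open>surv W 0\<close>. Lines that touch a cell without cutting it contain an extreme
  point of \<open>W\<close> and form a null set, by translation invariance.\<close>

section \<open>Lines and half-planes\<close>

text \<open>No uniqueness theorem for the backward equation is used. \<open>surv\<close> is
  constructed once, as the limit of an increasing iteration of the STIT equation, and the same
  function is then shown to solve the Mecke equation; so the two martingales meet in
  \<open>surv W 0\<close>. Passing from one cell to finitely many rests on the fact that a product
  of solutions solves the equation of the joint process, in which the next event belongs to one of
  the factors (\<open>mild_mult\<close>). The horizon \<open>T\<close> lies after all test times.
  From \<open>T\<close> on \<open>surv\<close> is 1, so the product over the current cells differs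
  from 1 only while some cell is born before \<open>T\<close>, and Laplace transforms make the
  probability of that vanish. Values in \<open>ennreal\<close> free Fubini and the algebra of the
  equations from integrability. In the Mecke data the jump process, rather than the sequence of
  waiting times, is stated to be independent of lines and labels; hence the computation takes place
  on a product of three copies of the probability space and is carried back through the law of the
  jump process.\<close>

abbreviation normal :: "real \<Rightarrow> real^2" where
  "normal \<theta> \<equiv> vector [cos \<theta>, sin \<theta>]"

lemma inner_normal: "normal \<theta> \<bullet> x = cos \<theta> * x$1 + sin \<theta> * x$2"
  by (simp add: inner_vec_def sum_2)

lemma normal_normal [simp]: "normal \<theta> \<bullet> normal \<theta> = 1"
  by (simp add: inner_normal flip: power2_eq_square)

lemma norm_normal: "norm (normal \<theta>) = 1"
  by (simp add: norm_eq_1)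

lemma line_of_iff: "x \<in> line_of (\<theta>, r) \<longleftrightarrow> normal \<theta> \<bullet> x = r"
  by (simp add: line_of_def)

text \<open>Half-planes are defined through an arbitrary equation \<open>a \<bullet> y = b\<close>
  of the line; every such equation is a multiple of the normal form. A foot point and its translate
  by the direction \<open>?m\<close> both satisfy it, which makes \<open>a\<close> orthogonal to
  \<open>?m\<close>.\<close>

lemma hyperplane_eq_line_of:
  assumes "line_of (\<theta>, r) = {y. a \<bullet> y = b}"
  shows "a = (a \<bullet> normal \<theta>) *\<^sub>R normal \<theta>" and "b = (a \<bullet> normal \<theta>) * r"
proof -
  let ?n = "normal \<theta>" and ?m = "vector [- sin \<theta>, cos \<theta>] :: real^2"
  have nm: "?n \<bullet> ?m = 0" by (simp add: inner_normal)
  have "r *\<^sub>R ?n \<in> line_of (\<theta>, r)" "r *\<^sub>R ?n + ?m \<in> line_of (\<theta>, r)"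
    using nm by (simp_all add: line_of_iff inner_add_right)
  then have 1: "a \<bullet> (r *\<^sub>R ?n) = b" and "a \<bullet> (r *\<^sub>R ?n + ?m) = b" using assms by auto
  then have "a \<bullet> ?m = 0" by (simp add: inner_add_right)
  then have m: "a$2 * cos \<theta> = a$1 * sin \<theta>" by (simp add: inner_vec_def sum_2)
  show "b = (a \<bullet> ?n) * r" using 1 by (simp add: mult.commute)
  have "(a \<bullet> ?n) * cos \<theta> = a$1" "(a \<bullet> ?n) * sin \<theta> = a$2"
  proof -
    have "(a \<bullet> ?n) * cos \<theta> = a$1 * (cos \<theta> * cos \<theta>) + (a$2 * cos \<theta>) * sin \<theta>"
      by (simp add: inner_vec_def sum_2 algebra_simps)
    also have "\<dots> = a$1 * (cos \<theta> * cos \<theta> + sin \<theta> * sin \<theta>)" unfolding m by (simp only: distrib_left mult.assoc)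
    finally show "(a \<bullet> ?n) * cos \<theta> = a$1" by (simp only: sin_cos_squared_add3 mult_1_right)
    have "(a \<bullet> ?n) * sin \<theta> = (a$1 * sin \<theta>) * cos \<theta> + a$2 * (sin \<theta> * sin \<theta>)"
      by (simp add: inner_vec_def sum_2 algebra_simps)
    also have "\<dots> = a$2 * (cos \<theta> * cos \<theta> + sin \<theta> * sin \<theta>)" unfolding m[symmetric] by (simp only: distrib_left mult.assoc)
    finally show "(a \<bullet> ?n) * sin \<theta> = a$2" by (simp only: sin_cos_squared_add3 mult_1_right)
  qed
  then show "a = (a \<bullet> ?n) *\<^sub>R ?n"
    by (simp add: vec_eq_iff forall_2)
qed

text \<open>For \<open>r = 0\<close> no equation of the line has \<open>0 < b\<close>, so the side
  is empty; otherwise the sign of \<open>r\<close> tells on which side the origin lies.\<close>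

lemma plus_side_line_of:
  "x \<in> plus_side (line_of (\<theta>, r)) \<longleftrightarrow> (0 < r \<and> normal \<theta> \<bullet> x < r) \<or> (r < 0 \<and> normal \<theta> \<bullet> x > r)"
  (is "?L \<longleftrightarrow> ?R")
proof
  assume ?L
  then obtain a b where g: "line_of (\<theta>, r) = {y. a \<bullet> y = b}" and b: "0 < b" "a \<bullet> x < b"
    by (auto simp: plus_side_def)
  define c where "c = a \<bullet> normal \<theta>"
  have a: "a = c *\<^sub>R normal \<theta>" and br: "b = c * r"
    unfolding c_def by (rule hyperplane_eq_line_of[OF g])+
  have "c * (normal \<theta> \<bullet> x) < c * r" "0 < c * r" using b by (simp_all add: a br)
  then show ?R by (auto simp: zero_less_mult_iff mult_less_cancel_left)
next
  assume ?R
  then show ?L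
  proof
    assume "0 < r \<and> normal \<theta> \<bullet> x < r"
    then show ?L unfolding plus_side_def line_of_def
      by (intro CollectI exI[of _ "normal \<theta>"] exI[of _ r]) auto
  next
    assume "r < 0 \<and> normal \<theta> \<bullet> x > r"
    then show ?L unfolding plus_side_def line_of_def
      by (intro CollectI exI[of _ "- normal \<theta>"] exI[of _ "- r"]) auto
  qed
qed

lemma minus_side_line_of:
  "x \<in> minus_side (line_of (\<theta>, r)) \<longleftrightarrow> (0 < r \<and> normal \<theta> \<bullet> x > r) \<or> (r < 0 \<and> normal \<theta> \<bullet> x < r)"
  (is "?L \<longleftrightarrow> ?R")
proof
  assume ?L
  then obtain a b where g: "line_of (\<theta>, r) = {y. a \<bullet> y = b}" and b: "0 < b" "a \<bullet> x > b"
    by (auto simp: minus_side_def)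
  define c where "c = a \<bullet> normal \<theta>"
  have a: "a = c *\<^sub>R normal \<theta>" and br: "b = c * r"
    unfolding c_def by (rule hyperplane_eq_line_of[OF g])+
  have "c * (normal \<theta> \<bullet> x) > c * r" "0 < c * r" using b by (simp_all add: a br)
  then show ?R by (auto simp: zero_less_mult_iff mult_less_cancel_left)
next
  assume ?R
  then show ?L
  proof
    assume "0 < r \<and> normal \<theta> \<bullet> x > r"
    then show ?L unfolding minus_side_def line_of_def
      by (intro CollectI exI[of _ "normal \<theta>"] exI[of _ r]) auto
  next
    assume "r < 0 \<and> normal \<theta> \<bullet> x < r"
    then show ?L unfolding minus_side_def line_of_def
      by (intro CollectI exI[of _ "- normal \<theta>"] exI[of _ "- r"]) auto
  qed
qed

lemma lines_cases:
  assumes "g \<in> lines"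
  obtains \<theta> r where "g = line_of (\<theta>, r)" "0 \<le> \<theta>" "\<theta> < pi"
proof -
  have "g \<in> space line_space" using assms by (simp add: space_line_space)
  then show ?thesis
    using that by (auto simp: line_space_def space_embed_measure space_restrict_space)
qed

text \<open>Sets of lines are images of Borel sets of parameters, and \<open>line_of\<close> makes
  sense for all real angles, so a map may be tested on the whole parameter plane.\<close>

lemma measurable_line_spaceI:
  assumes "(\<lambda>p. f (line_of (fst p, snd p))) \<in> measurable (borel \<Otimes>\<^sub>M borel) N"
  shows "f \<in> measurable line_space N"
proof -
  have "(\<lambda>p. f (line_of p)) \<in> measurable (restrict_space borel ({0..<pi} \<times> UNIV)) N"
    using assms by (simp add: borel_prod measurable_restrict_space1)
  then show ?thesis
    unfolding line_space_def by (rule measurable_embed_measure1)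
qed

lemma pred_line [measurable]:
  shows "Measurable.pred line_space (\<lambda>g. x \<in> plus_side g)"
    and "Measurable.pred line_space (\<lambda>g. x \<in> minus_side g)"
    and "Measurable.pred line_space (\<lambda>g. x \<in> g)"
proof -
  have [measurable]: "(\<lambda>p. normal (fst p) \<bullet> x) \<in> borel_measurable (borel \<Otimes>\<^sub>M borel :: (real \<times> real) measure)"
    unfolding inner_normal borel_prod by (intro borel_measurable_continuous_onI continuous_intros)
  show "Measurable.pred line_space (\<lambda>g. x \<in> plus_side g)"
    by (rule measurable_line_spaceI) (unfold plus_side_line_of, measurable)
  show "Measurable.pred line_space (\<lambda>g. x \<in> minus_side g)"
    by (rule measurable_line_spaceI) (unfold minus_side_line_of, measurable)
  show "Measurable.pred line_space (\<lambda>g. x \<in> g)"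
    by (rule measurable_line_spaceI) (unfold line_of_iff, measurable)
qed

lemma plus_side_facts:
  assumes "g \<in> lines"
  shows "open (plus_side g)" "convex (plus_side g)" "open (minus_side g)" "convex (minus_side g)"
    "plus_side g \<inter> minus_side g = {}" "g \<inter> plus_side g = {}" "g \<inter> minus_side g = {}"
    "0 \<notin> g \<Longrightarrow> plus_side g \<union> minus_side g = - g"
proof -
  obtain \<theta> r where g: "g = line_of (\<theta>, r)" using lines_cases[OF assms] by metis
  have p: "plus_side g = (if r > 0 then {x. normal \<theta> \<bullet> x < r} else if r < 0 then {x. normal \<theta> \<bullet> x > r} else {})"
    by (auto simp: g plus_side_line_of)
  have m: "minus_side g = (if r > 0 then {x. normal \<theta> \<bullet> x > r} else if r < 0 then {x. normal \<theta> \<bullet> x < r} else {})"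
    by (auto simp: g minus_side_line_of)
  show "open (plus_side g)" "convex (plus_side g)" "open (minus_side g)" "convex (minus_side g)"
    unfolding p m by (auto simp: open_halfspace_lt open_halfspace_gt convex_halfspace_lt convex_halfspace_gt)
  show "plus_side g \<inter> minus_side g = {}" "g \<inter> plus_side g = {}" "g \<inter> minus_side g = {}"
    unfolding p m by (auto simp: g line_of_iff)
  show "0 \<notin> g \<Longrightarrow> plus_side g \<union> minus_side g = - g"
    unfolding p m by (auto simp: g line_of_iff)
qed

lemma sets_line_spaceI:
  assumes "closed S" and "\<And>\<theta> r. 0 \<le> \<theta> \<Longrightarrow> \<theta> < pi \<Longrightarrow> (\<theta>, r) \<in> S \<longleftrightarrow> line_of (\<theta>, r) \<in> A" and "A \<subseteq> lines"
  shows "A \<in> sets line_space"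
proof -
  let ?P = "restrict_space borel ({0..<pi} \<times> UNIV) :: (real \<times> real) measure"
  have "A = line_of ` (S \<inter> ({0..<pi} \<times> UNIV))"
  proof
    show "A \<subseteq> line_of ` (S \<inter> ({0..<pi} \<times> UNIV))"
    proof
      fix g assume g: "g \<in> A"
      then obtain \<theta> r where "g = line_of (\<theta>, r)" "0 \<le> \<theta>" "\<theta> < pi"
        using lines_cases assms(3) by (metis subsetD)
      then show "g \<in> line_of ` (S \<inter> ({0..<pi} \<times> UNIV))" using g assms(2) by auto
    qed
  qed (use assms(2) in auto)
  moreover have "S \<inter> ({0..<pi} \<times> UNIV) \<in> sets ?P"
    using assms(1) by (subst Int_commute) (simp add: sets_restrict_space borel_closed)
  ultimately show ?thesis
    unfolding line_space_def by (metis in_sets_embed_measure)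
qed

lemma hitting_compact_measurable:
  assumes "compact K"
  shows "hitting K \<in> sets line_space"
proof (rule sets_line_spaceI)
  \<comment> \<open>The parameters of all lines hitting \<open>K\<close> are values of this
    continuous map. The angle \<pi> is included for compactness; the criterion compares only
    parameters with angle below \<pi>.\<close>
  define f where "f = (\<lambda>(\<theta>::real, x::real^2). (\<theta>, normal \<theta> \<bullet> x))"
  have "compact (f ` ({0..pi} \<times> K))"
    unfolding f_def split_beta inner_normal
    by (intro compact_continuous_image compact_Times assms compact_Icc continuous_intros)
  then show "closed (f ` ({0..pi} \<times> K))" by (rule compact_imp_closed)
  fix \<theta> r assume "0 \<le> \<theta>" "\<theta> < pi"
  then have "(\<theta>, r) \<in> f ` ({0..pi} \<times> K) \<longleftrightarrow> (\<exists>x\<in>K. normal \<theta> \<bullet> x = r)"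
    unfolding f_def by force
  also have "\<dots> \<longleftrightarrow> line_of (\<theta>, r) \<in> hitting K"
    unfolding hitting_def disjoint_iff using line_of_in_lines line_of_iff by blast
  finally show "(\<theta>, r) \<in> f ` ({0..pi} \<times> K) \<longleftrightarrow> line_of (\<theta>, r) \<in> hitting K" .
qed (auto simp: hitting_def)

text \<open>Any \<open>n\<close> of the sets, each of measure \<open>e\<close>, fit almost
  disjointly into \<open>H\<close>, so \<open>n * e\<close> stays below the finite measure of
  \<open>H\<close> for all \<open>n\<close>.\<close>

lemma almost_disjoint_imp_null:
  fixes A :: "nat \<Rightarrow> 'a set"
  assumes A: "\<And>k. A k \<in> sets M" "\<And>k. emeasure M (A k) = e" "\<And>k. A k \<subseteq> H"
    and H: "H \<in> sets M" "emeasure M H < \<infinity>"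
    and disj: "AE x in M. \<forall>i j. x \<in> A i \<longrightarrow> x \<in> A j \<longrightarrow> i = j"
  shows "e = 0"
proof -
  have le: "of_nat n * e \<le> emeasure M H" for n
  proof -
    have "of_nat n * e = (\<Sum>k<n. \<integral>\<^sup>+x. indicator (A k) x \<partial>M)"
      using A by simp
    also have "\<dots> = (\<integral>\<^sup>+x. (\<Sum>k<n. indicator (A k) x) \<partial>M)"
      using A(1) by (intro nn_integral_sum[symmetric]) auto
    also have "\<dots> \<le> (\<integral>\<^sup>+x. indicator H x \<partial>M)"
    proof (rule nn_integral_mono_AE, use disj in eventually_elim)
      case (elim x)
      show "(\<Sum>k<n. indicator (A k) x) \<le> (indicator H x :: ennreal)"
      proof (cases "\<exists>i<n. x \<in> A i")
        case True
        then obtain i where i: "i < n" "x \<in> A i" by auto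
        have "(\<Sum>k<n. indicator (A k) x) = (\<Sum>k<n. if k = i then 1 else 0 :: ennreal)"
          using elim i by (intro sum.cong) (auto simp: indicator_def)
        then show ?thesis using i A(3)[of i] by (auto simp: indicator_def)
      next
        case False
        then have "(\<Sum>k<n. indicator (A k) x) = (0::ennreal)" by (auto simp: indicator_def)
        then show ?thesis by simp
      qed
    qed
    finally show ?thesis using H(1) by simp
  qed
  have fin: "e < \<infinity>" using le[of 1] H(2) by auto
  define a where "a = enn2real e"
  define b where "b = enn2real (emeasure M H)"
  have e: "e = ennreal a" "a \<ge> 0" and b: "emeasure M H = ennreal b" "b \<ge> 0"
    using fin H(2) by (auto simp: a_def b_def)
  have nb: "real n * a \<le> b" for n
  proof -
    have "ennreal (real n * a) = of_nat n * e"
      unfolding e(1) ennreal_of_nat_eq_real_of_nat by (rule ennreal_mult) (use e(2) in auto)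
    also have "\<dots> \<le> ennreal b" using le b(1) by simp
    finally show ?thesis using b(2) by simp
  qed
  have "a \<le> 0"
  proof (rule ccontr)
    assume "\<not> a \<le> 0"
    then obtain n :: nat where "b < real n * a" using reals_Archimedean3[of a] by auto
    then show False using nb[of n] by simp
  qed
  then show ?thesis using e by simp
qed

section \<open>Translation invariance and null sets of lines\<close>

lemma translate_line_of: "(+) (s *\<^sub>R normal \<theta>) ` line_of (\<theta>, r) = line_of (\<theta>, r + s)"
proof -
  have "y \<in> (+) (s *\<^sub>R normal \<theta>) ` line_of (\<theta>, r) \<longleftrightarrow> y - s *\<^sub>R normal \<theta> \<in> line_of (\<theta>, r)" for y
    by (auto simp: image_iff intro!: bexI[of _ "y - s *\<^sub>R normal \<theta>"])
  then show ?thesis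
    by (intro set_eqI) (simp only: line_of_iff inner_diff_right inner_scaleR_right normal_normal mult_1_right diff_eq_eq)
qed

lemma translate_lines: "g \<in> lines \<Longrightarrow> (+) v ` g \<in> lines"
  by (auto simp: lines_def affine_translation[symmetric] aff_dim_translation_eq)

lemma line_unique:
  assumes "g \<in> lines" "h \<in> lines" "x \<noteq> y" "x \<in> g" "y \<in> g" "x \<in> h" "y \<in> h"
  shows "g = h"
proof -
  have *: "affine hull {x, y} = k" if "k \<in> lines" "x \<in> k" "y \<in> k" for k
  proof (rule affine_dim_equal)
    show "aff_dim (affine hull {x, y}) = aff_dim k"
      using that \<open>x \<noteq> y\<close> by (simp add: lines_def aff_dim_affine_hull aff_dim_2)
    show "affine hull {x, y} \<subseteq> k" using that by (intro hull_minimal) (auto simp: lines_def)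
  qed (use that in \<open>auto simp: lines_def affine_affine_hull\<close>)
  show ?thesis using *[of g] *[of h] assms by auto
qed

lemma lines_two_points:
  assumes "h \<in> lines"
  obtains x y where "x \<in> h" "y \<in> h" "x \<noteq> y"
proof -
  have h: "affine h" "aff_dim h = 1" using assms by (auto simp: lines_def)
  have ne: "h \<noteq> {}" using h(2) by auto
  then obtain x where x: "x \<in> h" by auto
  have "h \<noteq> {x}" using h(2) by auto
  then show thesis using that x by blast
qed

lemma singleton_line_measurable:
  assumes "h \<in> lines"
  shows "{h} \<in> sets line_space"
proof -
  obtain x y where xy: "x \<in> h" "y \<in> h" "x \<noteq> y"
    by (rule lines_two_points[OF assms])
  have "{h} = {g \<in> space line_space. x \<in> g \<and> y \<in> g}"
    unfolding space_line_space using line_unique[OF _ assms xy(3)] assms xy by blast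
  also have "\<dots> \<in> sets line_space" by measurable
  finally show ?thesis .
qed

text \<open>Moving the line along its normal by \<open>1 / Suc k\<close> gives infinitely many
  different parallel lines of equal measure, all hitting one ball of radius 1.\<close>

lemma null_single_line:
  assumes sets: "sets \<Lambda> = sets line_space" and lf: "locally_finite_lines \<Lambda>"
    and ti: "translation_invariant_lines \<Lambda>" and g: "g \<in> lines"
  shows "emeasure \<Lambda> {g} = 0"
proof -
  obtain \<theta> r where gl: "g = line_of (\<theta>, r)" using lines_cases[OF g] by metis
  let ?p = "r *\<^sub>R normal \<theta>" and ?A = "\<lambda>k::nat. {line_of (\<theta>, r + 1 / Suc k)}"
  have single: "{h} \<in> sets \<Lambda>" if "h \<in> lines" for h
    using singleton_line_measurable[OF that] by (simp add: sets)
  show ?thesis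
  proof (rule almost_disjoint_imp_null)
    show "?A k \<in> sets \<Lambda>" for k by (rule single[OF line_of_in_lines])
    show "emeasure \<Lambda> (?A k) = emeasure \<Lambda> {g}" for k
    proof -
      have "emeasure \<Lambda> ((\<lambda>g. (+) ((1 / Suc k) *\<^sub>R normal \<theta>) ` g) ` {g}) = emeasure \<Lambda> {g}"
        using ti single[OF g] unfolding translation_invariant_lines_def by blast
      then show ?thesis by (simp add: gl translate_line_of)
    qed
    show "?A k \<subseteq> hitting (cball ?p 1)" for k
    proof -
      have "?p + (1 / Suc k) *\<^sub>R normal \<theta> \<in> line_of (\<theta>, r + 1 / Suc k) \<inter> cball ?p 1"
        by (simp add: line_of_iff inner_add_right dist_norm norm_normal)
      then show ?thesis by (auto simp: hitting_def line_of_in_lines)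
    qed
    show "hitting (cball ?p 1) \<in> sets \<Lambda>"
      by (simp add: sets hitting_compact_measurable)
    show "emeasure \<Lambda> (hitting (cball ?p 1)) < \<infinity>"
      using lf by (auto simp: locally_finite_lines_def)
    have "i = j" if "line_of (\<theta>, r + 1 / Suc i) = line_of (\<theta>, r + 1 / Suc j)" for i j
    proof -
      have "(r + 1 / Suc i) *\<^sub>R normal \<theta> \<in> line_of (\<theta>, r + 1 / Suc j)"
        unfolding that[symmetric] by (simp add: line_of_iff)
      then show ?thesis by (simp add: line_of_iff)
    qed
    then show "AE x in \<Lambda>. \<forall>i j. x \<in> ?A i \<longrightarrow> x \<in> ?A j \<longrightarrow> i = j"
      by auto
  qed
qed

text \<open>The sets of lines through infinitely many points of a segment have the same measure, by
  translation invariance, and are disjoint up to the one line containing the segment.\<close>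

lemma null_lines_through_point:
  assumes sets: "sets \<Lambda> = sets line_space" and lf: "locally_finite_lines \<Lambda>"
    and ti: "translation_invariant_lines \<Lambda>"
  shows "AE g in \<Lambda>. x \<notin> g"
proof -
  have sp: "space \<Lambda> = lines" using sets_eq_imp_space_eq[OF sets] by (simp add: space_line_space)
  let ?T = "\<lambda>x. {g \<in> lines. x \<in> g}"
  have T: "?T y \<in> sets \<Lambda>" for y
  proof -
    have "{g \<in> space line_space. y \<in> g} \<in> sets line_space" by measurable
    then show ?thesis by (simp add: sets space_line_space)
  qed
  \<comment> \<open>Translation by \<open>y - x\<close> carries the pencil of lines through
    \<open>x\<close> onto the pencil through \<open>y\<close>.\<close>
  have eq: "emeasure \<Lambda> (?T y) = emeasure \<Lambda> (?T x)" for y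
  proof -
    have tr: "(+) v ` k \<in> ?T (v + w)" if "k \<in> ?T w" for v w k
      using that translate_lines[of k v] by blast
    have "(\<lambda>g. (+) (y - x) ` g) ` ?T x \<subseteq> ?T y"
    proof
      fix h assume "h \<in> (\<lambda>g. (+) (y - x) ` g) ` ?T x"
      then obtain k where "k \<in> ?T x" "h = (+) (y - x) ` k" by blast
      then show "h \<in> ?T y" using tr[of k x "y - x"] by simp
    qed
    moreover have "?T y \<subseteq> (\<lambda>g. (+) (y - x) ` g) ` ?T x"
    proof
      fix h assume h: "h \<in> ?T y"
      have "h = (+) (y - x) ` ((+) (x - y) ` h)" by (simp add: image_image)
      moreover have "(+) (x - y) ` h \<in> ?T x" using tr[OF h, of "x - y"] by simp
      ultimately show "h \<in> (\<lambda>g. (+) (y - x) ` g) ` ?T x" by (rule image_eqI)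
    qed
    ultimately have eq: "(\<lambda>g. (+) (y - x) ` g) ` ?T x = ?T y" by (rule equalityI)
    have "emeasure \<Lambda> ((\<lambda>g. (+) (y - x) ` g) ` ?T x) = emeasure \<Lambda> (?T x)"
      using ti[unfolded translation_invariant_lines_def] T[of x] by blast
    then show ?thesis unfolding eq .
  qed
  \<comment> \<open>The points \<open>p k\<close> lie on the first coordinate axis and in the unit
    ball. The axis is \<open>h\<close>, with normal angle \<open>pi / 2\<close> and distance 0; it
    is the only line through two of the points.\<close>
  define e1 :: "real^2" where "e1 = axis 1 1"
  define p where "p k = (1 / Suc k) *\<^sub>R e1" for k :: nat
  have e1: "norm e1 = 1" "e1 \<noteq> 0" by (auto simp: e1_def axis_eq_0_iff)
  have p_eq: "p i = p j \<longleftrightarrow> i = j" for i j using e1 by (auto simp: p_def)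
  define h where "h = line_of (pi / 2, 0)"
  have h: "h \<in> lines" by (simp add: h_def line_of_in_lines)
  have ph: "p k \<in> h" for k unfolding h_def line_of_iff inner_normal p_def e1_def by (simp add: axis_def)
  have "emeasure \<Lambda> (?T x) = 0"
  proof (rule almost_disjoint_imp_null)
    show "?T (p k) \<in> sets \<Lambda>" for k by (rule T)
    show "emeasure \<Lambda> (?T (p k)) = emeasure \<Lambda> (?T x)" for k by (rule eq)
    show "?T (p k) \<subseteq> hitting (cball 0 1)" for k
    proof -
      have "p k \<in> cball 0 1" by (simp add: p_def e1)
      then show ?thesis by (auto simp: hitting_def)
    qed
    show "hitting (cball 0 1) \<in> sets \<Lambda>"
      by (simp add: sets hitting_compact_measurable)
    show "emeasure \<Lambda> (hitting (cball 0 1)) < \<infinity>"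
      using lf by (auto simp: locally_finite_lines_def)
    have "AE g in \<Lambda>. g \<noteq> h"
      using singleton_line_measurable[OF h] sets
      by (intro AE_I[OF _ null_single_line[OF sets lf ti h]]) auto
    then show "AE g in \<Lambda>. \<forall>i j. g \<in> ?T (p i) \<longrightarrow> g \<in> ?T (p j) \<longrightarrow> i = j"
      by eventually_elim (use line_unique[OF _ h] ph p_eq in blast)
  qed
  then show ?thesis
    by (intro AE_I[OF _ _ T[of x]]) (auto simp: sp)
qed

text \<open>The linear form defining \<open>g\<close> is extremal over \<open>C\<close> at a point
  of \<open>g\<close>. Since \<open>C\<close> is open in the convex set \<open>W\<close>, this local
  extremum is one over \<open>W\<close>, so \<open>g\<close> supports \<open>W\<close> and cuts out
  a compact face, which has an extreme point.\<close>

lemma touching_contains_extreme_point: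
  assumes W: "compact W" "convex W" and C: "openin (top_of_set W) C"
    and g: "g \<in> lines" "0 \<notin> g" and hit: "g \<inter> C \<noteq> {}"
    and side: "C \<inter> plus_side g = {} \<or> C \<inter> minus_side g = {}"
  shows "\<exists>v. v extreme_point_of W \<and> v \<in> g"
proof -
  obtain \<theta> r where gl: "g = line_of (\<theta>, r)" using lines_cases[OF g(1)] by metis
  have r: "r \<noteq> 0" using g(2) by (auto simp: gl line_of_iff)
  obtain a b where ab: "g = {y. a \<bullet> y = b}" "\<And>y. y \<in> C \<Longrightarrow> a \<bullet> y \<le> b"
  proof (cases "\<forall>y\<in>C. normal \<theta> \<bullet> y \<le> r")
    case True
    then show thesis using that[of "normal \<theta>" r] by (auto simp: gl line_of_def)
  next
    case False
    then have "\<forall>y\<in>C. normal \<theta> \<bullet> y \<ge> r"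
      using side r unfolding gl disjoint_iff plus_side_line_of minus_side_line_of
      by (meson linorder_less_linear linorder_not_le)
    then show thesis using that[of "- normal \<theta>" "- r"] by (auto simp: gl line_of_def)
  qed
  obtain x where x: "x \<in> g" "x \<in> C" using hit by auto
  obtain V where V: "open V" "C = W \<inter> V" using C by (auto simp: openin_open)
  have le: "a \<bullet> y \<le> b" if "y \<in> W" for y
  proof (rule ccontr)
    assume n: "\<not> a \<bullet> y \<le> b"
    \<comment> \<open>A short step from \<open>x\<close> towards \<open>y\<close> stays in
      \<open>C\<close>, where the linear form would already exceed \<open>b\<close>.\<close>
    have "((\<lambda>e. x + e *\<^sub>R (y - x)) \<longlongrightarrow> x + 0 *\<^sub>R (y - x)) (at_right 0)"
      by (intro tendsto_intros)
    then have "\<forall>\<^sub>F e in at_right 0. x + e *\<^sub>R (y - x) \<in> V"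
      using V x by (intro topological_tendstoD) auto
    moreover have "\<forall>\<^sub>F e in at_right (0::real). e > 0 \<and> e < 1"
      by (intro eventually_conj eventually_at_right_less eventually_at_rightI[of 0 1]) auto
    ultimately have "\<forall>\<^sub>F e in at_right 0. x + e *\<^sub>R (y - x) \<in> V \<and> e > 0 \<and> e < 1"
      by (rule eventually_conj)
    then obtain e where e: "x + e *\<^sub>R (y - x) \<in> V" "e > 0" "e < 1"
      using eventually_happens trivial_limit_at_right_real by blast
    have eq: "x + e *\<^sub>R (y - x) = (1 - e) *\<^sub>R x + e *\<^sub>R y" by (simp add: algebra_simps)
    have "x + e *\<^sub>R (y - x) \<in> W"
      unfolding eq using W(2) x that V e by (intro convexD) auto
    then have "a \<bullet> (x + e *\<^sub>R (y - x)) \<le> b" using ab(2) e(1) V(2) by auto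
    then have "e * (a \<bullet> y - b) \<le> 0" using x(1) by (simp add: ab(1) inner_add_right inner_diff_right)
    then show False using n e by (simp add: mult_le_0_iff)
  qed
  let ?S = "W \<inter> {y. a \<bullet> y = b}"
  have face: "?S face_of W"
    by (rule face_of_Int_supporting_hyperplane_le[OF W(2) le])
  have "compact ?S" "convex ?S"
    using W face by (auto intro!: compact_Int_closed closed_hyperplane dest: face_of_imp_convex)
  moreover have "?S \<noteq> {}" using x V ab(1) by auto
  ultimately obtain v where v: "v extreme_point_of ?S"
    using extreme_point_exists_convex by blast
  then have "v extreme_point_of W" using extreme_point_of_face[OF face] by auto
  moreover have "v \<in> ?S" using v by (simp add: extreme_point_of_def)
  ultimately show ?thesis using ab(1) by blast
qed

section \<open>The measurable space of cells\<close>

text \<open>Cells are cut out of \<open>W\<close> by open half-planes. Relative openness lets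
  countably many points decide whether a cell meets an open set, and convexity lets them decide the
  same for its frontier. The empty set is included because Mecke divisions produce it.\<close>

definition cells :: "(real^2) set \<Rightarrow> (real^2) set set" where
  "cells W = {C. convex C \<and> openin (top_of_set W) C}"

text \<open>Generated by membership of single points: maps into this space are checked point by
  point, and all further events about cells are reduced to countably many such tests.\<close>

definition cell_space :: "(real^2) set \<Rightarrow> (real^2) set measure" where
  "cell_space W = sigma (cells W) {{C \<in> cells W. x \<in> C} | x. True}"

lemma space_cell_space: "space (cell_space W) = cells W"
  and sets_cell_space: "sets (cell_space W) = sigma_sets (cells W) {{C \<in> cells W. x \<in> C} | x. True}"
  unfolding cell_space_def by (auto intro!: space_measure_of sets_measure_of)

lemma pred_mem_cell [measurable]: "Measurable.pred (cell_space W) (\<lambda>C. x \<in> C)"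
proof -
  have "{C \<in> space (cell_space W). x \<in> C} \<in> sets (cell_space W)"
    unfolding space_cell_space sets_cell_space by (rule sigma_sets.Basic) blast
  then show ?thesis by (simp add: pred_def)
qed

lemma measurable_cell_spaceI:
  assumes "\<And>y. y \<in> space M \<Longrightarrow> f y \<in> cells W" and "\<And>x. Measurable.pred M (\<lambda>y. x \<in> f y)"
  shows "f \<in> measurable M (cell_space W)"
proof (rule measurable_sigma_sets[OF sets_cell_space])
  show "f \<in> space M \<rightarrow> cells W" using assms(1) by auto
  show "f -` A \<inter> space M \<in> sets M" if AA: "A \<in> {{C \<in> cells W. x \<in> C} | x. True}" for A
  proof -
    obtain x where A: "A = {C \<in> cells W. x \<in> C}" using AA by auto
    have "f -` A \<inter> space M = {y \<in> space M. x \<in> f y}" using assms(1) by (auto simp: A)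
    also have "\<dots> \<in> sets M" using assms(2)[of x] by (simp add: pred_def)
    finally show ?thesis .
  qed
qed auto

lemma cells_subset: "C \<in> cells W \<Longrightarrow> C \<subseteq> W"
  unfolding cells_def using openin_imp_subset by blast

lemma cells_top: "convex W \<Longrightarrow> W \<in> cells W"
  by (simp add: cells_def)

lemma cells_empty: "{} \<in> cells W"
  by (simp add: cells_def)

lemma cells_Int_open:
  assumes "C \<in> cells W" "open U" "convex U" shows "C \<inter> U \<in> cells W"
  using assms by (auto simp: cells_def intro!: convex_Int openin_Int_open)

lemma cells_plus_side: "C \<in> cells W \<Longrightarrow> g \<in> lines \<Longrightarrow> C \<inter> plus_side g \<in> cells W"
  and cells_minus_side: "C \<in> cells W \<Longrightarrow> g \<in> lines \<Longrightarrow> C \<inter> minus_side g \<in> cells W"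
  using cells_Int_open plus_side_facts by blast+

section \<open>Countable tests for cells\<close>

definition probe :: "(real^2) set \<Rightarrow> (real^2) set" where
  "probe W = (SOME D. countable D \<and> D \<subseteq> W \<and> W \<subseteq> closure D)"

lemma probe: "countable (probe W)" "probe W \<subseteq> W" "W \<subseteq> closure (probe W)"
proof -
  have "\<exists>D. countable D \<and> D \<subseteq> W \<and> W \<subseteq> closure D"
    by (rule separable[of W]) blast
  then have "countable (probe W) \<and> probe W \<subseteq> W \<and> W \<subseteq> closure (probe W)"
    unfolding probe_def by (rule someI_ex)
  then show "countable (probe W)" "probe W \<subseteq> W" "W \<subseteq> closure (probe W)" by auto
qed

text \<open>\<open>C \<inter> U\<close> is relatively open in \<open>W\<close>, so if it is
  non-empty it contains a point of the dense set \<open>probe W\<close>.\<close>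

lemma cell_meets_open_iff:
  assumes "C \<in> cells W" "open U"
  shows "C \<inter> U \<noteq> {} \<longleftrightarrow> (\<exists>x\<in>probe W. x \<in> C \<and> x \<in> U)"
proof
  assume "C \<inter> U \<noteq> {}"
  then obtain x where x: "x \<in> C" "x \<in> U" by auto
  obtain V where V: "open V" "C = W \<inter> V" using assms(1) by (auto simp: cells_def openin_open)
  have "x \<in> closure (probe W)" using x V probe(3) by auto
  moreover have "open (U \<inter> V)" "x \<in> U \<inter> V" using assms V x by auto
  ultimately have "(U \<inter> V) \<inter> probe W \<noteq> {}" using open_Int_closure_eq_empty[of "U \<inter> V" "probe W"] by blast
  then show "\<exists>x\<in>probe W. x \<in> C \<and> x \<in> U" using V probe(2) by auto
qed auto

lemma pred_countable_bounded:
  assumes "countable X" "\<And>i. i \<in> X \<Longrightarrow> Measurable.pred M (P i)"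
  shows "Measurable.pred M (\<lambda>x. \<forall>i\<in>X. P i x)" "Measurable.pred M (\<lambda>x. \<exists>i\<in>X. P i x)"
  using assms sets.sets_Collect_countable_All'[of X M P] sets.sets_Collect_countable_Ex'[of X M P]
  by (simp_all add: pred_def)

lemma pred_cell_meets_open [measurable]:
  assumes "open U"
  shows "Measurable.pred (cell_space W) (\<lambda>C. C \<inter> U \<noteq> {})"
proof -
  have [measurable]: "Measurable.pred (cell_space W) (\<lambda>C. \<exists>x\<in>probe W. x \<in> C \<and> x \<in> U)"
    by (intro pred_countable_bounded probe(1)) measurable
  then show ?thesis
    by (rule measurable_cong[THEN iffD2, rotated]) (simp add: space_cell_space cell_meets_open_iff assms)
qed

text \<open>Both open parts have to be non-empty, in contrast to \<open>hitting\<close>, which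
  includes lines that merely touch. A line through the origin has empty sides and hence cuts
  nothing.\<close>

definition cuts :: "(real^2) set \<Rightarrow> (real^2) set \<Rightarrow> bool" where
  "cuts C g \<longleftrightarrow> C \<inter> plus_side g \<noteq> {} \<and> C \<inter> minus_side g \<noteq> {}"

lemma pred_mem_cell_pair [measurable]:
  "Measurable.pred (cell_space W \<Otimes>\<^sub>M line_space) (\<lambda>p. x \<in> fst p)"
  "Measurable.pred (cell_space W \<Otimes>\<^sub>M line_space) (\<lambda>p. x \<in> plus_side (snd p))"
  "Measurable.pred (cell_space W \<Otimes>\<^sub>M line_space) (\<lambda>p. x \<in> minus_side (snd p))"
  by measurable

lemma pred_cuts [measurable]: "Measurable.pred (cell_space W \<Otimes>\<^sub>M line_space) (\<lambda>p. cuts (fst p) (snd p))"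
proof -
  have "Measurable.pred (cell_space W \<Otimes>\<^sub>M line_space) (\<lambda>p.
    (\<exists>x\<in>probe W. x \<in> fst p \<and> x \<in> plus_side (snd p)) \<and> (\<exists>x\<in>probe W. x \<in> fst p \<and> x \<in> minus_side (snd p)))"
    by (intro pred_intros_logic pred_countable_bounded probe(1) pred_mem_cell_pair)
  then show ?thesis
  proof (rule measurable_cong[THEN iffD2, rotated])
    fix p assume "p \<in> space (cell_space W \<Otimes>\<^sub>M line_space)"
    then have "fst p \<in> cells W" "snd p \<in> lines"
      by (auto simp: space_pair_measure space_cell_space space_line_space)
    then show "cuts (fst p) (snd p) \<longleftrightarrow> (\<exists>x\<in>probe W. x \<in> fst p \<and> x \<in> plus_side (snd p)) \<and>
        (\<exists>x\<in>probe W. x \<in> fst p \<and> x \<in> minus_side (snd p))"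
      unfolding cuts_def by (simp only: cell_meets_open_iff plus_side_facts)
  qed
qed

lemma measurable_split [measurable]:
  "(\<lambda>p. fst p \<inter> plus_side (snd p)) \<in> measurable (cell_space W \<Otimes>\<^sub>M line_space) (cell_space W)"
  "(\<lambda>p. fst p \<inter> minus_side (snd p)) \<in> measurable (cell_space W \<Otimes>\<^sub>M line_space) (cell_space W)"
  by (rule measurable_cell_spaceI;
      simp add: space_pair_measure space_cell_space space_line_space cells_plus_side cells_minus_side mem_Times_iff)+

text \<open>The right-hand side refers to countably many points of \<open>C\<close> only; hence measurability.\<close>

lemma frontier_disjoint_ball_iff:
  assumes "convex C"
  shows "frontier C \<inter> ball x e = {} \<longleftrightarrow> C \<inter> ball x e = {} \<or> (\<forall>y\<in>ball x e \<inter> probe UNIV. y \<in> C)"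
proof
  assume d: "frontier C \<inter> ball x e = {}"
  show "C \<inter> ball x e = {} \<or> (\<forall>y\<in>ball x e \<inter> probe UNIV. y \<in> C)"
  proof (rule ccontr)
    assume n: "\<not> ?thesis"
    then have "ball x e \<inter> C \<noteq> {}" "ball x e - C \<noteq> {}" by auto
    then have "ball x e \<inter> frontier C \<noteq> {}" by (intro connected_Int_frontier) auto
    then show False using d by auto
  qed
next
  assume "C \<inter> ball x e = {} \<or> (\<forall>y\<in>ball x e \<inter> probe UNIV. y \<in> C)"
  then show "frontier C \<inter> ball x e = {}"
  proof
    assume "C \<inter> ball x e = {}"
    then have "closure C \<inter> ball x e = {}"
      using open_Int_closure_eq_empty[of "ball x e" C] by blast
    then show ?thesis by (auto simp: frontier_def)
  next
    assume "\<forall>y\<in>ball x e \<inter> probe UNIV. y \<in> C"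
    then have "ball x e \<inter> probe UNIV \<subseteq> C" by auto
    then have "closure (ball x e \<inter> probe UNIV) \<subseteq> closure C" by (rule closure_mono)
    moreover have "ball x e \<subseteq> closure (ball x e \<inter> probe UNIV)"
      using probe(3)[of UNIV] open_Int_closure_subset[of "ball x e" "probe UNIV"] by auto
    \<comment> \<open>The dense points only place the ball in the closure of \<open>C\<close>; a
      convex set has the same interior as its closure.\<close>
    ultimately have "ball x e \<subseteq> interior (closure C)" by (intro interior_maximal) auto
    also have "\<dots> = interior C" by (rule convex_interior_closure[OF assms])
    finally show ?thesis by (auto simp: frontier_def)
  qed
qed

text \<open>An open set is a countable union of balls (Lindelof), and for balls the frontier test is
  a countable one.\<close>

lemma pred_frontier_disjoint [measurable]:
  assumes "open U"
  shows "Measurable.pred (cell_space W) (\<lambda>C. frontier C \<inter> U = {})"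
proof -
  obtain B where B: "B \<subseteq> {ball x e | x e. ball x e \<subseteq> U}" "countable B" "\<Union>B = \<Union>{ball x e | x e. ball x e \<subseteq> U}"
    by (rule Lindelof[of "{ball x e | x e. ball x e \<subseteq> U}"]) auto
  have U: "\<Union>B = U"
  proof (intro equalityI subsetI)
    fix x assume "x \<in> U"
    then obtain e where "e > 0" "ball x e \<subseteq> U" using assms open_contains_ball by metis
    then have "x \<in> ball x e" "ball x e \<in> {ball x e | x e. ball x e \<subseteq> U}" by auto
    then show "x \<in> \<Union>B" unfolding B(3) by blast
  qed (use B(1) in blast)
  have [measurable]: "Measurable.pred (cell_space W) (\<lambda>C. frontier C \<inter> ball x e = {})" for x e
  proof -
    have "countable (ball x e \<inter> probe UNIV)" using probe(1) by auto
    then have [measurable]: "Measurable.pred (cell_space W) (\<lambda>C. \<forall>y\<in>ball x e \<inter> probe UNIV. y \<in> C)"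
      by (intro pred_countable_bounded pred_mem_cell)
    have [measurable]: "Measurable.pred (cell_space W) (\<lambda>C. C \<inter> ball x e \<noteq> {})"
      by (intro pred_cell_meets_open open_ball)
    have "Measurable.pred (cell_space W) (\<lambda>C. \<not> C \<inter> ball x e \<noteq> {} \<or> (\<forall>y\<in>ball x e \<inter> probe UNIV. y \<in> C))"
      by measurable
    then show ?thesis
      by (rule measurable_cong[THEN iffD2, rotated])
         (simp add: space_cell_space cells_def frontier_disjoint_ball_iff)
  qed
  have "Measurable.pred (cell_space W) (\<lambda>C. \<forall>b\<in>B. frontier C \<inter> b = {})"
    using B(1) by (intro pred_countable_bounded B(2)) auto
  moreover have "(\<lambda>C. \<forall>b\<in>B. frontier C \<inter> b = {}) = (\<lambda>C. frontier C \<inter> U = {})"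
    unfolding U[symmetric] by (intro ext) blast
  ultimately show ?thesis by simp
qed

section \<open>Backward equations\<close>

text \<open>First-event decomposition with horizon \<open>T\<close>: \<open>U r\<close> is the probability of success for a process
  at time \<open>r\<close>, \<open>K r s\<close> that no event and no failure happens between \<open>r\<close> and \<open>s\<close>, and \<open>\<Phi> s\<close> is the
  rate of an event at time \<open>s\<close> times the probability of success after it.\<close>

definition mild :: "real \<Rightarrow> (real \<Rightarrow> real \<Rightarrow> ennreal) \<Rightarrow> (real \<Rightarrow> ennreal) \<Rightarrow> (real \<Rightarrow> ennreal) \<Rightarrow> bool" where
  "mild T K \<Phi> U \<longleftrightarrow> (\<forall>r<T. U r = K r T + (\<integral>\<^sup>+s\<in>{r<..<T}. K r s * \<Phi> s \<partial>lborel))"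

text \<open>The flow property of a probability that nothing happens between two times. It is shared
  by \<open>decay\<close> and the 0/1 factor \<open>unhit\<close>, and it survives products.\<close>

definition multiplicative :: "(real \<Rightarrow> real \<Rightarrow> ennreal) \<Rightarrow> bool" where
  "multiplicative K \<longleftrightarrow> (\<forall>r q s. r \<le> q \<longrightarrow> q \<le> s \<longrightarrow> K r s = K r q * K q s) \<and>
     (\<forall>r. K r \<in> borel_measurable borel)"

definition decay :: "real \<Rightarrow> real \<Rightarrow> real \<Rightarrow> ennreal" where
  "decay c r s = ennreal (exp (- c * (s - r)))"

lemma multiplicativeD: "multiplicative K \<Longrightarrow> r \<le> q \<Longrightarrow> q \<le> s \<Longrightarrow> K r s = K r q * K q s"
  unfolding multiplicative_def by blast

lemma multiplicative_measurable: "multiplicative K \<Longrightarrow> K r \<in> borel_measurable borel"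
  unfolding multiplicative_def by blast

lemma multiplicative_decay: "multiplicative (decay c)"
  unfolding multiplicative_def
proof safe
  fix r q s :: real
  have "exp (- c * (s - r)) = exp (- c * (q - r)) * exp (- c * (s - q))"
    unfolding exp_add[symmetric] by (rule arg_cong[of _ _ exp]) (simp add: algebra_simps)
  then show "decay c r s = decay c r q * decay c q s"
    unfolding decay_def by (simp add: ennreal_mult')
next
  fix r
  have "(\<lambda>s. decay c r s) \<in> borel_measurable borel" unfolding decay_def by measurable
  then show "decay c r \<in> borel_measurable borel" .
qed

lemma multiplicative_mult:
  assumes "multiplicative K" "multiplicative L"
  shows "multiplicative (\<lambda>r s. K r s * L r s)"
  unfolding multiplicative_def
proof safe
  fix r q s :: real assume "r \<le> q" "q \<le> s"
  then show "K r s * L r s = K r q * L r q * (K q s * L q s)"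
    by (simp add: multiplicativeD[OF assms(1), of r q s] multiplicativeD[OF assms(2), of r q s] mult_ac)
next
  fix r show "(\<lambda>s. K r s * L r s) \<in> borel_measurable borel"
    using assms[THEN multiplicative_measurable, of r] by measurable
qed

lemma multiplicative_1: "multiplicative (\<lambda>_ _. 1)"
  by (simp add: multiplicative_def)

lemma multiplicative_prod:
  "(\<And>i. i \<in> I \<Longrightarrow> multiplicative (K i)) \<Longrightarrow> multiplicative (\<lambda>r s. \<Prod>i\<in>I. K i r s)"
  by (induction I rule: infinite_finite_induct) (simp_all add: multiplicative_1 multiplicative_mult)

lemma decay_add: "decay c r s * decay d r s = decay (c + d) r s"
proof -
  have "exp (- (c + d) * (s - r)) = exp (- c * (s - r)) * exp (- d * (s - r))"
    unfolding exp_add[symmetric] by (rule arg_cong[of _ _ exp]) (simp add: algebra_simps)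
  then show ?thesis unfolding decay_def by (simp add: ennreal_mult')
qed

lemma decay_shift: "decay c r (r + l) = decay c 0 l"
  by (simp add: decay_def)

lemma decay_0: "decay 0 r s = 1"
  by (simp add: decay_def)

text \<open>Multiplying the equation at time \<open>s\<close> by \<open>K r s\<close> turns every
  kernel starting at \<open>s\<close> into one starting at \<open>r\<close>. In
  \<open>mild_mult\<close> this restarts one process at the event of the other.\<close>

lemma mild_restart:
  assumes U: "mild T K \<Phi> U" and K: "multiplicative K" and [measurable]: "\<Phi> \<in> borel_measurable borel"
    and s: "r < s" "s < T"
  shows "K r s * U s = K r T + (\<integral>\<^sup>+q. (K r q * \<Phi> q * indicator {r<..<T} q) * indicator {s<..} q \<partial>lborel)"
proof -
  note [measurable] = multiplicative_measurable[OF K]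
  have "K r s * U s = K r s * K s T + K r s * (\<integral>\<^sup>+q. K s q * \<Phi> q * indicator {s<..<T} q \<partial>lborel)"
    using U s by (simp add: mild_def distrib_left)
  also have "K r s * K s T = K r T"
    using multiplicativeD[OF K, of r s T] s by simp
  also have "K r s * (\<integral>\<^sup>+q. K s q * \<Phi> q * indicator {s<..<T} q \<partial>lborel) =
      (\<integral>\<^sup>+q. K r s * (K s q * \<Phi> q * indicator {s<..<T} q) \<partial>lborel)"
    by (rule nn_integral_cmult[symmetric]) measurable
  also have "\<dots> = (\<integral>\<^sup>+q. (K r q * \<Phi> q * indicator {r<..<T} q) * indicator {s<..} q \<partial>lborel)"
  proof (rule nn_integral_cong)
    fix q
    show "K r s * (K s q * \<Phi> q * indicator {s<..<T} q) = (K r q * \<Phi> q * indicator {r<..<T} q) * indicator {s<..} q"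
      using multiplicativeD[OF K, of r s q] s by (auto simp: indicator_def mult_ac)
  qed
  finally show ?thesis .
qed

text \<open>The plane of pairs \<open>(s, q)\<close> splits into two triangles and the diagonal, a
  null set: one of two events comes first.\<close>

lemma nn_integral_triangles:
  fixes f g :: "real \<Rightarrow> ennreal"
  assumes [measurable]: "f \<in> borel_measurable borel" "g \<in> borel_measurable borel"
  shows "(\<integral>\<^sup>+s. f s * (\<integral>\<^sup>+q. g q * indicator {s<..} q \<partial>lborel) \<partial>lborel) +
      (\<integral>\<^sup>+s. g s * (\<integral>\<^sup>+q. f q * indicator {s<..} q \<partial>lborel) \<partial>lborel) =
      (\<integral>\<^sup>+s. f s \<partial>lborel) * (\<integral>\<^sup>+s. g s \<partial>lborel)"
proof -
  have [measurable]: "Measurable.pred (borel \<Otimes>\<^sub>M borel) (\<lambda>p::real \<times> real. snd p \<in> {fst p<..})"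
    "Measurable.pred (borel \<Otimes>\<^sub>M borel) (\<lambda>p::real \<times> real. fst p \<in> {snd p<..})"
    by (simp_all add: greaterThan_def)
  have [measurable]: "Measurable.pred borel (\<lambda>x. s \<in> {x<..})" for s :: real
    by (simp add: greaterThan_def)
  have "(\<integral>\<^sup>+s. g s * (\<integral>\<^sup>+q. f q * indicator {s<..} q \<partial>lborel) \<partial>lborel) =
      (\<integral>\<^sup>+s. (\<integral>\<^sup>+q. g s * (f q * indicator {s<..} q) \<partial>lborel) \<partial>lborel)"
    by (simp add: nn_integral_cmult)
  \<comment> \<open>After the exchange both triangles carry \<open>f\<close> in the outer
    variable.\<close>
  also have "\<dots> = (\<integral>\<^sup>+q. (\<integral>\<^sup>+s. g s * (f q * indicator {s<..} q) \<partial>lborel) \<partial>lborel)"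
    by (rule lborel_pair.Fubini') (simp add: split_beta')
  finally have 2: "(\<integral>\<^sup>+s. g s * (\<integral>\<^sup>+q. f q * indicator {s<..} q \<partial>lborel) \<partial>lborel) =
      (\<integral>\<^sup>+s. (\<integral>\<^sup>+q. g q * (f s * indicator {q<..} s) \<partial>lborel) \<partial>lborel)" .
  have 1: "(\<integral>\<^sup>+s. f s * (\<integral>\<^sup>+q. g q * indicator {s<..} q \<partial>lborel) \<partial>lborel) =
      (\<integral>\<^sup>+s. (\<integral>\<^sup>+q. f s * (g q * indicator {s<..} q) \<partial>lborel) \<partial>lborel)"
    by (simp add: nn_integral_cmult)
  have "(\<integral>\<^sup>+s. (\<integral>\<^sup>+q. f s * (g q * indicator {s<..} q) \<partial>lborel) \<partial>lborel) +
      (\<integral>\<^sup>+s. (\<integral>\<^sup>+q. g q * (f s * indicator {q<..} s) \<partial>lborel) \<partial>lborel) =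
      (\<integral>\<^sup>+s. (\<integral>\<^sup>+q. f s * (g q * indicator {s<..} q) \<partial>lborel) + (\<integral>\<^sup>+q. g q * (f s * indicator {q<..} s) \<partial>lborel) \<partial>lborel)"
    by (rule nn_integral_add[symmetric]) measurable
  also have "\<dots> = (\<integral>\<^sup>+s. f s * (\<integral>\<^sup>+q. g q \<partial>lborel) \<partial>lborel)"
  proof (rule nn_integral_cong)
    fix s :: real
    have "(\<integral>\<^sup>+q. f s * (g q * indicator {s<..} q) \<partial>lborel) + (\<integral>\<^sup>+q. g q * (f s * indicator {q<..} s) \<partial>lborel) =
       (\<integral>\<^sup>+q. f s * (g q * indicator {s<..} q) + g q * (f s * indicator {q<..} s) \<partial>lborel)"
      by (rule nn_integral_add[symmetric]) measurable
    also have "\<dots> = (\<integral>\<^sup>+q. f s * g q \<partial>lborel)"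
    proof (rule nn_integral_cong_AE, use AE_lborel_singleton[of s] in eventually_elim)
      case (elim q)
      then show ?case by (cases "s < q") (auto simp: mult_ac)
    qed
    also have "\<dots> = f s * (\<integral>\<^sup>+q. g q \<partial>lborel)" by (rule nn_integral_cmult) measurable
    finally show "(\<integral>\<^sup>+q. f s * (g q * indicator {s<..} q) \<partial>lborel) + (\<integral>\<^sup>+q. g q * (f s * indicator {q<..} s) \<partial>lborel) =
       f s * (\<integral>\<^sup>+q. g q \<partial>lborel)" .
  qed
  also have "\<dots> = (\<integral>\<^sup>+s. f s \<partial>lborel) * (\<integral>\<^sup>+s. g s \<partial>lborel)" by (rule nn_integral_multc) measurable
  finally show ?thesis unfolding 1 2 .
qed

text \<open>The joint process waits with kernel \<open>K1 * K2\<close>; its next event belongs to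
  one of the two processes, while the other continues with its own solution from that time on. When
  the two equations are multiplied, the product of the integrals is split according to which event
  comes first.\<close>

lemma mild_mult:
  assumes U1: "mild T K1 \<Phi>1 U1" and K1: "multiplicative K1"
    and U2: "mild T K2 \<Phi>2 U2" and K2: "multiplicative K2"
    and [measurable]: "\<Phi>1 \<in> borel_measurable borel" "\<Phi>2 \<in> borel_measurable borel"
      "U1 \<in> borel_measurable borel" "U2 \<in> borel_measurable borel"
  shows "mild T (\<lambda>r s. K1 r s * K2 r s) (\<lambda>s. \<Phi>1 s * U2 s + U1 s * \<Phi>2 s) (\<lambda>s. U1 s * U2 s)"
  unfolding mild_def
proof safe
  fix r assume r: "r < T"
  note [measurable] = multiplicative_measurable[OF K1] multiplicative_measurable[OF K2]
  define f1 f2 where "f1 = (\<lambda>s. K1 r s * \<Phi>1 s * indicator {r<..<T} s)"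
    and "f2 = (\<lambda>s. K2 r s * \<Phi>2 s * indicator {r<..<T} s)"
  have [measurable]: "f1 \<in> borel_measurable borel" "f2 \<in> borel_measurable borel"
    unfolding f1_def f2_def by measurable
  let ?I = "\<lambda>f. \<integral>\<^sup>+s. f s \<partial>lborel"
  have meas2 [measurable]: "(\<lambda>s. \<integral>\<^sup>+q. f q * indicator {s<..} q \<partial>lborel) \<in> borel_measurable borel"
    if [measurable]: "f \<in> borel_measurable borel" for f :: "real \<Rightarrow> ennreal"
  proof -
    have [measurable]: "Measurable.pred (borel \<Otimes>\<^sub>M borel) (\<lambda>p::real \<times> real. snd p \<in> {fst p<..})"
      by (simp add: greaterThan_def)
    show ?thesis by measurable
  qed
  \<comment> \<open>The first process has the earlier event, at time \<open>s\<close>, and the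
    second one is restarted there; \<open>B\<close> is the mirror image.\<close>
  have A: "(\<integral>\<^sup>+s. K1 r s * K2 r s * (\<Phi>1 s * U2 s) * indicator {r<..<T} s \<partial>lborel) =
      ?I f1 * K2 r T + (\<integral>\<^sup>+s. f1 s * (\<integral>\<^sup>+q. f2 q * indicator {s<..} q \<partial>lborel) \<partial>lborel)"
  proof -
    have "(\<integral>\<^sup>+s. K1 r s * K2 r s * (\<Phi>1 s * U2 s) * indicator {r<..<T} s \<partial>lborel) =
      (\<integral>\<^sup>+s. f1 s * K2 r T + f1 s * (\<integral>\<^sup>+q. f2 q * indicator {s<..} q \<partial>lborel) \<partial>lborel)"
    proof (rule nn_integral_cong)
      fix s
      show "K1 r s * K2 r s * (\<Phi>1 s * U2 s) * indicator {r<..<T} s =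
          f1 s * K2 r T + f1 s * (\<integral>\<^sup>+q. f2 q * indicator {s<..} q \<partial>lborel)"
      proof (cases "s \<in> {r<..<T}")
        case True
        have "K1 r s * K2 r s * (\<Phi>1 s * U2 s) * indicator {r<..<T} s = f1 s * (K2 r s * U2 s)"
          by (simp add: f1_def mult_ac)
        also have "K2 r s * U2 s = K2 r T + (\<integral>\<^sup>+q. f2 q * indicator {s<..} q \<partial>lborel)"
          unfolding f2_def using True by (intro mild_restart[OF U2 K2]) auto
        finally show ?thesis by (simp add: distrib_left)
      qed (simp add: f1_def)
    qed
    also have "\<dots> = (\<integral>\<^sup>+s. f1 s * K2 r T \<partial>lborel) + (\<integral>\<^sup>+s. f1 s * (\<integral>\<^sup>+q. f2 q * indicator {s<..} q \<partial>lborel) \<partial>lborel)"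
      by (rule nn_integral_add) measurable
    also have "(\<integral>\<^sup>+s. f1 s * K2 r T \<partial>lborel) = ?I f1 * K2 r T" by (rule nn_integral_multc) measurable
    finally show ?thesis .
  qed
  have B: "(\<integral>\<^sup>+s. K1 r s * K2 r s * (U1 s * \<Phi>2 s) * indicator {r<..<T} s \<partial>lborel) =
      ?I f2 * K1 r T + (\<integral>\<^sup>+s. f2 s * (\<integral>\<^sup>+q. f1 q * indicator {s<..} q \<partial>lborel) \<partial>lborel)"
  proof -
    have "(\<integral>\<^sup>+s. K1 r s * K2 r s * (U1 s * \<Phi>2 s) * indicator {r<..<T} s \<partial>lborel) =
      (\<integral>\<^sup>+s. f2 s * K1 r T + f2 s * (\<integral>\<^sup>+q. f1 q * indicator {s<..} q \<partial>lborel) \<partial>lborel)"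
    proof (rule nn_integral_cong)
      fix s
      show "K1 r s * K2 r s * (U1 s * \<Phi>2 s) * indicator {r<..<T} s =
          f2 s * K1 r T + f2 s * (\<integral>\<^sup>+q. f1 q * indicator {s<..} q \<partial>lborel)"
      proof (cases "s \<in> {r<..<T}")
        case True
        have "K1 r s * K2 r s * (U1 s * \<Phi>2 s) * indicator {r<..<T} s = f2 s * (K1 r s * U1 s)"
          by (simp add: f2_def mult_ac)
        also have "K1 r s * U1 s = K1 r T + (\<integral>\<^sup>+q. f1 q * indicator {s<..} q \<partial>lborel)"
          unfolding f1_def using True by (intro mild_restart[OF U1 K1]) auto
        finally show ?thesis by (simp add: distrib_left)
      qed (simp add: f2_def)
    qed
    also have "\<dots> = (\<integral>\<^sup>+s. f2 s * K1 r T \<partial>lborel) + (\<integral>\<^sup>+s. f2 s * (\<integral>\<^sup>+q. f1 q * indicator {s<..} q \<partial>lborel) \<partial>lborel)"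
      by (rule nn_integral_add) measurable
    also have "(\<integral>\<^sup>+s. f2 s * K1 r T \<partial>lborel) = ?I f2 * K1 r T" by (rule nn_integral_multc) measurable
    finally show ?thesis .
  qed
  have "U1 r * U2 r = (K1 r T + ?I f1) * (K2 r T + ?I f2)"
    using U1 U2 r by (simp add: mild_def f1_def f2_def)
  also have "\<dots> = K1 r T * K2 r T + (?I f1 * K2 r T + ?I f2 * K1 r T + ?I f1 * ?I f2)"
    by (simp add: distrib_left distrib_right mult_ac add_ac)
  also have "?I f1 * K2 r T + ?I f2 * K1 r T + ?I f1 * ?I f2 =
     (\<integral>\<^sup>+s. K1 r s * K2 r s * (\<Phi>1 s * U2 s) * indicator {r<..<T} s \<partial>lborel) +
     (\<integral>\<^sup>+s. K1 r s * K2 r s * (U1 s * \<Phi>2 s) * indicator {r<..<T} s \<partial>lborel)"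
    unfolding A B nn_integral_triangles[of f1 f2, symmetric, OF \<open>f1 \<in> _\<close> \<open>f2 \<in> _\<close>] by (simp add: add_ac)
  also have "\<dots> = (\<integral>\<^sup>+s. K1 r s * K2 r s * (\<Phi>1 s * U2 s) * indicator {r<..<T} s +
      K1 r s * K2 r s * (U1 s * \<Phi>2 s) * indicator {r<..<T} s \<partial>lborel)"
    by (rule nn_integral_add[symmetric]) measurable
  also have "\<dots> = (\<integral>\<^sup>+s\<in>{r<..<T}. K1 r s * K2 r s * (\<Phi>1 s * U2 s + U1 s * \<Phi>2 s) \<partial>lborel)"
    by (simp add: distrib_left distrib_right)
  finally show "U1 r * U2 r = K1 r T * K2 r T +
      (\<integral>\<^sup>+s\<in>{r<..<T}. K1 r s * K2 r s * (\<Phi>1 s * U2 s + U1 s * \<Phi>2 s) \<partial>lborel)" .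
qed

section \<open>Exponential waiting times\<close>

lemma decay_integral:
  assumes c: "c \<ge> 0" and "r \<le> q"
  shows "(\<integral>\<^sup>+s. ennreal c * decay c r s * indicator {r..q} s \<partial>lborel) = 1 - decay c r q"
proof -
  have "(\<integral>\<^sup>+s. ennreal (c * exp (- c * (s - r))) * indicator {r..q} s \<partial>lborel) =
      ennreal (- exp (- c * (q - r)) - (- exp (- c * (r - r))))"
    by (rule nn_integral_FTC_Icc[OF _ _ _ \<open>r \<le> q\<close>])
       (use c in \<open>auto intro!: derivative_eq_intros\<close>)
  also have "\<dots> = ennreal (1 - exp (- c * (q - r)))" by simp
  also have "\<dots> = 1 - decay c r q" unfolding decay_def by (subst ennreal_minus[symmetric]) auto
  finally show ?thesis using c by (simp add: decay_def ennreal_mult' mult_ac)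
qed

lemma decay_integral_inf:
  assumes c: "c > 0"
  shows "(\<integral>\<^sup>+s. ennreal c * decay c r s * indicator {r..} s \<partial>lborel) = 1"
proof -
  have "(\<integral>\<^sup>+s. ennreal (c * exp (- c * (s - r))) * indicator {r..} s \<partial>lborel) =
      ennreal (0 - (- exp (- c * (r - r))))"
  proof (rule nn_integral_FTC_atLeast[where F = "\<lambda>s. - exp (- c * (s - r))"])
    show "((\<lambda>s. - exp (- c * (s - r))) \<longlongrightarrow> 0) at_top"
    proof -
      have "filterlim (\<lambda>s. - r + s) at_top at_top"
        by (rule filterlim_tendsto_add_at_top[OF tendsto_const filterlim_ident])
      then have "filterlim (\<lambda>s. c * (- r + s)) at_top at_top"
        by (rule filterlim_tendsto_pos_mult_at_top[OF tendsto_const c])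
      then have "filterlim (\<lambda>s. c * (s - r)) at_top at_top" by simp
      then have "((\<lambda>s. exp (- (c * (s - r)))) \<longlongrightarrow> 0) at_top"
        by (intro filterlim_compose[OF exp_at_bot] filterlim_compose[OF filterlim_uminus_at_bot_at_top])
      then show ?thesis by (auto intro: tendsto_minus_cancel)
    qed
  qed (use c in \<open>auto intro!: derivative_eq_intros\<close>)
  then show ?thesis using c by (simp add: decay_def ennreal_mult' mult_ac)
qed

lemma decay_le_1: "c \<ge> 0 \<Longrightarrow> r \<le> q \<Longrightarrow> decay c r q \<le> 1"
  by (simp add: decay_def)

lemma decay_integral_open:
  assumes c: "c \<ge> 0" and "r \<le> q"
  shows "decay c r q + (\<integral>\<^sup>+s. ennreal c * decay c r s * indicator {r<..<q} s \<partial>lborel) = 1"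
proof -
  have "(\<integral>\<^sup>+s. ennreal c * decay c r s * indicator {r<..<q} s \<partial>lborel) =
      (\<integral>\<^sup>+s. ennreal c * decay c r s * indicator {r..q} s \<partial>lborel)"
    by (rule nn_integral_cong_AE, use AE_lborel_singleton[of r] AE_lborel_singleton[of q] in eventually_elim)
       (auto simp: indicator_def)
  also have "\<dots> = 1 - decay c r q" by (rule decay_integral[OF assms])
  finally show ?thesis using decay_le_1[OF assms] by (simp add: add_diff_inverse_ennreal)
qed

text \<open>A clock of rate \<open>c\<close> whose events have no consequence: success is certain,
  and the backward equation says that the total probability is 1.\<close>

lemma mild_1:
  assumes "c \<ge> 0" shows "mild T (decay c) (\<lambda>_. ennreal c) (\<lambda>_. 1)"
  unfolding mild_def using decay_integral_open[OF assms]
  by (auto simp: mult.commute mult.left_commute)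

text \<open>The thinning step: events of rate \<open>c\<close> without effect do not change the solution.\<close>

lemma mild_add_rate:
  assumes "mild T K \<Phi> U" "multiplicative K" "c \<ge> 0"
    and "\<Phi> \<in> borel_measurable borel" "U \<in> borel_measurable borel"
  shows "mild T (\<lambda>r s. K r s * decay c r s) (\<lambda>s. \<Phi> s + U s * ennreal c) U"
  using mild_mult[OF assms(1,2) mild_1[OF assms(3)] multiplicative_decay] assms(4,5) by simp

text \<open>Induction with \<open>mild_mult\<close>: the next event belongs to exactly one index
  \<open>i\<close>, and all other factors keep their solutions.\<close>

lemma mild_prod:
  fixes K :: "'i \<Rightarrow> real \<Rightarrow> real \<Rightarrow> ennreal"
  assumes "finite I" and "\<And>i. i \<in> I \<Longrightarrow> mild T (K i) (\<Phi> i) (U i)" "\<And>i. i \<in> I \<Longrightarrow> multiplicative (K i)"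
    and "\<And>i. i \<in> I \<Longrightarrow> \<Phi> i \<in> borel_measurable borel" "\<And>i. i \<in> I \<Longrightarrow> U i \<in> borel_measurable borel"
  shows "mild T (\<lambda>r s. \<Prod>i\<in>I. K i r s) (\<lambda>s. \<Sum>i\<in>I. \<Phi> i s * (\<Prod>j\<in>I - {i}. U j s)) (\<lambda>s. \<Prod>i\<in>I. U i s)"
  using assms
proof (induction I rule: finite_induct)
  case empty
  then show ?case by (simp add: mild_def)
next
  case (insert i I)
  have "mild T (\<lambda>r s. K i r s * (\<Prod>i\<in>I. K i r s))
     (\<lambda>s. \<Phi> i s * (\<Prod>i\<in>I. U i s) + U i s * (\<Sum>i\<in>I. \<Phi> i s * (\<Prod>j\<in>I - {i}. U j s)))
     (\<lambda>s. U i s * (\<Prod>i\<in>I. U i s))"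
    using insert.prems insert.IH
    by (intro mild_mult multiplicative_prod borel_measurable_sum borel_measurable_prod borel_measurable_times) auto
  moreover have "(\<Phi> i s * (\<Prod>i\<in>I. U i s) + U i s * (\<Sum>i\<in>I. \<Phi> i s * (\<Prod>j\<in>I - {i}. U j s))) =
     (\<Sum>k\<in>insert i I. \<Phi> k s * (\<Prod>j\<in>insert i I - {k}. U j s))" for s
  proof -
    have "(\<Prod>j\<in>insert i I - {k}. U j s) = U i s * (\<Prod>j\<in>I - {k}. U j s)" if "k \<in> I" for k
      using insert.hyps that by (subst insert_Diff_if) auto
    then show ?thesis
      using insert.hyps by (simp add: sum_distrib_left mult_ac Diff_insert0 cong: sum.cong)
  qed
  ultimately show ?case using insert.hyps by (simp cong: if_cong)
qed

text \<open>If no event after time \<open>T\<close> matters, the boundary term is the contribution of the events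
  after \<open>T\<close>.\<close>

lemma mild_unbounded:
  assumes U: "mild T (\<lambda>r s. decay c r s * B r s) \<Phi> U" and c: "c > 0"
    and B: "multiplicative B" and B1: "\<And>r s. T \<le> r \<Longrightarrow> B r s = 1"
    and U1: "\<And>s. T \<le> s \<Longrightarrow> U s = 1" and \<Phi>1: "\<And>s. T \<le> s \<Longrightarrow> \<Phi> s = ennreal c"
    and [measurable]: "\<Phi> \<in> borel_measurable borel"
  shows "U r = (\<integral>\<^sup>+s. decay c r s * B r s * \<Phi> s * indicator {r..} s \<partial>lborel)"
proof -
  note [measurable] = multiplicative_measurable[OF B] multiplicative_measurable[OF multiplicative_decay]
  note inf = decay_integral_inf[OF c]
  show ?thesis
  proof (cases "r < T")
    case False
    then have "(\<integral>\<^sup>+s. decay c r s * B r s * \<Phi> s * indicator {r..} s \<partial>lborel) =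
        (\<integral>\<^sup>+s. ennreal c * decay c r s * indicator {r..} s \<partial>lborel)"
      by (intro nn_integral_cong) (auto simp: B1 \<Phi>1 indicator_def mult_ac)
    then show ?thesis using False inf U1 by simp
  next
    case True
    have "(\<integral>\<^sup>+s. decay c r s * B r s * \<Phi> s * indicator {r..} s \<partial>lborel) =
        (\<integral>\<^sup>+s. decay c r s * B r s * \<Phi> s * indicator {r<..<T} s + decay c r T * B r T * (ennreal c * decay c T s * indicator {T..} s) \<partial>lborel)"
    proof (rule nn_integral_cong_AE, use AE_lborel_singleton[of r] in eventually_elim)
      case (elim s)
      consider "s < r" | "r < s" "s < T" | "T \<le> s" using elim by linarith
      then show ?case
      proof cases
        case 3
        \<comment> \<open>Past \<open>T\<close> the kernel factors through \<open>T\<close> with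
          \<open>B T s = 1\<close>; the remaining exponential density integrates to 1 and leaves the
          boundary term.\<close>
        then have "decay c r s * B r s = decay c r T * B r T * decay c T s"
          using multiplicativeD[OF multiplicative_decay, of r T s c] multiplicativeD[OF B, of r T s] B1 True
          by (simp add: mult_ac)
        then show ?thesis using 3 True \<Phi>1 by (simp add: mult_ac)
      qed (use True in \<open>auto simp: indicator_def\<close>)
    qed
    also have "\<dots> = (\<integral>\<^sup>+s. decay c r s * B r s * \<Phi> s * indicator {r<..<T} s \<partial>lborel) +
        decay c r T * B r T * (\<integral>\<^sup>+s. ennreal c * decay c T s * indicator {T..} s \<partial>lborel)"
      by (subst nn_integral_add) (simp_all add: nn_integral_cmult)
    also have "\<dots> = U r" using U True by (simp add: mild_def inf add.commute)
    finally show ?thesis by simp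
  qed
qed

section \<open>The survival function\<close>

text \<open>The common frame of both processes: \<open>Q\<close> is the law of a line hitting
  \<open>W\<close>, \<open>rate\<close> stands for \<Lambda>([W]), \<open>F\<close> is the set of
  tests and \<open>T\<close> a horizon after all of them. In this frame translation invariance is
  represented by \<open>no_touch\<close>: almost every line divides a cell properly or leaves it
  whole on one side.\<close>

locale splitting =
  fixes W :: "(real^2) set" and Q :: "(real^2) set measure" and rate :: real
    and F :: "(real \<times> (real^2) set) set" and T :: real
  assumes prob_Q: "prob_space Q" and sets_Q [measurable_cong]: "sets Q = sets line_space"
    and convex_W: "convex W" and rate: "rate > 0"
    and finite_F: "finite F" and open_F: "\<And>p. p \<in> F \<Longrightarrow> open (snd p)"
    and F_before: "\<And>p. p \<in> F \<Longrightarrow> fst p < T"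
    and no_touch: "\<And>C. C \<in> cells W \<Longrightarrow> AE g in Q. cuts C g \<or>
      C \<inter> plus_side g = {} \<and> C \<inter> minus_side g = C \<or> C \<inter> minus_side g = {} \<and> C \<inter> plus_side g = C"
begin

interpretation Q: prob_space Q by (rule prob_Q)

lemma space_Q: "space Q = lines"
  using sets_eq_imp_space_eq[OF sets_Q] by (simp add: space_line_space)

text \<open>This is \<Lambda>([C]), see \<open>split_rate_hitting\<close>: the rate \<Lambda>([W])
  thinned by the probability that a line hitting \<open>W\<close> cuts \<open>C\<close>.\<close>

definition split_rate :: "(real^2) set \<Rightarrow> real" where
  "split_rate C = rate * measure Q {g \<in> space Q. cuts C g}"

text \<open>A cell born at \<open>r\<close> and divided at \<open>s\<close> is present during the
  half-open interval from \<open>r\<close> to \<open>s\<close>, as in \<open>stit_alive\<close>.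
  Points of \<open>frontier W\<close> are excluded because both processes drop them before taking
  the closure.\<close>

definition unhit :: "(real^2) set \<Rightarrow> real \<Rightarrow> real \<Rightarrow> ennreal" where
  "unhit C r s = (if \<forall>p\<in>F. r \<le> fst p \<and> fst p < s \<longrightarrow> frontier C \<inter> (snd p - frontier W) = {} then 1 else 0)"

definition gain :: "((real^2) set \<Rightarrow> real \<Rightarrow> ennreal) \<Rightarrow> (real^2) set \<Rightarrow> real \<Rightarrow> ennreal" where
  "gain u C s = ennreal rate *
     (\<integral>\<^sup>+g. (if cuts C g then u (C \<inter> plus_side g) s * u (C \<inter> minus_side g) s else 0) \<partial>Q)"

text \<open>The right side of the backward equation as an operator on candidate solutions. From
  \<open>T\<close> on no test is left, hence the value 1.\<close>

definition first_split :: "((real^2) set \<Rightarrow> real \<Rightarrow> ennreal) \<Rightarrow> (real^2) set \<Rightarrow> real \<Rightarrow> ennreal" where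
  "first_split u C r = (if T \<le> r then 1 else decay (split_rate C) r T * unhit C r T +
     (\<integral>\<^sup>+s\<in>{r<..<T}. decay (split_rate C) r s * unhit C r s * gain u C s \<partial>lborel))"

text \<open>Iterating from 0 before \<open>T\<close> counts only the histories in which every line
  of descent reaches \<open>T\<close> with fewer than \<open>n\<close> divisions. The iterates
  increase, so they converge without any contraction estimate.\<close>

definition surv_iter :: "nat \<Rightarrow> (real^2) set \<Rightarrow> real \<Rightarrow> ennreal" where
  "surv_iter n = (first_split ^^ n) (\<lambda>C r. if T \<le> r then 1 else 0)"

text \<open>\<open>surv C r\<close> is the probability that the process started at time \<open>r\<close> in the cell \<open>C\<close> misses, for
  all \<open>(t, U)\<close> in \<open>F\<close> with \<open>r \<le> t\<close>, the set \<open>U\<close> at time \<open>t\<close>.\<close>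

definition surv :: "(real^2) set \<Rightarrow> real \<Rightarrow> ennreal" where
  "surv C r = (SUP n. surv_iter n C r)"

lemma surv_iter_simps: "surv_iter 0 = (\<lambda>C r. if T \<le> r then 1 else 0)"
  "surv_iter (Suc n) = first_split (surv_iter n)"
  by (simp_all add: surv_iter_def)

section \<open>Measurability of the survival function\<close>

lemma pred_cuts_section [measurable]: "C \<in> cells W \<Longrightarrow> Measurable.pred line_space (cuts C)"
  using measurable_compose[OF measurable_Pair1'[of C "cell_space W" line_space] pred_cuts]
  by (simp add: space_cell_space)

lemma pred_cuts_Q [measurable]: "Measurable.pred (cell_space W \<Otimes>\<^sub>M Q) (\<lambda>p. cuts (fst p) (snd p))"
  using pred_cuts by measurable

lemma split_rate_eq:
  assumes "C \<in> cells W"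
  shows "ennreal (split_rate C) = ennreal rate * (\<integral>\<^sup>+g. (if cuts C g then 1 else 0) \<partial>Q)"
proof -
  have [measurable]: "Measurable.pred Q (cuts C)" using pred_cuts_section[OF assms] by measurable
  have "(\<integral>\<^sup>+g. (if cuts C g then 1 else 0) \<partial>Q) = (\<integral>\<^sup>+g. indicator {g \<in> space Q. cuts C g} g \<partial>Q)"
    by (intro nn_integral_cong) (simp add: indicator_def)
  also have "\<dots> = ennreal (measure Q {g \<in> space Q. cuts C g})"
    by (simp add: Q.emeasure_eq_measure)
  finally show ?thesis using rate by (simp add: split_rate_def ennreal_mult)
qed

lemma split_rate_nonneg: "0 \<le> split_rate C"
  using rate by (simp add: split_rate_def)

lemma split_rate_le: "split_rate C \<le> rate"
  using rate by (simp add: split_rate_def mult_left_le)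

lemma measurable_split_rate [measurable]: "split_rate \<in> borel_measurable (cell_space W)"
proof -
  have "(\<lambda>C. enn2real (ennreal rate * (\<integral>\<^sup>+g. (if cuts C g then 1 else 0) \<partial>Q))) \<in> borel_measurable (cell_space W)"
    using pred_cuts_Q by (simp add: case_prod_beta')
  then show ?thesis
    by (rule measurable_cong[THEN iffD1, rotated])
       (simp add: space_cell_space split_rate_eq[symmetric] split_rate_nonneg)
qed

lemma pred_frontier_unhit [measurable]:
  "p \<in> F \<Longrightarrow> Measurable.pred (cell_space W) (\<lambda>C. frontier C \<inter> (snd p - frontier W) = {})"
  by (intro pred_frontier_disjoint open_Diff open_F frontier_closed)

lemma measurable_unhit [measurable (raw)]:
  assumes [measurable]: "f \<in> measurable M (cell_space W)" "g \<in> borel_measurable M" "h \<in> borel_measurable M"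
  shows "(\<lambda>x. unhit (f x) (g x) (h x)) \<in> borel_measurable M"
proof -
  have [measurable]: "Measurable.pred M (\<lambda>x. \<forall>p\<in>F. g x \<le> fst p \<and> fst p < h x \<longrightarrow> frontier (f x) \<inter> (snd p - frontier W) = {})"
  proof (intro pred_intros_finite finite_F)
    fix p assume p: "p \<in> F"
    have [measurable]: "Measurable.pred M (\<lambda>x. frontier (f x) \<inter> (snd p - frontier W) = {})"
      by (rule measurable_compose[OF assms(1) pred_frontier_unhit[OF p]])
    show "Measurable.pred M (\<lambda>x. g x \<le> fst p \<and> fst p < h x \<longrightarrow> frontier (f x) \<inter> (snd p - frontier W) = {})"
      by measurable
  qed
  show ?thesis unfolding unhit_def by measurable
qed

lemma measurable_decay [measurable (raw)]:
  assumes [measurable]: "f \<in> borel_measurable M" "g \<in> borel_measurable M" "h \<in> borel_measurable M"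
  shows "(\<lambda>x. decay (f x) (g x) (h x)) \<in> borel_measurable M"
  unfolding decay_def by measurable

abbreviation cell_function :: "((real^2) set \<Rightarrow> real \<Rightarrow> ennreal) \<Rightarrow> bool" where
  "cell_function u \<equiv> (\<lambda>p. u (fst p) (snd p)) \<in> borel_measurable (cell_space W \<Otimes>\<^sub>M borel)"

lemma cell_function_compose:
  assumes "cell_function u" and [measurable]: "f \<in> measurable M (cell_space W)" "g \<in> borel_measurable M"
  shows "(\<lambda>x. u (f x) (g x)) \<in> borel_measurable M"
  using measurable_compose[OF _ assms(1), of "\<lambda>x. (f x, g x)" M] by simp

lemma measurable_split_compose [measurable (raw)]:
  assumes [measurable]: "f \<in> measurable M (cell_space W)" "g \<in> measurable M line_space"
  shows "(\<lambda>x. f x \<inter> plus_side (g x)) \<in> measurable M (cell_space W)"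
    and "(\<lambda>x. f x \<inter> minus_side (g x)) \<in> measurable M (cell_space W)"
    and "Measurable.pred M (\<lambda>x. cuts (f x) (g x))"
  using measurable_compose[OF measurable_Pair[OF assms] measurable_split(1)]
    measurable_compose[OF measurable_Pair[OF assms] measurable_split(2)]
    measurable_compose[OF measurable_Pair[OF assms] pred_cuts] by simp_all

lemma cell_function_gain:
  assumes "cell_function u" shows "cell_function (gain u)"
proof -
  note [measurable (raw)] = cell_function_compose[OF assms]
  show ?thesis unfolding gain_def by measurable
qed

lemma cell_function_first_split:
  assumes "cell_function u" shows "cell_function (first_split u)"
proof -
  note [measurable (raw)] = cell_function_compose[OF cell_function_gain[OF assms]]
  have [measurable]: "Measurable.pred ((cell_space W \<Otimes>\<^sub>M borel) \<Otimes>\<^sub>M borel) (\<lambda>x. snd x \<in> {snd (fst x)<..<T})"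
    unfolding greaterThanLessThan_iff by measurable
  show ?thesis unfolding first_split_def by measurable
qed

lemma cell_function_surv_iter: "cell_function (surv_iter n)"
  by (induction n) (simp_all add: surv_iter_simps cell_function_first_split)

lemma cell_function_surv: "cell_function surv"
  using cell_function_surv_iter unfolding surv_def by measurable

lemmas measurable_surv [measurable (raw)] = cell_function_compose[OF cell_function_surv]
lemmas measurable_gain_surv [measurable (raw)] = cell_function_compose[OF cell_function_gain[OF cell_function_surv]]

lemma unhit_le_1: "unhit C r s \<le> 1"
  by (simp add: unhit_def)

lemma unhit_cases: "unhit C r s = 1 \<or> unhit C r s = 0"
  by (simp add: unhit_def)

lemma unhit_eq_1: "unhit C r s = 1 \<longleftrightarrow>
    (\<forall>p\<in>F. r \<le> fst p \<and> fst p < s \<longrightarrow> frontier C \<inter> (snd p - frontier W) = {})"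
  by (simp add: unhit_def)

lemma cells_split: "C \<in> cells W \<Longrightarrow> g \<in> space Q \<Longrightarrow> C \<inter> plus_side g \<in> cells W"
  "C \<in> cells W \<Longrightarrow> g \<in> space Q \<Longrightarrow> C \<inter> minus_side g \<in> cells W"
  by (simp_all add: space_Q cells_plus_side cells_minus_side)

section \<open>Bounds and convergence of the iteration\<close>

lemma gain_mono:
  assumes "\<And>C. C \<in> cells W \<Longrightarrow> u C s \<le> v C s" "C \<in> cells W"
  shows "gain u C s \<le> gain v C s"
  unfolding gain_def using assms cells_split
  by (intro mult_left_mono nn_integral_mono) (auto intro!: mult_mono)

lemma first_split_mono:
  assumes "\<And>C s. C \<in> cells W \<Longrightarrow> u C s \<le> v C s" "C \<in> cells W"
  shows "first_split u C r \<le> first_split v C r"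
  unfolding first_split_def using gain_mono[of u _ v C] assms
  by (auto intro!: add_left_mono nn_integral_mono mult_left_mono mult_right_mono)

lemma surv_iter_mono: "C \<in> cells W \<Longrightarrow> surv_iter n C r \<le> surv_iter (Suc n) C r"
proof (induction n arbitrary: C r)
  case 0
  then show ?case by (simp add: surv_iter_simps first_split_def)
next
  case (Suc n)
  then show ?case
    unfolding surv_iter_simps(2)[of n] surv_iter_simps(2)[of "Suc n"] by (intro first_split_mono)
qed

lemma gain_le:
  assumes "\<And>C. C \<in> cells W \<Longrightarrow> u C s \<le> 1" "C \<in> cells W"
  shows "gain u C s \<le> ennreal (split_rate C)"
  unfolding gain_def split_rate_eq[OF assms(2)]
proof (intro mult_left_mono nn_integral_mono)
  fix g assume "g \<in> space Q"
  then have "u (C \<inter> plus_side g) s * u (C \<inter> minus_side g) s \<le> 1 * 1"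
    using assms cells_split by (intro mult_mono) auto
  then show "(if cuts C g then u (C \<inter> plus_side g) s * u (C \<inter> minus_side g) s else 0) \<le> (if cuts C g then 1 else 0)"
    by simp
qed simp

lemma first_split_le_1:
  assumes "\<And>C s. C \<in> cells W \<Longrightarrow> u C s \<le> 1" "C \<in> cells W"
  shows "first_split u C r \<le> 1"
proof (cases "T \<le> r")
  case False
  have "decay (split_rate C) r T * unhit C r T +
     (\<integral>\<^sup>+s\<in>{r<..<T}. decay (split_rate C) r s * unhit C r s * gain u C s \<partial>lborel) \<le>
     decay (split_rate C) r T * 1 +
     (\<integral>\<^sup>+s\<in>{r<..<T}. decay (split_rate C) r s * 1 * ennreal (split_rate C) \<partial>lborel)"
    using gain_le[of u _ C] assms
    by (intro add_mono mult_mono nn_integral_mono unhit_le_1) (auto)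
  also have "\<dots> = 1"
    using decay_integral_open[OF split_rate_nonneg, of r T C] False by (simp add: mult_ac)
  finally show ?thesis using False by (simp add: first_split_def)
qed (simp add: first_split_def)

lemma surv_iter_le_1: "C \<in> cells W \<Longrightarrow> surv_iter n C r \<le> 1"
proof (induction n arbitrary: C r)
  case (Suc n)
  then show ?case unfolding surv_iter_simps(2) by (intro first_split_le_1)
qed (simp add: surv_iter_simps)

lemma surv_le_1: "C \<in> cells W \<Longrightarrow> surv C r \<le> 1"
  unfolding surv_def by (intro SUP_least surv_iter_le_1)

lemma surv_iter_tendsto: "C \<in> cells W \<Longrightarrow> (\<lambda>n. surv_iter n C r) \<longlonglongrightarrow> surv C r"
  unfolding surv_def by (intro LIMSEQ_SUP incseq_SucI surv_iter_mono)

lemma measurable_surv_iter [measurable (raw)]: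
  "f \<in> measurable M (cell_space W) \<Longrightarrow> g \<in> borel_measurable M \<Longrightarrow> (\<lambda>x. surv_iter n (f x) (g x)) \<in> borel_measurable M"
  by (rule cell_function_compose[OF cell_function_surv_iter])

lemma const_cell [measurable]: "C \<in> cells W \<Longrightarrow> (\<lambda>_. C) \<in> measurable M (cell_space W)"
  by (simp add: space_cell_space)

lemma gain_tendsto:
  assumes C: "C \<in> cells W"
  shows "(\<lambda>n. gain (surv_iter n) C s) \<longlonglongrightarrow> gain surv C s"
proof -
  let ?f = "\<lambda>n g. if cuts C g then surv_iter n (C \<inter> plus_side g) s * surv_iter n (C \<inter> minus_side g) s else 0"
  let ?f' = "\<lambda>g. if cuts C g then surv (C \<inter> plus_side g) s * surv (C \<inter> minus_side g) s else 0"
  note [measurable] = const_cell[OF C]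
  have m: "(\<lambda>g. ?f n g)
      \<in> borel_measurable Q" for n by measurable
  have m': "(\<lambda>g. ?f' g)
      \<in> borel_measurable Q" by measurable
  have "(\<lambda>n. \<integral>\<^sup>+g. ?f n g \<partial>Q)
     \<longlonglongrightarrow> (\<integral>\<^sup>+g. ?f' g \<partial>Q)"
  proof (rule nn_integral_dominated_convergence[where w = "\<lambda>_. 1"])
    show "AE g in Q. ?f n g \<le> 1" for n
    proof (rule AE_I2)
      fix g assume g: "g \<in> space Q"
      have "surv_iter n (C \<inter> plus_side g) s * surv_iter n (C \<inter> minus_side g) s \<le> 1 * 1"
        using cells_split[OF C g] by (intro mult_mono surv_iter_le_1) auto
      then show "?f n g \<le> 1" by simp
    qed
    show "AE g in Q. (\<lambda>n. ?f n g)
       \<longlonglongrightarrow> ?f' g"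
    proof (rule AE_I2)
      fix g assume g: "g \<in> space Q"
      have "surv (C \<inter> plus_side g) s \<noteq> top" "surv (C \<inter> minus_side g) s \<noteq> top"
        using surv_le_1[OF cells_split(1)[OF C g], of s] surv_le_1[OF cells_split(2)[OF C g], of s]
        by (metis ennreal_one_neq_top neq_top_trans)+
      then have "(\<lambda>n. surv_iter n (C \<inter> plus_side g) s * surv_iter n (C \<inter> minus_side g) s)
         \<longlonglongrightarrow> surv (C \<inter> plus_side g) s * surv (C \<inter> minus_side g) s"
        using cells_split[OF C g] by (intro tendsto_mult_ennreal surv_iter_tendsto) auto
      then show "(\<lambda>n. ?f n g)
         \<longlonglongrightarrow> ?f' g" by simp
    qed
  qed (use m m' in \<open>simp_all add: Q.emeasure_space_1\<close>)
  then show ?thesis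
    unfolding gain_def by (intro ennreal_tendsto_cmult) auto
qed

text \<open>Both sides are limits of \<open>surv_iter (Suc n) C r\<close>; bounded convergence
  carries the limit through the integral over times, as \<open>gain_tendsto\<close> does for the
  integral over lines.\<close>

lemma surv_first_split:
  assumes C: "C \<in> cells W"
  shows "surv C r = first_split surv C r"
proof (cases "T \<le> r")
  case True
  have "surv_iter n C r = 1" for n using True by (cases n) (simp_all add: surv_iter_simps first_split_def)
  then show ?thesis using True by (simp add: surv_def first_split_def)
next
  case False
  let ?K = "\<lambda>s. decay (split_rate C) r s * unhit C r s"
  note [measurable] = const_cell[OF C]
  have fin: "gain u C s * x \<le> ennreal rate" if "\<And>C. C \<in> cells W \<Longrightarrow> u C s \<le> 1" "x \<le> 1" for u s x
  proof -
    have "gain u C s * x \<le> ennreal (split_rate C) * 1"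
      using that C by (intro mult_mono gain_le) auto
    also have "\<dots> \<le> ennreal rate" using split_rate_le by (simp add: ennreal_leI)
    finally show ?thesis .
  qed
  have x: "decay (split_rate C) r s * unhit C r s \<le> 1" if "r \<le> s" for s
    using mult_mono[OF decay_le_1[OF split_rate_nonneg that] unhit_le_1] by simp
  have "(\<lambda>n. \<integral>\<^sup>+s. ?K s * gain (surv_iter n) C s * indicator {r<..<T} s \<partial>lborel)
     \<longlonglongrightarrow> (\<integral>\<^sup>+s. ?K s * gain surv C s * indicator {r<..<T} s \<partial>lborel)"
  \<comment> \<open>The rate of division never exceeds \<open>rate\<close>, and the interval from
    \<open>r\<close> to \<open>T\<close> is bounded.\<close>
  proof (rule nn_integral_dominated_convergence[where w = "\<lambda>s. ennreal rate * indicator {r<..<T} s"])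
    note [measurable (raw)] = cell_function_compose[OF cell_function_gain[OF cell_function_surv_iter]]
    show "(\<lambda>s. ?K s * gain (surv_iter n) C s * indicator {r<..<T} s) \<in> borel_measurable lborel" for n
      by measurable
    show "(\<lambda>s. ?K s * gain surv C s * indicator {r<..<T} s) \<in> borel_measurable lborel"
      by measurable
    show "AE s in lborel. ?K s * gain (surv_iter n) C s * indicator {r<..<T} s
        \<le> ennreal rate * indicator {r<..<T} s" for n
    proof (rule AE_I2)
      fix s
      show "?K s * gain (surv_iter n) C s * indicator {r<..<T} s
        \<le> ennreal rate * indicator {r<..<T} s"
        using fin[of "surv_iter n" s, OF surv_iter_le_1 x[of s]] by (auto simp: indicator_def mult.commute)
    qed
    show "AE s in lborel. (\<lambda>n. ?K s * gain (surv_iter n) C s * indicator {r<..<T} s)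
       \<longlonglongrightarrow> ?K s * gain surv C s * indicator {r<..<T} s"
    proof (rule AE_I2)
      fix s
      have "(\<lambda>n. ?K s * gain (surv_iter n) C s)
       \<longlonglongrightarrow> ?K s * gain surv C s"
        by (intro ennreal_tendsto_cmult gain_tendsto C) (auto simp: decay_def unhit_def)
      then show "(\<lambda>n. ?K s * gain (surv_iter n) C s * indicator {r<..<T} s)
       \<longlonglongrightarrow> ?K s * gain surv C s * indicator {r<..<T} s"
        by (simp add: indicator_def)
    qed
    show "(\<integral>\<^sup>+ s. ennreal rate * indicator {r<..<T} s \<partial>lborel) < \<infinity>"
      using False by (simp add: nn_integral_cmult ennreal_mult_less_top)
  qed simp
  then have "(\<lambda>n. decay (split_rate C) r T * unhit C r T +
       (\<integral>\<^sup>+s. ?K s * gain (surv_iter n) C s * indicator {r<..<T} s \<partial>lborel))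
     \<longlonglongrightarrow> first_split surv C r"
    unfolding first_split_def using False by (simp add: tendsto_add)
  then have "(\<lambda>n. surv_iter (Suc n) C r) \<longlonglongrightarrow> first_split surv C r"
    using False by (simp add: surv_iter_simps first_split_def)
  moreover have "(\<lambda>n. surv_iter (Suc n) C r) \<longlonglongrightarrow> surv C r"
    using surv_iter_tendsto[OF C] by (rule LIMSEQ_Suc)
  ultimately show ?thesis by (metis LIMSEQ_unique)
qed

section \<open>The equations solved by the survival function\<close>

lemma surv_after: "T \<le> r \<Longrightarrow> C \<in> cells W \<Longrightarrow> surv C r = 1"
  by (simp add: surv_first_split first_split_def)

lemma not_cuts_empty: "\<not> cuts {} g"
  by (simp add: cuts_def)

text \<open>An empty cell has empty frontier and division rate 0. Its factor 1 is what lets a Mecke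
  line that misses a cell pass without effect.\<close>

lemma surv_empty: "surv {} r = 1"
  using cells_empty[of W]
  by (simp add: surv_first_split[of "{}"] first_split_def gain_def not_cuts_empty split_rate_def unhit_def decay_0)

lemma unhit_after: "T \<le> r \<Longrightarrow> unhit C r s = 1"
  using F_before by (force simp: unhit_def)

lemma multiplicative_unhit: "C \<in> cells W \<Longrightarrow> multiplicative (unhit C)"
  unfolding multiplicative_def
proof safe
  fix r q s :: real assume "r \<le> q" "q \<le> s"
  then have "(\<forall>p\<in>F. r \<le> fst p \<and> fst p < s \<longrightarrow> P p) \<longleftrightarrow>
      (\<forall>p\<in>F. r \<le> fst p \<and> fst p < q \<longrightarrow> P p) \<and> (\<forall>p\<in>F. q \<le> fst p \<and> fst p < s \<longrightarrow> P p)" for P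
    by (meson le_less_linear le_less_trans less_le_trans order_trans)
  then show "unhit C r s = unhit C r q * unhit C q s" unfolding unhit_def by simp
next
  fix r assume "C \<in> cells W"
  note [measurable] = const_cell[OF this]
  have "(\<lambda>s. unhit C r s) \<in> borel_measurable borel" by measurable
  then show "unhit C r \<in> borel_measurable borel" .
qed

lemma mild_surv:
  assumes "C \<in> cells W"
  shows "mild T (\<lambda>r s. decay (split_rate C) r s * unhit C r s) (gain surv C) (surv C)"
  unfolding mild_def by (simp add: surv_first_split[OF assms, of r for r] first_split_def)

lemma surv_section_measurable:
  assumes "C \<in> cells W"
  shows "surv C \<in> borel_measurable borel" "gain surv C \<in> borel_measurable borel"
proof -
  note [measurable] = const_cell[OF assms]
  have "(\<lambda>s. surv C s) \<in> borel_measurable borel" "(\<lambda>s. gain surv C s) \<in> borel_measurable borel" by measurable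
  then show "surv C \<in> borel_measurable borel" "gain surv C \<in> borel_measurable borel" .
qed

lemma gain_after: "T \<le> s \<Longrightarrow> C \<in> cells W \<Longrightarrow> gain surv C s = ennreal (split_rate C)"
proof -
  assume s: "T \<le> s" and C: "C \<in> cells W"
  have "(\<integral>\<^sup>+g. (if cuts C g then surv (C \<inter> plus_side g) s * surv (C \<inter> minus_side g) s else 0) \<partial>Q) =
      (\<integral>\<^sup>+g. (if cuts C g then 1 else 0) \<partial>Q)"
    by (rule nn_integral_cong) (simp add: surv_after s cells_split[OF C])
  then show ?thesis using split_rate_eq[OF C] by (simp add: gain_def)
qed

text \<open>A STIT lifetime is not stopped at \<open>T\<close>, so the boundary term is traded for
  an integral over all later times. This needs a positive rate, since only then do the later
  divisions have total probability 1.\<close>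

lemma surv_eq_stit:
  assumes C: "C \<in> cells W" and pos: "split_rate C > 0"
  shows "surv C r = (\<integral>\<^sup>+s. decay (split_rate C) r s * unhit C r s * gain surv C s * indicator {r..} s \<partial>lborel)"
  by (rule mild_unbounded[OF mild_surv[OF C] pos multiplicative_unhit[OF C]])
     (simp_all add: unhit_after surv_after gain_after C surv_section_measurable)

definition try_gain :: "(real^2) set \<Rightarrow> real \<Rightarrow> ennreal" where
  "try_gain C s = ennreal rate * (\<integral>\<^sup>+g. surv (C \<inter> plus_side g) s * surv (C \<inter> minus_side g) s \<partial>Q)"

text \<open>By \<open>no_touch\<close>, a line that does not cut \<open>C\<close> almost surely
  leaves one part equal to \<open>C\<close> and the other empty, so the product is
  \<open>surv C s\<close> again. Such lines come at rate \<open>rate - split_rate C\<close>.\<close>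

lemma try_gain_eq:
  assumes C: "C \<in> cells W"
  shows "try_gain C s = gain surv C s + surv C s * ennreal (rate - split_rate C)"
proof -
  note [measurable] = const_cell[OF C]
  have "(\<integral>\<^sup>+g. surv (C \<inter> plus_side g) s * surv (C \<inter> minus_side g) s \<partial>Q) =
      (\<integral>\<^sup>+g. (if cuts C g then surv (C \<inter> plus_side g) s * surv (C \<inter> minus_side g) s else 0) +
         surv C s * indicator {g \<in> space Q. \<not> cuts C g} g \<partial>Q)"
    by (rule nn_integral_cong_AE, use no_touch[OF C] AE_space in eventually_elim)
       (auto simp: surv_empty cuts_def)
  also have "\<dots> = (\<integral>\<^sup>+g. (if cuts C g then surv (C \<inter> plus_side g) s * surv (C \<inter> minus_side g) s else 0) \<partial>Q) +
         surv C s * ennreal (measure Q {g \<in> space Q. \<not> cuts C g})"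
    by (subst nn_integral_add) (simp_all add: nn_integral_cmult Q.emeasure_eq_measure)
  also have "measure Q {g \<in> space Q. \<not> cuts C g} = 1 - measure Q {g \<in> space Q. cuts C g}"
    by (rule Q.prob_neg) measurable
  finally have "try_gain C s = gain surv C s + surv C s * (ennreal rate * ennreal (1 - measure Q {g \<in> space Q. cuts C g}))"
    by (simp add: try_gain_def gain_def distrib_left mult_ac)
  also have "ennreal rate * ennreal (1 - measure Q {g \<in> space Q. cuts C g}) = ennreal (rate - split_rate C)"
    using rate by (simp add: split_rate_def ennreal_mult'[symmetric] right_diff_distrib)
  finally show ?thesis .
qed

text \<open>Filling up the division rate to \<open>rate\<close> with ineffective lines gives every
  cell, whatever its size, the same clock.\<close>

lemma mild_surv_try:
  assumes C: "C \<in> cells W"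
  shows "mild T (\<lambda>r s. decay rate r s * unhit C r s) (try_gain C) (surv C)"
proof -
  have "mild T (\<lambda>r s. decay (split_rate C) r s * unhit C r s * decay (rate - split_rate C) r s)
     (\<lambda>s. gain surv C s + surv C s * ennreal (rate - split_rate C)) (surv C)"
    using split_rate_le by (intro mild_add_rate mild_surv multiplicative_mult multiplicative_decay
      multiplicative_unhit surv_section_measurable C) auto
  moreover have "decay (split_rate C) r s * unhit C r s * decay (rate - split_rate C) r s = decay rate r s * unhit C r s" for r s
    using decay_add[of "split_rate C" r s "rate - split_rate C"] by (simp add: mult_ac)
  ultimately show ?thesis by (simp flip: try_gain_eq[OF C])
qed

lemma prod_decay: "(\<Prod>i\<in>I. decay c r s) = decay (real (card I) * c) r s"
proof (induction I rule: infinite_finite_induct)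
  case (insert i I)
  then show ?case by (simp add: decay_add distrib_right)
qed (simp_all add: decay_0)

text \<open>Clocks of the same rate superpose to one clock of rate \<open>card I * rate\<close>, the
  waiting time of the Mecke process with \<open>card I\<close> cells; the addend of \<open>i\<close>
  belongs to the choice of the cell \<open>C i\<close>.\<close>

lemma prod_surv_eq_mecke:
  assumes I: "finite I" "I \<noteq> {}" and C: "\<And>i. i \<in> I \<Longrightarrow> C i \<in> cells W"
  shows "(\<Prod>i\<in>I. surv (C i) r) =
    (\<integral>\<^sup>+s. decay (real (card I) * rate) r s * (\<Prod>i\<in>I. unhit (C i) r s) *
      (\<Sum>i\<in>I. try_gain (C i) s * (\<Prod>j\<in>I - {i}. surv (C j) s)) * indicator {r..} s \<partial>lborel)"
proof (rule mild_unbounded[where T = T and U = "\<lambda>r. \<Prod>i\<in>I. surv (C i) r"])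
  have m: "try_gain (C i) \<in> borel_measurable borel" if "i \<in> I" for i
  proof -
    note [measurable] = surv_section_measurable[OF C[OF that]]
    have "(\<lambda>s. gain surv (C i) s + surv (C i) s * ennreal (rate - split_rate (C i))) \<in> borel_measurable borel"
      by measurable
    then show ?thesis using try_gain_eq[OF C[OF that]] by (simp cong: measurable_cong)
  qed
  have "mild T (\<lambda>r s. \<Prod>i\<in>I. decay rate r s * unhit (C i) r s)
      (\<lambda>s. \<Sum>i\<in>I. try_gain (C i) s * (\<Prod>j\<in>I - {i}. surv (C j) s)) (\<lambda>s. \<Prod>i\<in>I. surv (C i) s)"
    using m C by (intro mild_prod I(1) mild_surv_try multiplicative_mult multiplicative_decay multiplicative_unhit
      surv_section_measurable)
  then show "mild T (\<lambda>r s. decay (real (card I) * rate) r s * (\<Prod>i\<in>I. unhit (C i) r s))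
      (\<lambda>s. \<Sum>i\<in>I. try_gain (C i) s * (\<Prod>j\<in>I - {i}. surv (C j) s)) (\<lambda>s. \<Prod>i\<in>I. surv (C i) s)"
    by (simp only: prod.distrib prod_decay)
  show "real (card I) * rate > 0" using I rate by (simp add: card_gt_0_iff)
  show "multiplicative (\<lambda>r s. \<Prod>i\<in>I. unhit (C i) r s)"
    using C by (intro multiplicative_prod multiplicative_unhit)
  show "(\<lambda>s. \<Sum>i\<in>I. try_gain (C i) s * (\<Prod>j\<in>I - {i}. surv (C j) s)) \<in> borel_measurable borel"
    using m surv_section_measurable C by (intro borel_measurable_sum borel_measurable_times borel_measurable_prod) auto
  \<comment> \<open>Past \<open>T\<close> each of the \<open>card I\<close> addends equals
    \<open>rate\<close>, which gives the total rate that \<open>mild_unbounded\<close> asks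
    for.\<close>
  show "(\<Sum>i\<in>I. try_gain (C i) s * (\<Prod>j\<in>I - {i}. surv (C j) s)) = ennreal (real (card I) * rate)" if "T \<le> s" for s
  proof -
    have "try_gain (C i) s = ennreal rate" if "i \<in> I" for i
      using rate split_rate_nonneg split_rate_le \<open>T \<le> s\<close> C[OF that]
      by (simp add: try_gain_eq gain_after surv_after ennreal_plus[symmetric] del: ennreal_plus)
    then show ?thesis using that C rate
      by (simp add: surv_after ennreal_mult ennreal_of_nat_eq_real_of_nat)
  qed
qed (use C in \<open>simp_all add: surv_after unhit_after\<close>)

end

section \<open>The STIT process\<close>

text \<open>Generation of a \<sigma>-algebra becomes measurability of the identity map, which can be
  checked coordinate by coordinate when \<open>N\<close> is a product.\<close>

lemma sets_eq_sigma_of_measurable_ident: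
  assumes "space N = \<Omega>" "E \<subseteq> sets N" "(\<lambda>x. x) \<in> measurable (sigma \<Omega> E) N" "E \<subseteq> Pow \<Omega>"
  shows "sets N = sigma_sets \<Omega> E"
proof
  show "sigma_sets \<Omega> E \<subseteq> sets N"
    using assms(1,2) sets.sigma_sets_subset by blast
  show "sets N \<subseteq> sigma_sets \<Omega> E"
  proof
    fix A assume A: "A \<in> sets N"
    have "(\<lambda>x. x) -` A \<inter> space (sigma \<Omega> E) \<in> sets (sigma \<Omega> E)"
      using assms(3) A by (rule measurable_sets)
    moreover have "A \<subseteq> \<Omega>" using sets.sets_into_space[OF A] assms(1) by simp
    ultimately show "A \<in> sigma_sets \<Omega> E"
      using assms(4) by (simp add: space_measure_of sets_measure_of Int_absorb2)
  qed
qed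

abbreviation level :: "nat \<Rightarrow> bool list set" where
  "level n \<equiv> {w. length w = n}"

lemma finite_level [simp]: "finite (level n)"
  using finite_lists_length_eq[of "UNIV :: bool set" n] by simp

lemma prod_level_Suc: "(\<Prod>w\<in>level (Suc n). f w) = (\<Prod>w\<in>level n. f (True # w) * f (False # w))"
  for f :: "bool list \<Rightarrow> 'b :: comm_monoid_mult"
proof -
  have l: "level (Suc n) = (Cons True) ` level n \<union> (Cons False) ` level n"
  proof (intro equalityI subsetI)
    fix w assume "w \<in> level (Suc n)"
    then obtain b v where "w = b # v" "length v = n" by (auto simp: length_Suc_conv)
    then show "w \<in> (Cons True) ` level n \<union> (Cons False) ` level n" by (cases b) auto
  qed auto
  show ?thesis
    unfolding l by (subst prod.union_disjoint) (auto simp: prod.reindex inj_on_def prod.distrib)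
qed

lemma measurable_stit_data:
  assumes [measurable]: "\<And>w. L w \<in> borel_measurable M" "\<And>w. G w \<in> measurable M line_space"
  shows "(\<lambda>\<omega>. \<lambda>w\<in>{w. length w < n}. (L w \<omega>, G w \<omega>)) \<in> measurable M (Pi\<^sub>M {w. length w < n} (\<lambda>_. borel \<Otimes>\<^sub>M line_space))"
  by (rule measurable_restrict) measurable

lemma subalgebra_stit_history:
  assumes "\<And>w. L w \<in> borel_measurable M" "\<And>w. G w \<in> measurable M line_space"
  shows "subalgebra M (stit_history M L G n)"
proof -
  note hist = measurable_stit_data[of L M G n, OF assms]
  have "sets (stit_history M L G n) \<subseteq> sets M"
  proof
    fix A assume "A \<in> sets (stit_history M L G n)"
    then obtain D where D: "A = (\<lambda>\<omega>. \<lambda>w\<in>{w. length w < n}. (L w \<omega>, G w \<omega>)) -` D \<inter> space M"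
      "D \<in> sets (Pi\<^sub>M {w. length w < n} (\<lambda>_. borel \<Otimes>\<^sub>M line_space))"
      unfolding stit_history_def
      by (subst (asm) sets_vimage_algebra2) (use measurable_space[OF hist] in auto)
    show "A \<in> sets M" unfolding D(1) using hist D(2) by (rule measurable_sets)
  qed
  then show ?thesis by (simp add: subalgebra_def stit_history_def)
qed

text \<open>An open set misses the closure of a set iff it misses the set, so the event becomes one
  condition per cell.\<close>

lemma stit_misses_iff:
  assumes "open U"
  shows "stit W l g t \<inter> U = {} \<longleftrightarrow>
    (\<forall>w. stit_birth l w \<le> t \<and> t < stit_birth l w + l w \<longrightarrow> frontier (stit_cell W g w) \<inter> (U - frontier W) = {})"
proof -
  have "stit W l g t \<inter> U = {} \<longleftrightarrow>
      U \<inter> ((\<Union>w\<in>stit_alive l t. frontier (stit_cell W g w)) - frontier W) = {}"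
    unfolding stit_def Int_commute[of "closure _"] by (rule open_Int_closure_eq_empty[OF assms])
  also have "\<dots> \<longleftrightarrow> (\<forall>w. stit_birth l w \<le> t \<and> t < stit_birth l w + l w \<longrightarrow>
      frontier (stit_cell W g w) \<inter> (U - frontier W) = {})"
    by (auto simp: stit_alive_def)
  finally show ?thesis .
qed

text \<open>\<open>law\<close> is the conditional law of \<open>stit_data\<close> in integrated
  form, over events \<open>A\<close> of the earlier generations, with lifetime and line of each cell
  described by a joint density.\<close>

locale stit_run = splitting W Q rate F T
  for W :: "(real^2) set" and Q :: "(real^2) set measure" and rate :: real
    and F :: "(real \<times> (real^2) set) set" and T :: real +
  fixes M :: "'a measure" and L :: "bool list \<Rightarrow> 'a \<Rightarrow> real" and G :: "bool list \<Rightarrow> 'a \<Rightarrow> (real^2) set"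
  assumes prob_M: "prob_space M"
    and L_meas [measurable]: "\<And>w. L w \<in> borel_measurable M"
    and G_meas [measurable]: "\<And>w. G w \<in> measurable M line_space"
    and law: "\<And>n I B A. (\<And>w. length w = n \<Longrightarrow> I w \<in> sets borel) \<Longrightarrow>
        (\<And>w. length w = n \<Longrightarrow> B w \<in> sets line_space) \<Longrightarrow> A \<in> sets (stit_history M L G n) \<Longrightarrow>
        emeasure M {\<omega> \<in> A. \<forall>w. length w = n \<longrightarrow> L w \<omega> \<in> I w \<and> G w \<omega> \<in> B w} =
        (\<integral>\<^sup>+\<omega>\<in>A. (\<Prod>w\<in>level n. \<integral>\<^sup>+p\<in>I w \<times> B w.
           ennreal rate * decay (split_rate (stit_cell W (\<lambda>u. G u \<omega>) w)) 0 (fst p) * indicator {0..} (fst p) *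
             of_bool (cuts (stit_cell W (\<lambda>u. G u \<omega>) w) (snd p)) \<partial>(lborel \<Otimes>\<^sub>M Q)) \<partial>M)"
    and split_pos: "\<And>w. AE \<omega> in M. 0 < split_rate (stit_cell W (\<lambda>u. G u \<omega>) w)"
begin

interpretation Q: prob_space Q by (rule prob_Q)
interpretation M: prob_space M by (rule prob_M)

abbreviation R :: "(real \<times> (real^2) set) measure" where "R \<equiv> lborel \<Otimes>\<^sub>M Q"
abbreviation H :: "nat \<Rightarrow> 'a measure" where "H n \<equiv> stit_history M L G n"
abbreviation cell :: "bool list \<Rightarrow> 'a \<Rightarrow> (real^2) set" where "cell w \<omega> \<equiv> stit_cell W (\<lambda>u. G u \<omega>) w"
abbreviation birth :: "bool list \<Rightarrow> 'a \<Rightarrow> real" where "birth w \<omega> \<equiv> stit_birth (\<lambda>u. L u \<omega>) w"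
abbreviation gen :: "nat \<Rightarrow> 'a \<Rightarrow> bool list \<Rightarrow> real \<times> (real^2) set" where
  "gen n \<omega> \<equiv> (\<lambda>w\<in>level n. (L w \<omega>, G w \<omega>))"

text \<open>With \<open>a = split_rate C\<close>: the exponential density
  \<open>a * exp (- a * l)\<close> times the density \<open>rate / a\<close> that the dividing line
  has with respect to \<open>Q\<close> on the lines cutting \<open>C\<close>. The factor
  \<open>a\<close> cancels.\<close>

definition dens :: "(real^2) set \<Rightarrow> real \<times> (real^2) set \<Rightarrow> ennreal" where
  "dens C p = ennreal rate * decay (split_rate C) 0 (fst p) * indicator {0..} (fst p) * of_bool (cuts C (snd p))"

section \<open>Measurability along the tree\<close>

lemma sets_R: "sets R = sets (borel \<Otimes>\<^sub>M line_space)"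
  by (intro sets_pair_measure_cong sets_Q sets_lborel)

lemma sigma_finite_R: "sigma_finite_measure R"
proof -
  interpret pair_sigma_finite lborel Q ..
  show ?thesis by unfold_locales
qed

lemma space_H: "space (H n) = space M"
  by (simp add: stit_history_def)

lemma subalgebra_H: "subalgebra M (H n)"
  by (rule subalgebra_stit_history[OF L_meas G_meas])

lemma H_coordinates:
  assumes "length w < n"
  shows "L w \<in> borel_measurable (H n)" "G w \<in> measurable (H n) line_space"
proof -
  have "(\<lambda>\<omega>. \<lambda>w\<in>{w. length w < n}. (L w \<omega>, G w \<omega>)) \<in> measurable (H n) (Pi\<^sub>M {w. length w < n} (\<lambda>_. borel \<Otimes>\<^sub>M line_space))"
    unfolding stit_history_def by (rule measurable_vimage_algebra1) (use measurable_space[OF measurable_stit_data[of L M G n, OF L_meas G_meas]] in auto)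
  from measurable_compose[OF this measurable_component_singleton[of w]] assms
  have "(\<lambda>\<omega>. (L w \<omega>, G w \<omega>)) \<in> measurable (H n) (borel \<Otimes>\<^sub>M line_space)" by simp
  from measurable_compose[OF this measurable_fst] measurable_compose[OF this measurable_snd]
  show "L w \<in> borel_measurable (H n)" "G w \<in> measurable (H n) line_space" by simp_all
qed

lemma measurable_birth_gen:
  assumes "\<And>u. length u < length w \<Longrightarrow> L u \<in> borel_measurable N"
  shows "birth w \<in> borel_measurable N"
  using assms by (induction w) auto

lemma measurable_cell_gen:
  assumes "\<And>u. length u < length w \<Longrightarrow> G u \<in> measurable N line_space"
  shows "cell w \<in> measurable N (cell_space W)"
  using assms
proof (induction w)
  case Nil
  then show ?case by (simp add: space_cell_space cells_top convex_W)
next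
  case (Cons s w)
  then have [measurable]: "cell w \<in> measurable N (cell_space W)" "G w \<in> measurable N line_space" by auto
  show ?case by (cases s) simp_all
qed

lemma measurable_birth_H: "length w \<le> n \<Longrightarrow> birth w \<in> borel_measurable (H n)"
  and measurable_cell_H: "length w \<le> n \<Longrightarrow> cell w \<in> measurable (H n) (cell_space W)"
  by (intro measurable_birth_gen measurable_cell_gen H_coordinates; simp)+

lemma measurable_birth [measurable]: "birth w \<in> borel_measurable M"
  and measurable_cell [measurable]: "cell w \<in> measurable M (cell_space W)"
  by (intro measurable_birth_gen measurable_cell_gen; simp)+

lemma cell_in_cells: "\<omega> \<in> space M \<Longrightarrow> cell w \<omega> \<in> cells W"
  using measurable_space[OF measurable_cell] by (simp add: space_cell_space)

lemma measurable_dens [measurable (raw)]: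
  assumes [measurable]: "f \<in> measurable N (cell_space W)" "g \<in> measurable N (borel \<Otimes>\<^sub>M line_space)"
  shows "(\<lambda>x. dens (f x) (g x)) \<in> borel_measurable N"
  unfolding dens_def by measurable

lemma measurable_gen: "gen n \<in> measurable M (Pi\<^sub>M (level n) (\<lambda>_. R))"
proof -
  have "gen n \<in> measurable M (Pi\<^sub>M (level n) (\<lambda>_. borel \<Otimes>\<^sub>M line_space))"
    by (rule measurable_restrict) measurable
  then show ?thesis
    by (subst measurable_cong_sets[OF refl sets_PiM_cong[OF refl sets_R]])
qed

lemma measurable_history_gen: "(\<lambda>\<omega>. (\<omega>, gen n \<omega>)) \<in> measurable M (H n \<Otimes>\<^sub>M Pi\<^sub>M (level n) (\<lambda>_. R))"
proof (rule measurable_Pair[OF _ measurable_gen])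
  show "(\<lambda>\<omega>. \<omega>) \<in> measurable M (H n)"
    using subalgebra_H[of n] by (intro measurableI) (auto simp: subalgebra_def)
qed

section \<open>Joint law of one generation and its past\<close>

definition rects :: "nat \<Rightarrow> ('a \<times> (bool list \<Rightarrow> real \<times> (real^2) set)) set set" where
  "rects n = {A \<times> (\<Pi>\<^sub>E w\<in>level n. I w \<times> B w) | A I B.
     A \<in> sets (H n) \<and> (\<forall>w. I w \<in> sets borel) \<and> (\<forall>w. B w \<in> sets line_space)}"

lemma sets_rects:
  "sets (H n \<Otimes>\<^sub>M Pi\<^sub>M (level n) (\<lambda>_. R)) = sigma_sets (space (H n \<Otimes>\<^sub>M Pi\<^sub>M (level n) (\<lambda>_. R))) (rects n)"
proof (rule sets_eq_sigma_of_measurable_ident[OF refl])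
  let ?N = "H n \<Otimes>\<^sub>M Pi\<^sub>M (level n) (\<lambda>_. R)"
  show sub: "rects n \<subseteq> sets ?N"
    unfolding rects_def by (auto intro!: pair_measureI sets_PiM_I_finite simp: sets_R)
  then show Pow: "rects n \<subseteq> Pow (space ?N)" using sets.sets_into_space by blast
  define S where "S = sigma (space ?N) (rects n)"
  have spN: "space ?N = space (H n) \<times> (\<Pi>\<^sub>E w\<in>level n. UNIV \<times> lines)"
    by (simp add: space_pair_measure space_PiM space_Q)
  have spS: "space S = space (H n) \<times> (\<Pi>\<^sub>E w\<in>level n. UNIV \<times> lines)"
    using Pow by (simp add: S_def space_measure_of flip: spN)
  have rS: "X \<in> sets S" if "X \<in> rects n" for X
    using that Pow by (simp add: S_def sets_measure_of sigma_sets.Basic)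
  have lines: "lines \<in> sets line_space" using sets.top[of line_space] by (simp add: space_line_space)
  have "(\<lambda>x. x) \<in> measurable S ?N"
  proof (subst measurable_pair_iff, intro conjI)
    show "fst \<circ> (\<lambda>x. x) \<in> measurable S (H n)"
    proof (rule measurableI)
      fix A assume A: "A \<in> sets (H n)"
      have "(fst \<circ> (\<lambda>x. x)) -` A \<inter> space S = A \<times> (\<Pi>\<^sub>E w\<in>level n. UNIV \<times> lines)"
        using sets.sets_into_space[OF A] by (auto simp: spS)
      also have "\<dots> \<in> rects n"
        unfolding rects_def using A lines by (intro CollectI exI[of _ A] exI[of _ "\<lambda>_. UNIV"] exI[of _ "\<lambda>_. lines"]) auto
      finally show "(fst \<circ> (\<lambda>x. x)) -` A \<inter> space S \<in> sets S" by (rule rS)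
    qed (auto simp: spS)
    show "snd \<circ> (\<lambda>x. x) \<in> measurable S (Pi\<^sub>M (level n) (\<lambda>_. R))"
    proof (rule measurable_PiM_single')
      fix v assume v: "v \<in> level n"
      show "(\<lambda>x. (snd \<circ> (\<lambda>x. x)) x v) \<in> measurable S R"
      proof (subst measurable_pair_iff, intro conjI)
        show "fst \<circ> (\<lambda>x. (snd \<circ> (\<lambda>x. x)) x v) \<in> measurable S lborel"
        proof (rule measurableI)
          fix J :: "real set" assume J: "J \<in> sets lborel"
          have "(fst \<circ> (\<lambda>x. (snd \<circ> (\<lambda>x. x)) x v)) -` J \<inter> space S =
            space (H n) \<times> (\<Pi>\<^sub>E w\<in>level n. (if w = v then J else UNIV) \<times> lines)"
            using v by (auto simp: spS PiE_iff mem_Times_iff split: if_splits)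
          also have "\<dots> \<in> rects n"
            unfolding rects_def using J lines
            by (intro CollectI exI[of _ "space (H n)"] exI[of _ "\<lambda>w. if w = v then J else UNIV"] exI[of _ "\<lambda>_. lines"]) auto
          finally show "(fst \<circ> (\<lambda>x. (snd \<circ> (\<lambda>x. x)) x v)) -` J \<inter> space S \<in> sets S" by (rule rS)
        qed simp
        show "snd \<circ> (\<lambda>x. (snd \<circ> (\<lambda>x. x)) x v) \<in> measurable S Q"
        proof (rule measurableI)
          fix J assume J: "J \<in> sets Q"
          have JL: "J \<subseteq> lines" using sets.sets_into_space[OF J] by (simp add: space_Q)
          have "(snd \<circ> (\<lambda>x. (snd \<circ> (\<lambda>x. x)) x v)) -` J \<inter> space S =
            space (H n) \<times> (\<Pi>\<^sub>E w\<in>level n. UNIV \<times> (if w = v then J else lines))"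
            using v JL by (auto simp: spS PiE_iff mem_Times_iff split: if_splits) (metis subsetD)
          also have "\<dots> \<in> rects n"
            unfolding rects_def using J lines
            by (intro CollectI exI[of _ "space (H n)"] exI[of _ "\<lambda>_. UNIV"] exI[of _ "\<lambda>w. if w = v then J else lines"])
               (auto simp: sets_Q)
          finally show "(snd \<circ> (\<lambda>x. (snd \<circ> (\<lambda>x. x)) x v)) -` J \<inter> space S \<in> sets S" by (rule rS)
        qed (use v in \<open>auto simp: spS space_Q PiE_iff mem_Times_iff\<close>)
      qed
    qed (auto simp: spS space_pair_measure space_Q dest: PiE_mem)
  qed
  then show "(\<lambda>x. x) \<in> measurable (sigma (space ?N) (rects n)) ?N" by (simp only: S_def)
qed

lemma nn_integral_Pi_R_prod:
  assumes "finite I" "\<And>w. w \<in> I \<Longrightarrow> f w \<in> borel_measurable R"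
  shows "(\<integral>\<^sup>+y. (\<Prod>w\<in>I. f w (y w)) \<partial>Pi\<^sub>M I (\<lambda>_. R)) = (\<Prod>w\<in>I. \<integral>\<^sup>+p. f w p \<partial>R)"
proof -
  interpret product_sigma_finite "\<lambda>_. R"
    using sigma_finite_R by (simp add: product_sigma_finite_def)
  show ?thesis using assms by (rule product_nn_integral_prod)
qed

lemma sigma_finite_Pi_R: "sigma_finite_measure (Pi\<^sub>M (level n) (\<lambda>_. R))"
proof -
  interpret product_sigma_finite "\<lambda>_. R"
    using sigma_finite_R by (simp add: product_sigma_finite_def)
  show ?thesis by (rule sigma_finite) simp
qed

text \<open>Generation \<open>n\<close> has a density conditionally on the past; the first factor of
  the product may therefore know the past only, which is why \<open>M\<close> is restricted to
  \<open>H n\<close>.\<close>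

abbreviation MH :: "nat \<Rightarrow> 'a measure" where "MH n \<equiv> restr_to_subalg M (H n)"

lemma sets_MH: "sets (MH n) = sets (H n)"
  by (rule sets_restr_to_subalg[OF subalgebra_H])

lemma sets_MH_pair: "sets (MH n \<Otimes>\<^sub>M N) = sets (H n \<Otimes>\<^sub>M N)"
  by (intro sets_pair_measure_cong sets_MH refl)

lemma measurable_MH_pair: "f \<in> measurable (H n \<Otimes>\<^sub>M N) K \<longleftrightarrow> f \<in> measurable (MH n \<Otimes>\<^sub>M N) K"
  by (simp only: measurable_cong_sets[OF sets_MH_pair refl])

lemma measurable_dens_level:
  assumes "w \<in> level n"
  shows "(\<lambda>z. dens (cell w (fst z)) (snd z)) \<in> borel_measurable (H n \<Otimes>\<^sub>M R)"
    and "(\<lambda>z. dens (cell w (fst z)) (snd z w)) \<in> borel_measurable (H n \<Otimes>\<^sub>M Pi\<^sub>M (level n) (\<lambda>_. R))"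
proof -
  have [measurable]: "cell w \<in> measurable (H n) (cell_space W)"
    using assms by (intro measurable_cell_H) simp
  have [measurable]: "(\<lambda>y. y w) \<in> measurable (Pi\<^sub>M (level n) (\<lambda>_. R)) (borel \<Otimes>\<^sub>M line_space)"
    using measurable_component_singleton[OF assms, of "\<lambda>_. R"] by (simp add: measurable_cong_sets[OF refl sets_R])
  have [measurable]: "(\<lambda>p. p) \<in> measurable R (borel \<Otimes>\<^sub>M line_space)"
    by (simp add: measurable_cong_sets[OF refl sets_R[symmetric]])
  show "(\<lambda>z. dens (cell w (fst z)) (snd z)) \<in> borel_measurable (H n \<Otimes>\<^sub>M R)"
    by (intro measurable_dens measurable_compose[OF measurable_snd \<open>(\<lambda>p. p) \<in> _\<close>]) measurable
  show "(\<lambda>z. dens (cell w (fst z)) (snd z w)) \<in> borel_measurable (H n \<Otimes>\<^sub>M Pi\<^sub>M (level n) (\<lambda>_. R))"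
    by measurable
qed

text \<open>By \<open>law\<close> both measures agree on rectangles built from an event of the past
  and one set per cell; these are stable under intersection and generate the product
  \<sigma>-algebra.\<close>

lemma joint_law:
  "distr M (MH n \<Otimes>\<^sub>M Pi\<^sub>M (level n) (\<lambda>_. R)) (\<lambda>\<omega>. (\<omega>, gen n \<omega>)) =
   density (MH n \<Otimes>\<^sub>M Pi\<^sub>M (level n) (\<lambda>_. R)) (\<lambda>z. \<Prod>w\<in>level n. dens (cell w (fst z)) (snd z w))"
proof -
  let ?P = "Pi\<^sub>M (level n) (\<lambda>_. R)"
  let ?N = "MH n \<Otimes>\<^sub>M ?P"
  let ?D = "\<lambda>z. \<Prod>w\<in>level n. dens (cell w (fst z)) (snd z w)"
  let ?L = "distr M ?N (\<lambda>\<omega>. (\<omega>, gen n \<omega>))"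
  interpret P: sigma_finite_measure ?P by (rule sigma_finite_Pi_R)
  have sub: "rects n \<subseteq> sets ?N"
    unfolding sets_MH_pair sets_rects by (auto intro: sigma_sets.Basic)
  have spN: "space ?N = space M \<times> (\<Pi>\<^sub>E w\<in>level n. UNIV \<times> lines)"
    by (simp add: space_pair_measure space_PiM space_Q space_restr_to_subalg)
  have Dm: "?D \<in> borel_measurable ?N"
    unfolding measurable_MH_pair[symmetric] using measurable_dens_level(2) by (intro borel_measurable_prod_ennreal) auto
  have map_meas: "(\<lambda>\<omega>. (\<omega>, gen n \<omega>)) \<in> measurable M ?N"
    using measurable_history_gen[of n] by (subst measurable_cong_sets[OF refl sets_MH_pair])
  have lines: "lines \<in> sets line_space" using sets.top[of line_space] by (simp add: space_line_space)
  have eq: "emeasure ?L X = emeasure (density ?N ?D) X" if XX: "X \<in> rects n" for X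
  proof -
    obtain A I B where X: "X = A \<times> (\<Pi>\<^sub>E w\<in>level n. I w \<times> B w)" "A \<in> sets (H n)"
      and I: "\<And>w. I w \<in> sets borel" and B: "\<And>w. B w \<in> sets line_space"
      using XX unfolding rects_def by blast
    let ?p = "\<lambda>\<omega> y. \<Prod>w\<in>level n. dens (cell w \<omega>) (y w) * indicator (I w \<times> B w) (y w)"
    have A: "A \<subseteq> space M" using sets.sets_into_space[OF X(2)] by (simp add: space_H)
    have IB: "I w \<times> B w \<in> sets R" for w
      using I B by (auto simp: sets_R intro!: pair_measureI)
    have "emeasure ?L X = emeasure M ((\<lambda>\<omega>. (\<omega>, gen n \<omega>)) -` X \<inter> space M)"
      using sub that by (intro emeasure_distr map_meas) auto
    also have "(\<lambda>\<omega>. (\<omega>, gen n \<omega>)) -` X \<inter> space M = {\<omega> \<in> A. \<forall>w. length w = n \<longrightarrow> L w \<omega> \<in> I w \<and> G w \<omega> \<in> B w}"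
      using A by (auto simp: X(1) PiE_iff)
    also have "emeasure M \<dots> = (\<integral>\<^sup>+\<omega>\<in>A. (\<Prod>w\<in>level n. \<integral>\<^sup>+p\<in>I w \<times> B w. dens (cell w \<omega>) p \<partial>R) \<partial>M)"
      unfolding dens_def by (rule law[OF I B X(2)])
    also have "\<dots> = (\<integral>\<^sup>+\<omega>. indicator A \<omega> * (\<integral>\<^sup>+y. ?p \<omega> y \<partial>?P) \<partial>M)"
    proof (rule nn_integral_cong)
      fix \<omega> assume w: "\<omega> \<in> space M"
      have "(\<lambda>p. dens (cell w \<omega>) p * indicator (I w \<times> B w) p) \<in> borel_measurable R" if "w \<in> level n" for w
      proof -
        have "(\<lambda>p. dens (cell w \<omega>) p) \<in> borel_measurable R"
          using measurable_compose[OF measurable_Pair1'[of \<omega> "H n" R] measurable_dens_level(1)[OF that]] w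
          by (simp add: space_H)
        then show ?thesis using IB by measurable
      qed
      then show "(\<Prod>w\<in>level n. \<integral>\<^sup>+p\<in>I w \<times> B w. dens (cell w \<omega>) p \<partial>R) * indicator A \<omega> =
         indicator A \<omega> * (\<integral>\<^sup>+y. ?p \<omega> y \<partial>?P)"
        by (subst nn_integral_Pi_R_prod) (simp_all add: mult.commute)
    qed
    also have "\<dots> = (\<integral>\<^sup>+\<omega>. (\<integral>\<^sup>+y. ?D (\<omega>, y) * indicator X (\<omega>, y) \<partial>?P) \<partial>M)"
    proof (rule nn_integral_cong)
      fix \<omega> assume w: "\<omega> \<in> space M"
      have "indicator A \<omega> * (\<integral>\<^sup>+y. ?p \<omega> y \<partial>?P) =
         (\<integral>\<^sup>+y. indicator A \<omega> * ?p \<omega> y \<partial>?P)"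
        by (cases "\<omega> \<in> A") simp_all
      also have "\<dots> = (\<integral>\<^sup>+y. ?D (\<omega>, y) * indicator X (\<omega>, y) \<partial>?P)"
      proof (rule nn_integral_cong)
        fix y assume y: "y \<in> space ?P"
        show "indicator A \<omega> * ?p \<omega> y =
          ?D (\<omega>, y) * indicator X (\<omega>, y)"
        proof -
          have "(\<Prod>w\<in>level n. indicator (I w \<times> B w) (y w)) = (indicator (\<Pi>\<^sub>E w\<in>level n. I w \<times> B w) y :: ennreal)"
          proof (cases "y \<in> (\<Pi>\<^sub>E w\<in>level n. I w \<times> B w)")
            case False
            then obtain w where "w \<in> level n" "y w \<notin> I w \<times> B w" using y by (auto simp: space_PiM PiE_iff)
            then show ?thesis using False by (auto intro!: prod_zero)
          qed (auto simp: PiE_iff intro!: prod.neutral)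
          then have "?p \<omega> y =
              (\<Prod>w\<in>level n. dens (cell w \<omega>) (y w)) * indicator (\<Pi>\<^sub>E w\<in>level n. I w \<times> B w) y"
            by (simp only: prod.distrib)
          moreover have "(indicator X (\<omega>, y) :: ennreal) = indicator A \<omega> * indicator (\<Pi>\<^sub>E w\<in>level n. I w \<times> B w) y"
            unfolding X(1) by (simp only: indicator_times fst_conv snd_conv)
          ultimately show ?thesis by (simp only: fst_conv snd_conv mult_ac)
        qed
      qed
      finally show "indicator A \<omega> * (\<integral>\<^sup>+y. ?p \<omega> y \<partial>?P) =
         (\<integral>\<^sup>+y. ?D (\<omega>, y) * indicator X (\<omega>, y) \<partial>?P)" .
    qed
    \<comment> \<open>The inner integral depends on the past only, so it may be integrated against
      the restricted measure.\<close>
    also have "\<dots> = (\<integral>\<^sup>+\<omega>. (\<integral>\<^sup>+y. ?D (\<omega>, y) * indicator X (\<omega>, y) \<partial>?P) \<partial>MH n)"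
    proof (rule nn_integral_subalgebra2[OF subalgebra_H, symmetric])
      have "(\<lambda>\<omega>. \<integral>\<^sup>+y. ?D (\<omega>, y) * indicator X (\<omega>, y) \<partial>?P) \<in> borel_measurable (MH n)"
        using Dm sub that by (intro P.borel_measurable_nn_integral_fst) auto
      then show "(\<lambda>\<omega>. \<integral>\<^sup>+y. ?D (\<omega>, y) * indicator X (\<omega>, y) \<partial>?P) \<in> borel_measurable (H n)"
        by (simp add: measurable_cong_sets[OF sets_MH refl])
    qed
    also have "\<dots> = (\<integral>\<^sup>+z. ?D z * indicator X z \<partial>?N)"
      using Dm sub that by (intro P.nn_integral_fst) auto
    also have "\<dots> = emeasure (density ?N ?D) X"
      using Dm sub that by (intro emeasure_density[symmetric]) auto
    finally show ?thesis .
  qed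
  have whole: "space ?N \<in> rects n"
    unfolding rects_def spN using lines sets.top[of "H n"]
    by (intro CollectI exI[of _ "space M"] exI[of _ "\<lambda>_. UNIV"] exI[of _ "\<lambda>_. lines"]) (auto simp: space_H)
  show ?thesis
  proof (rule measure_eqI_generator_eq[where E = "rects n" and \<Omega> = "space ?N" and A = "\<lambda>_. space ?N"])
    show "Int_stable (rects n)"
    proof (rule Int_stableI)
      fix X Y assume "X \<in> rects n" "Y \<in> rects n"
      then obtain A I B A' I' B' where X: "X = A \<times> (\<Pi>\<^sub>E w\<in>level n. I w \<times> B w)" "A \<in> sets (H n)"
        "\<And>w. I w \<in> sets borel" "\<And>w. B w \<in> sets line_space"
        and Y: "Y = A' \<times> (\<Pi>\<^sub>E w\<in>level n. I' w \<times> B' w)" "A' \<in> sets (H n)"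
        "\<And>w. I' w \<in> sets borel" "\<And>w. B' w \<in> sets line_space"
        unfolding rects_def by blast
      have "X \<inter> Y = (A \<inter> A') \<times> (\<Pi>\<^sub>E w\<in>level n. (I w \<inter> I' w) \<times> (B w \<inter> B' w))"
        unfolding X Y by (auto simp: PiE_iff mem_Times_iff)
      then show "X \<inter> Y \<in> rects n"
        unfolding rects_def using X Y
        by (intro CollectI exI[of _ "A \<inter> A'"] exI[of _ "\<lambda>w. I w \<inter> I' w"] exI[of _ "\<lambda>w. B w \<inter> B' w"]) auto
    qed
    show "rects n \<subseteq> Pow (space ?N)" using sub sets.sets_into_space by blast
    have "sets ?N = sigma_sets (space ?N) (rects n)"
      using sets_rects[of n] sets_eq_imp_space_eq[OF sets_MH_pair, of n ?P] by (simp only: sets_MH_pair)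
    then show "sets ?L = sigma_sets (space ?N) (rects n)"
      "sets (density ?N ?D) = sigma_sets (space ?N) (rects n)" by simp_all
    show "range (\<lambda>_. space ?N) \<subseteq> rects n" using whole by auto
    have "emeasure ?L (space ?N) \<le> 1"
      using prob_space.measure_le_1[OF M.prob_space_distr[OF map_meas]]
      by (simp add: finite_measure.emeasure_eq_measure[OF prob_space.finite_measure[OF M.prob_space_distr[OF map_meas]]])
    then show "emeasure ?L (space ?N) \<noteq> \<infinity>" by (auto simp: top_unique)
  qed (use eq in auto)
qed

text \<open>Integration of generation \<open>n\<close> given its past: \<open>joint_law\<close>
  replaces it by a density that is a product over the cells, so the factors \<open>\<phi> w\<close>
  can be integrated cell by cell.\<close>

lemma one_step:
  assumes X0: "X0 \<in> borel_measurable (H n)"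
    and \<phi>: "\<And>w. w \<in> level n \<Longrightarrow> (\<lambda>z. \<phi> w (fst z) (snd z)) \<in> borel_measurable (H n \<Otimes>\<^sub>M R)"
  shows "(\<integral>\<^sup>+\<omega>. X0 \<omega> * (\<Prod>w\<in>level n. \<phi> w \<omega> (L w \<omega>, G w \<omega>)) \<partial>M) =
     (\<integral>\<^sup>+\<omega>. X0 \<omega> * (\<Prod>w\<in>level n. \<integral>\<^sup>+p. \<phi> w \<omega> p * dens (cell w \<omega>) p \<partial>R) \<partial>M)"
proof -
  let ?P = "Pi\<^sub>M (level n) (\<lambda>_. R)"
  let ?N = "MH n \<Otimes>\<^sub>M ?P"
  let ?D = "\<lambda>z. \<Prod>w\<in>level n. dens (cell w (fst z)) (snd z w)"
  let ?f = "\<lambda>z. X0 (fst z) * (\<Prod>w\<in>level n. \<phi> w (fst z) (snd z w))"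
  interpret P: sigma_finite_measure ?P by (rule sigma_finite_Pi_R)
  have map_meas: "(\<lambda>\<omega>. (\<omega>, gen n \<omega>)) \<in> measurable M ?N"
    using measurable_history_gen[of n] by (subst measurable_cong_sets[OF refl sets_MH_pair])
  have Dm: "?D \<in> borel_measurable ?N"
    unfolding measurable_MH_pair[symmetric] using measurable_dens_level(2) by (intro borel_measurable_prod_ennreal) auto
  have \<phi>m: "(\<lambda>z. \<phi> w (fst z) (snd z w)) \<in> borel_measurable (H n \<Otimes>\<^sub>M ?P)" if "w \<in> level n" for w
  proof -
    have [measurable]: "(\<lambda>y. y w) \<in> measurable ?P R" by (rule measurable_component_singleton[OF that])
    have "(\<lambda>z. (fst z, snd z w)) \<in> measurable (H n \<Otimes>\<^sub>M ?P) (H n \<Otimes>\<^sub>M R)" by measurable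
    from measurable_compose[OF this \<phi>[OF that]] show ?thesis by simp
  qed
  have fm: "?f \<in> borel_measurable ?N"
    unfolding measurable_MH_pair[symmetric] using \<phi>m
    by (intro borel_measurable_times_ennreal measurable_compose[OF measurable_fst X0] borel_measurable_prod_ennreal) auto
  have "(\<integral>\<^sup>+\<omega>. X0 \<omega> * (\<Prod>w\<in>level n. \<phi> w \<omega> (L w \<omega>, G w \<omega>)) \<partial>M) = (\<integral>\<^sup>+\<omega>. ?f (\<omega>, gen n \<omega>) \<partial>M)"
    by (intro nn_integral_cong) (auto intro!: arg_cong2[where f = times] prod.cong)
  also have "\<dots> = (\<integral>\<^sup>+z. ?f z \<partial>distr M ?N (\<lambda>\<omega>. (\<omega>, gen n \<omega>)))"
    using fm by (intro nn_integral_distr[symmetric] map_meas) auto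
  also have "\<dots> = (\<integral>\<^sup>+z. ?D z * ?f z \<partial>?N)"
    unfolding joint_law by (rule nn_integral_density[OF Dm fm])
  also have "\<dots> = (\<integral>\<^sup>+\<omega>. (\<integral>\<^sup>+y. ?D (\<omega>, y) * ?f (\<omega>, y) \<partial>?P) \<partial>MH n)"
    using Dm fm by (intro P.nn_integral_fst[symmetric]) auto
  also have "\<dots> = (\<integral>\<^sup>+\<omega>. (\<integral>\<^sup>+y. ?D (\<omega>, y) * ?f (\<omega>, y) \<partial>?P) \<partial>M)"
  proof (rule nn_integral_subalgebra2[OF subalgebra_H])
    have "(\<lambda>\<omega>. \<integral>\<^sup>+y. ?D (\<omega>, y) * ?f (\<omega>, y) \<partial>?P) \<in> borel_measurable (MH n)"
      using Dm fm by (intro P.borel_measurable_nn_integral_fst) auto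
    then show "(\<lambda>\<omega>. \<integral>\<^sup>+y. ?D (\<omega>, y) * ?f (\<omega>, y) \<partial>?P) \<in> borel_measurable (H n)"
      by (simp add: measurable_cong_sets[OF sets_MH refl])
  qed
  also have "\<dots> = (\<integral>\<^sup>+\<omega>. X0 \<omega> * (\<Prod>w\<in>level n. \<integral>\<^sup>+p. \<phi> w \<omega> p * dens (cell w \<omega>) p \<partial>R) \<partial>M)"
  proof (rule nn_integral_cong)
    fix \<omega> assume w: "\<omega> \<in> space M"
    have m: "(\<lambda>p. \<phi> w \<omega> p * dens (cell w \<omega>) p) \<in> borel_measurable R" if "w \<in> level n" for w
      using measurable_compose[OF measurable_Pair1'[of \<omega> "H n" R] measurable_dens_level(1)[OF that]]
        measurable_compose[OF measurable_Pair1'[of \<omega> "H n" R] \<phi>[OF that]] w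
      by (intro borel_measurable_times_ennreal) (simp_all add: space_H)
    have "(\<integral>\<^sup>+y. ?D (\<omega>, y) * ?f (\<omega>, y) \<partial>?P) =
        (\<integral>\<^sup>+y. X0 \<omega> * (\<Prod>w\<in>level n. \<phi> w \<omega> (y w) * dens (cell w \<omega>) (y w)) \<partial>?P)"
      by (intro nn_integral_cong) (simp only: fst_conv snd_conv prod.distrib mult_ac)
    also have "\<dots> = X0 \<omega> * (\<integral>\<^sup>+y. (\<Prod>w\<in>level n. \<phi> w \<omega> (y w) * dens (cell w \<omega>) (y w)) \<partial>?P)"
    proof (rule nn_integral_cmult)
      have "(\<lambda>y. \<phi> w \<omega> (y w) * dens (cell w \<omega>) (y w)) \<in> borel_measurable ?P" if "w \<in> level n" for w
        by (rule measurable_compose[OF measurable_component_singleton[OF that] m[OF that]])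
      then show "(\<lambda>y. \<Prod>w\<in>level n. \<phi> w \<omega> (y w) * dens (cell w \<omega>) (y w)) \<in> borel_measurable ?P"
        by (intro borel_measurable_prod_ennreal) auto
    qed
    also have "(\<integral>\<^sup>+y. (\<Prod>w\<in>level n. \<phi> w \<omega> (y w) * dens (cell w \<omega>) (y w)) \<partial>?P) =
        (\<Prod>w\<in>level n. \<integral>\<^sup>+p. \<phi> w \<omega> p * dens (cell w \<omega>) p \<partial>R)"
      by (rule nn_integral_Pi_R_prod) (use m in auto)
    finally show "(\<integral>\<^sup>+y. ?D (\<omega>, y) * ?f (\<omega>, y) \<partial>?P) =
        X0 \<omega> * (\<Prod>w\<in>level n. \<integral>\<^sup>+p. \<phi> w \<omega> p * dens (cell w \<omega>) p \<partial>R)" .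
  qed
  finally show ?thesis .
qed

section \<open>One lifetime and one dividing line\<close>

lemma nn_integral_dens:
  assumes C: "C \<in> cells W" and [measurable]: "f \<in> borel_measurable borel" "h \<in> borel_measurable (borel \<Otimes>\<^sub>M line_space)"
  shows "(\<integral>\<^sup>+p. f (fst p) * h p * dens C p \<partial>R) =
    (\<integral>\<^sup>+l. decay (split_rate C) 0 l * f l * (ennreal rate * (\<integral>\<^sup>+g. (if cuts C g then h (l, g) else 0) \<partial>Q)) * indicator {0..} l \<partial>lborel)"
proof -
  note [measurable] = const_cell[OF C]
  have [measurable]: "(\<lambda>p. f (fst p) * h p * dens C p) \<in> borel_measurable (borel \<Otimes>\<^sub>M line_space)"
    by measurable
  then have "(\<lambda>p. f (fst p) * h p * dens C p) \<in> borel_measurable R"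
    by (simp only: measurable_cong_sets[OF sets_R refl])
  then have "(\<integral>\<^sup>+p. f (fst p) * h p * dens C p \<partial>R) = (\<integral>\<^sup>+l. \<integral>\<^sup>+g. f l * h (l, g) * dens C (l, g) \<partial>Q \<partial>lborel)"
    by (subst Q.nn_integral_fst[symmetric]) simp_all
  also have "\<dots> = (\<integral>\<^sup>+l. decay (split_rate C) 0 l * f l * (ennreal rate * (\<integral>\<^sup>+g. (if cuts C g then h (l, g) else 0) \<partial>Q)) * indicator {0..} l \<partial>lborel)"
  proof (rule nn_integral_cong)
    fix l :: real
    have "(\<integral>\<^sup>+g. f l * h (l, g) * dens C (l, g) \<partial>Q) =
       (\<integral>\<^sup>+g. (decay (split_rate C) 0 l * f l * ennreal rate * indicator {0..} l) * (if cuts C g then h (l, g) else 0) \<partial>Q)"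
      by (intro nn_integral_cong) (simp add: dens_def mult_ac)
    also have "\<dots> = (decay (split_rate C) 0 l * f l * ennreal rate * indicator {0..} l) * (\<integral>\<^sup>+g. (if cuts C g then h (l, g) else 0) \<partial>Q)"
      by (rule nn_integral_cmult) measurable
    finally show "(\<integral>\<^sup>+g. f l * h (l, g) * dens C (l, g) \<partial>Q) =
       decay (split_rate C) 0 l * f l * (ennreal rate * (\<integral>\<^sup>+g. (if cuts C g then h (l, g) else 0) \<partial>Q)) * indicator {0..} l"
      by (simp add: mult_ac)
  qed
  finally show ?thesis .
qed

text \<open>The substitution \<open>s = b + l\<close> turns the lifetime \<open>l\<close> of a cell
  born at \<open>b\<close> into its time of division, and \<open>surv_eq_stit\<close>
  applies.\<close>

lemma first_split_integral:
  assumes C: "C \<in> cells W" and pos: "split_rate C > 0"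
  shows "(\<integral>\<^sup>+p. unhit C b (b + fst p) * (surv (C \<inter> plus_side (snd p)) (b + fst p) *
      surv (C \<inter> minus_side (snd p)) (b + fst p)) * dens C p \<partial>R) = surv C b"
proof -
  note [measurable] = const_cell[OF C]
  have "(\<integral>\<^sup>+p. unhit C b (b + fst p) * (surv (C \<inter> plus_side (snd p)) (b + fst p) *
      surv (C \<inter> minus_side (snd p)) (b + fst p)) * dens C p \<partial>R) =
    (\<integral>\<^sup>+l. decay (split_rate C) 0 l * unhit C b (b + l) * gain surv C (b + l) * indicator {0..} l \<partial>lborel)"
    unfolding gain_def by (subst nn_integral_dens[OF C, where f = "\<lambda>l. unhit C b (b + l)"
      and h = "\<lambda>p. surv (C \<inter> plus_side (snd p)) (b + fst p) * surv (C \<inter> minus_side (snd p)) (b + fst p)"])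
      (simp_all cong del: if_weak_cong)
  also have "\<dots> = (\<integral>\<^sup>+l. decay (split_rate C) b (b + l) * unhit C b (b + l) * gain surv C (b + l) * indicator {b..} (b + l) \<partial>lborel)"
    by (simp add: decay_shift indicator_def)
  also have "\<dots> = surv C b"
    using nn_integral_real_affine[of "\<lambda>s. decay (split_rate C) b s * unhit C b s * gain surv C s * indicator {b..} s" 1 b]
    by (simp add: surv_eq_stit[OF C pos])
  finally show ?thesis .
qed

text \<open>With \<open>a = split_rate C\<close> the left side is the Laplace transform
  \<open>a / (a + \<theta>)\<close> of the lifetime, which the last hypothesis bounds by
  \<open>c\<close>.\<close>

lemma first_split_decay:
  assumes C: "C \<in> cells W" and pos: "split_rate C > 0" and \<theta>: "\<theta> \<ge> 0" "c \<ge> 0" "split_rate C \<le> c * (split_rate C + \<theta>)"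
  shows "(\<integral>\<^sup>+p. decay \<theta> 0 (fst p) * dens C p \<partial>R) \<le> ennreal c"
proof -
  let ?a = "split_rate C"
  have "(\<integral>\<^sup>+p. decay \<theta> 0 (fst p) * dens C p \<partial>R) = (\<integral>\<^sup>+p. decay \<theta> 0 (fst p) * 1 * dens C p \<partial>R)" by simp
  also have "\<dots> = (\<integral>\<^sup>+l. decay ?a 0 l * decay \<theta> 0 l * (ennreal rate * (\<integral>\<^sup>+g. (if cuts C g then 1 else 0) \<partial>Q)) * indicator {0..} l \<partial>lborel)"
    by (rule nn_integral_dens[OF C]) simp_all
  also have "\<dots> \<le> (\<integral>\<^sup>+l. ennreal c * (ennreal (?a + \<theta>) * decay (?a + \<theta>) 0 l * indicator {0..} l) \<partial>lborel)"
  proof (rule nn_integral_mono)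
    fix l
    have "ennreal ?a \<le> ennreal c * ennreal (?a + \<theta>)"
      using \<theta> by (simp add: ennreal_mult'[symmetric] ennreal_leI)
    then have "decay (?a + \<theta>) 0 l * indicator {0..} l * ennreal ?a \<le> decay (?a + \<theta>) 0 l * indicator {0..} l * (ennreal c * ennreal (?a + \<theta>))"
      by (rule mult_left_mono) simp
    then show "decay ?a 0 l * decay \<theta> 0 l * (ennreal rate * (\<integral>\<^sup>+g. (if cuts C g then 1 else 0) \<partial>Q)) * indicator {0..} l
       \<le> ennreal c * (ennreal (?a + \<theta>) * decay (?a + \<theta>) 0 l * indicator {0..} l)"
      unfolding split_rate_eq[OF C, symmetric] decay_add by (simp only: mult_ac)
  qed
  also have "\<dots> = ennreal c * 1"
    using decay_integral_inf[of "?a + \<theta>" 0] pos \<theta> by (subst nn_integral_cmult) simp_all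
  finally show ?thesis by simp
qed

section \<open>The martingale over the generations and non-explosion\<close>

definition avoided :: "nat \<Rightarrow> 'a \<Rightarrow> ennreal" where
  "avoided n \<omega> = (\<Prod>w | length w < n. unhit (cell w \<omega>) (birth w \<omega>) (birth w \<omega> + L w \<omega>))"

lemma finite_below [simp]: "finite {w :: bool list. length w < n}"
proof -
  have "{w :: bool list. length w < n} = (\<Union>m<n. level m)" by auto
  then show ?thesis by simp
qed

lemma avoided_0: "avoided 0 \<omega> = 1"
  by (simp add: avoided_def)

lemma avoided_Suc:
  "avoided (Suc n) \<omega> = avoided n \<omega> * (\<Prod>w\<in>level n. unhit (cell w \<omega>) (birth w \<omega>) (birth w \<omega> + L w \<omega>))"
proof -
  have "{w :: bool list. length w < Suc n} = {w. length w < n} \<union> level n" by auto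
  then show ?thesis unfolding avoided_def by (subst prod.union_disjoint[symmetric]) auto
qed

lemma measurable_unhit_path:
  assumes "cell w \<in> measurable N (cell_space W)" "birth w \<in> borel_measurable N" "L w \<in> borel_measurable N"
  shows "(\<lambda>\<omega>. unhit (cell w \<omega>) (birth w \<omega>) (birth w \<omega> + L w \<omega>)) \<in> borel_measurable N"
  using assms by measurable

lemma measurable_avoided_H: "avoided n \<in> borel_measurable (H n)"
  unfolding avoided_def
  by (intro borel_measurable_prod_ennreal measurable_unhit_path measurable_cell_H measurable_birth_H H_coordinates) auto

lemma measurable_avoided [measurable]: "avoided n \<in> borel_measurable M"
  unfolding avoided_def
  by (intro borel_measurable_prod_ennreal measurable_unhit_path measurable_cell measurable_birth L_meas)

text \<open>One generation is integrated out at a time: its \<open>unhit\<close> factors and the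
  \<open>surv\<close> factors of the daughter cells combine, cell by cell, to the
  \<open>surv\<close> factors of the mother cells.\<close>

lemma martingale:
  "(\<integral>\<^sup>+\<omega>. avoided n \<omega> * (\<Prod>w\<in>level n. surv (cell w \<omega>) (birth w \<omega>)) \<partial>M) = surv W 0"
proof (induction n)
  case 0
  have "level 0 = {[]}" by auto
  then show ?case by (simp add: avoided_0 M.emeasure_space_1)
next
  case (Suc n)
  let ?\<phi> = "\<lambda>w \<omega> p. unhit (cell w \<omega>) (birth w \<omega>) (birth w \<omega> + fst p) *
      (surv (cell w \<omega> \<inter> plus_side (snd p)) (birth w \<omega> + fst p) *
       surv (cell w \<omega> \<inter> minus_side (snd p)) (birth w \<omega> + fst p))"
  have "(\<integral>\<^sup>+\<omega>. avoided (Suc n) \<omega> * (\<Prod>w\<in>level (Suc n). surv (cell w \<omega>) (birth w \<omega>)) \<partial>M) =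
      (\<integral>\<^sup>+\<omega>. avoided n \<omega> * (\<Prod>w\<in>level n. ?\<phi> w \<omega> (L w \<omega>, G w \<omega>)) \<partial>M)"
    by (simp add: avoided_Suc prod_level_Suc prod.distrib mult.assoc)
  also have "\<dots> = (\<integral>\<^sup>+\<omega>. avoided n \<omega> * (\<Prod>w\<in>level n. \<integral>\<^sup>+p. ?\<phi> w \<omega> p * dens (cell w \<omega>) p \<partial>R) \<partial>M)"
  proof (rule one_step[OF measurable_avoided_H])
    fix w assume "w \<in> level n"
    then have [measurable]: "cell w \<in> measurable (H n) (cell_space W)" "birth w \<in> borel_measurable (H n)"
      by (auto intro: measurable_cell_H measurable_birth_H)
    have [measurable]: "(\<lambda>p. snd p) \<in> measurable R line_space"
      using measurable_snd[of lborel Q] by (simp add: measurable_cong_sets[OF refl sets_Q])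
    show "(\<lambda>z. ?\<phi> w (fst z) (snd z)) \<in> borel_measurable (H n \<Otimes>\<^sub>M R)"
      by measurable
  qed
  also have "\<dots> = (\<integral>\<^sup>+\<omega>. avoided n \<omega> * (\<Prod>w\<in>level n. surv (cell w \<omega>) (birth w \<omega>)) \<partial>M)"
  proof (rule nn_integral_cong_AE)
    have "AE \<omega> in M. \<forall>w. 0 < split_rate (cell w \<omega>)"
      using split_pos by (simp add: AE_all_countable)
    then show "AE \<omega> in M. avoided n \<omega> * (\<Prod>w\<in>level n. \<integral>\<^sup>+p. ?\<phi> w \<omega> p * dens (cell w \<omega>) p \<partial>R) =
        avoided n \<omega> * (\<Prod>w\<in>level n. surv (cell w \<omega>) (birth w \<omega>))"
      using AE_space by eventually_elim (simp add: first_split_integral cell_in_cells)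
  qed
  finally show ?case using Suc.IH by simp
qed

text \<open>Division rates are at most \<open>rate\<close>, so at \<open>3 * rate\<close> a lifetime
  has Laplace transform at most \<open>1 / 4\<close>; each ancestor contributes one such
  factor.\<close>

lemma birth_decay:
  "(\<integral>\<^sup>+\<omega>. decay (3 * rate) 0 (birth w \<omega>) \<partial>M) \<le> ennreal ((1 / 4) ^ length w)"
proof (induction w)
  case Nil
  then show ?case by (simp add: decay_def M.emeasure_space_1)
next
  case (Cons s w)
  let ?n = "length w" and ?\<theta> = "3 * rate"
  \<comment> \<open>Only the mother cell \<open>w\<close> carries the decay. The other cells of its
    generation carry 1, whose integral is at most 1 by \<open>first_split_decay\<close> with
    \<theta> = 0.\<close>
  let ?\<phi> = "\<lambda>v (\<omega>::'a) p::real \<times> (real^2) set. if v = w then decay ?\<theta> 0 (fst p) else 1"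
  have one: "(\<Prod>v\<in>level ?n. ?\<phi> v \<omega> (L v \<omega>, G v \<omega>)) = decay ?\<theta> 0 (L w \<omega>)" for \<omega>
    by (subst prod.delta) auto
  have add: "decay ?\<theta> 0 (birth (s # w) \<omega>) = decay ?\<theta> 0 (birth w \<omega>) * decay ?\<theta> 0 (L w \<omega>)" for \<omega>
    by (simp add: decay_def ennreal_mult'[symmetric] exp_add[symmetric] distrib_left)
  have "(\<integral>\<^sup>+\<omega>. decay ?\<theta> 0 (birth (s # w) \<omega>) \<partial>M) =
      (\<integral>\<^sup>+\<omega>. decay ?\<theta> 0 (birth w \<omega>) * (\<Prod>v\<in>level ?n. ?\<phi> v \<omega> (L v \<omega>, G v \<omega>)) \<partial>M)"
    unfolding one add ..
  also have "\<dots> = (\<integral>\<^sup>+\<omega>. decay ?\<theta> 0 (birth w \<omega>) * (\<Prod>v\<in>level ?n. \<integral>\<^sup>+p. ?\<phi> v \<omega> p * dens (cell v \<omega>) p \<partial>R) \<partial>M)"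
  proof (rule one_step)
    have [measurable]: "birth w \<in> borel_measurable (H ?n)" by (intro measurable_birth_H) simp
    show "(\<lambda>\<omega>. decay ?\<theta> 0 (birth w \<omega>)) \<in> borel_measurable (H ?n)" by measurable
  qed simp
  also have "\<dots> \<le> (\<integral>\<^sup>+\<omega>. decay ?\<theta> 0 (birth w \<omega>) * ennreal (1 / 4) \<partial>M)"
  proof (rule nn_integral_mono_AE)
    have "AE \<omega> in M. \<forall>w. 0 < split_rate (cell w \<omega>)"
      using split_pos by (simp add: AE_all_countable)
    then show "AE \<omega> in M. decay ?\<theta> 0 (birth w \<omega>) * (\<Prod>v\<in>level ?n. \<integral>\<^sup>+p. ?\<phi> v \<omega> p * dens (cell v \<omega>) p \<partial>R)
        \<le> decay ?\<theta> 0 (birth w \<omega>) * ennreal (1 / 4)"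
      using AE_space
    proof eventually_elim
      case (elim \<omega>)
      have "(\<Prod>v\<in>level ?n. \<integral>\<^sup>+p. ?\<phi> v \<omega> p * dens (cell v \<omega>) p \<partial>R) \<le> (\<Prod>v\<in>level ?n. if v = w then ennreal (1 / 4) else 1)"
      proof (rule prod_mono_ennreal)
        fix v
        show "(\<integral>\<^sup>+p. ?\<phi> v \<omega> p * dens (cell v \<omega>) p \<partial>R) \<le> (if v = w then ennreal (1 / 4) else 1)"
          using first_split_decay[of "cell v \<omega>" ?\<theta> "1 / 4"] first_split_decay[of "cell v \<omega>" 0 1]
            cell_in_cells[OF elim(2)] elim(1) split_rate_le[of "cell v \<omega>"] rate
          by (auto simp: decay_0)
      qed
      also have "\<dots> = ennreal (1 / 4)" by (subst prod.delta) auto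
      finally show ?case by (rule mult_left_mono) simp
    qed
  qed
  also have "\<dots> = (\<integral>\<^sup>+\<omega>. decay ?\<theta> 0 (birth w \<omega>) \<partial>M) * ennreal (1 / 4)"
    by (rule nn_integral_multc) measurable
  also have "\<dots> \<le> ennreal ((1 / 4) ^ ?n) * ennreal (1 / 4)"
    by (rule mult_right_mono[OF Cons.IH]) simp
  also have "\<dots> = ennreal ((1 / 4) ^ length (s # w))"
    by (subst ennreal_mult'[symmetric]) (simp_all add: mult.commute)
  finally show ?case .
qed

lemma card_level: "card (level n) = 2 ^ n"
  using card_lists_length_eq[of "UNIV :: bool set" n] by simp

text \<open>Markov's inequality for \<open>exp (- 3 * rate * birth)\<close>, summed over the
  \<open>2 ^ n\<close> nodes of the generation. The bound \<open>(1 / 4) ^ n\<close> per node beats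
  their number, which explains the factor 3 in the exponent.\<close>

lemma early_births:
  "(\<integral>\<^sup>+\<omega>. of_bool (\<exists>w\<in>level n. birth w \<omega> < T) \<partial>M) \<le> ennreal (exp (3 * rate * T) * (1 / 2) ^ n)"
proof -
  let ?\<theta> = "3 * rate"
  have "(\<integral>\<^sup>+\<omega>. of_bool (\<exists>w\<in>level n. birth w \<omega> < T) \<partial>M) \<le>
     (\<integral>\<^sup>+\<omega>. (\<Sum>w\<in>level n. ennreal (exp (?\<theta> * T)) * decay ?\<theta> 0 (birth w \<omega>)) \<partial>M)"
  proof (rule nn_integral_mono)
    fix \<omega>
    show "of_bool (\<exists>w\<in>level n. birth w \<omega> < T) \<le> (\<Sum>w\<in>level n. ennreal (exp (?\<theta> * T)) * decay ?\<theta> 0 (birth w \<omega>))"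
    proof (cases "\<exists>w\<in>level n. birth w \<omega> < T")
      case True
      then obtain w where w: "w \<in> level n" "birth w \<omega> < T" by auto
      have "1 \<le> ennreal (exp (?\<theta> * T + - ?\<theta> * birth w \<omega>))"
        using w(2) rate by (simp add: mult_left_mono)
      also have "\<dots> = ennreal (exp (?\<theta> * T)) * decay ?\<theta> 0 (birth w \<omega>)"
        by (simp add: decay_def ennreal_mult'[symmetric] exp_add[symmetric])
      also have "\<dots> \<le> (\<Sum>w\<in>level n. ennreal (exp (?\<theta> * T)) * decay ?\<theta> 0 (birth w \<omega>))"
        using w(1) by (intro member_le_sum) auto
      finally show ?thesis using True by simp
    qed simp
  qed
  also have "\<dots> = (\<Sum>w\<in>level n. ennreal (exp (?\<theta> * T)) * (\<integral>\<^sup>+\<omega>. decay ?\<theta> 0 (birth w \<omega>) \<partial>M))"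
    by (subst nn_integral_sum) (simp_all add: nn_integral_cmult)
  also have "\<dots> \<le> (\<Sum>w\<in>level n. ennreal (exp (?\<theta> * T)) * ennreal ((1 / 4) ^ n))"
    using birth_decay by (intro sum_mono mult_left_mono) auto
  also have "\<dots> = of_nat (2 ^ n) * ennreal (exp (?\<theta> * T) * (1 / 4) ^ n)"
    by (simp add: card_level ennreal_mult'[symmetric])
  also have "\<dots> = ennreal (2 ^ n * (exp (?\<theta> * T) * (1 / 4) ^ n))"
    by (simp add: ennreal_mult' ennreal_power[symmetric] flip: ennreal_numeral)
  also have "2 ^ n * (exp (?\<theta> * T) * (1 / 4) ^ n) = exp (?\<theta> * T) * (1 / 2 :: real) ^ n"
    by (simp add: power_divide power_mult_distrib[symmetric] flip: power_mult_distrib) (simp add: field_simps flip: power_mult_distrib)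
  finally show ?thesis .
qed

lemma avoided_le_1: "avoided n \<omega> \<le> 1"
  unfolding avoided_def by (rule prod_le_1) (auto simp: unhit_le_1)

text \<open>The product of \<open>surv\<close> in the martingale is at most 1, and it equals 1 once
  all births of generation \<open>n\<close> lie past \<open>T\<close>; so dropping it costs at most
  the probability of an earlier birth.\<close>

lemma avoided_tendsto: "(\<lambda>n. \<integral>\<^sup>+\<omega>. avoided n \<omega> \<partial>M) \<longlonglongrightarrow> surv W 0"
proof (rule tendsto_sandwich)
  let ?Z = "\<lambda>n \<omega>. \<Prod>w\<in>level n. surv (cell w \<omega>) (birth w \<omega>)"
  have Z1: "?Z n \<omega> \<le> 1" if "\<omega> \<in> space M" for n \<omega>
    using that by (intro prod_le_1) (auto simp: surv_le_1 cell_in_cells)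
  show "\<forall>\<^sub>F n in sequentially. surv W 0 \<le> (\<integral>\<^sup>+\<omega>. avoided n \<omega> \<partial>M)"
  proof (rule always_eventually, rule allI)
    fix n
    have "surv W 0 = (\<integral>\<^sup>+\<omega>. avoided n \<omega> * ?Z n \<omega> \<partial>M)" by (simp add: martingale)
    also have "\<dots> \<le> (\<integral>\<^sup>+\<omega>. avoided n \<omega> \<partial>M)"
      using mult_left_mono[OF Z1] by (intro nn_integral_mono) fastforce
    finally show "surv W 0 \<le> (\<integral>\<^sup>+\<omega>. avoided n \<omega> \<partial>M)" .
  qed
  show "\<forall>\<^sub>F n in sequentially. (\<integral>\<^sup>+\<omega>. avoided n \<omega> \<partial>M) \<le> surv W 0 + ennreal (exp (3 * rate * T) * (1 / 2) ^ n)"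
  proof (rule always_eventually, rule allI)
    fix n
    have "(\<integral>\<^sup>+\<omega>. avoided n \<omega> \<partial>M) \<le> (\<integral>\<^sup>+\<omega>. avoided n \<omega> * ?Z n \<omega> + of_bool (\<exists>w\<in>level n. birth w \<omega> < T) \<partial>M)"
    proof (rule nn_integral_mono)
      fix \<omega> assume w: "\<omega> \<in> space M"
      show "avoided n \<omega> \<le> avoided n \<omega> * ?Z n \<omega> + of_bool (\<exists>w\<in>level n. birth w \<omega> < T)"
      proof (cases "\<exists>w\<in>level n. birth w \<omega> < T")
        case True
        then show ?thesis using avoided_le_1[of n \<omega>] by (simp add: add_increasing)
      next
        case False
        then have "?Z n \<omega> = 1" using w by (intro prod.neutral) (auto simp: surv_after cell_in_cells not_less)
        then show ?thesis by simp
      qed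
    qed
    also have "\<dots> = (\<integral>\<^sup>+\<omega>. avoided n \<omega> * ?Z n \<omega> \<partial>M) + (\<integral>\<^sup>+\<omega>. of_bool (\<exists>w\<in>level n. birth w \<omega> < T) \<partial>M)"
      by (rule nn_integral_add) measurable
    also have "\<dots> \<le> surv W 0 + ennreal (exp (3 * rate * T) * (1 / 2) ^ n)"
      unfolding martingale by (rule add_left_mono[OF early_births])
    finally show "(\<integral>\<^sup>+\<omega>. avoided n \<omega> \<partial>M) \<le> surv W 0 + ennreal (exp (3 * rate * T) * (1 / 2) ^ n)" .
  qed
  have "(\<lambda>n. exp (3 * rate * T) * (1 / 2) ^ n) \<longlonglongrightarrow> exp (3 * rate * T) * 0"
    by (intro tendsto_mult tendsto_const LIMSEQ_realpow_zero) auto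
  then have "(\<lambda>n. ennreal (exp (3 * rate * T) * (1 / 2) ^ n)) \<longlonglongrightarrow> ennreal (exp (3 * rate * T) * 0)"
    by (rule tendsto_ennrealI)
  then have "(\<lambda>n. surv W 0 + ennreal (exp (3 * rate * T) * (1 / 2) ^ n)) \<longlonglongrightarrow> surv W 0 + ennreal (exp (3 * rate * T) * 0)"
    by (intro tendsto_add tendsto_const)
  then show "(\<lambda>n. surv W 0 + ennreal (exp (3 * rate * T) * (1 / 2) ^ n)) \<longlonglongrightarrow> surv W 0" by simp
qed simp

lemma avoided_eq: "avoided n \<omega> = of_bool (\<forall>w. length w < n \<longrightarrow> unhit (cell w \<omega>) (birth w \<omega>) (birth w \<omega> + L w \<omega>) = 1)"
proof (cases "\<forall>w. length w < n \<longrightarrow> unhit (cell w \<omega>) (birth w \<omega>) (birth w \<omega> + L w \<omega>) = 1")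
  case False
  then obtain w where "length w < n" "unhit (cell w \<omega>) (birth w \<omega>) (birth w \<omega> + L w \<omega>) = 0"
    using unhit_cases by metis
  then show ?thesis using False unfolding avoided_def by (simp add: prod_zero_iff) blast
qed (simp add: avoided_def)

text \<open>The event is the decreasing limit of the events that no cell of the first
  \<open>n\<close> generations is hit while present.\<close>

lemma stit_avoids:
  "emeasure M {\<omega> \<in> space M. \<forall>p\<in>F. stit W (\<lambda>w. L w \<omega>) (\<lambda>w. G w \<omega>) (fst p) \<inter> snd p = {}} = surv W 0"
proof -
  let ?E = "\<lambda>n. {\<omega> \<in> space M. avoided n \<omega> = 1}"
  have set_eq: "{\<omega> \<in> space M. \<forall>p\<in>F. stit W (\<lambda>w. L w \<omega>) (\<lambda>w. G w \<omega>) (fst p) \<inter> snd p = {}} = (\<Inter>n. ?E n)"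
  proof -
    have comm: "(\<forall>p\<in>F. \<forall>w. P p w) \<longleftrightarrow> (\<forall>w::bool list. \<forall>p\<in>F. P p w)" for P by blast
    have "(\<forall>p\<in>F. stit W (\<lambda>w. L w \<omega>) (\<lambda>w. G w \<omega>) (fst p) \<inter> snd p = {}) \<longleftrightarrow> (\<forall>n. avoided n \<omega> = 1)" for \<omega>
    proof -
      have "stit W (\<lambda>w. L w \<omega>) (\<lambda>w. G w \<omega>) (fst p) \<inter> snd p = {} \<longleftrightarrow>
          (\<forall>w. birth w \<omega> \<le> fst p \<and> fst p < birth w \<omega> + L w \<omega> \<longrightarrow> frontier (cell w \<omega>) \<inter> (snd p - frontier W) = {})"
        (is "_ \<longleftrightarrow> (\<forall>w. ?P p w)") if "p \<in> F" for p
        by (rule stit_misses_iff[OF open_F[OF that]])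
      then have "(\<forall>p\<in>F. stit W (\<lambda>w. L w \<omega>) (\<lambda>w. G w \<omega>) (fst p) \<inter> snd p = {}) \<longleftrightarrow> (\<forall>p\<in>F. \<forall>w. ?P p w)"
        by (simp only: cong: ball_cong)
      also have "\<dots> \<longleftrightarrow> (\<forall>w. \<forall>p\<in>F. ?P p w)" by (rule comm)
      also have "\<dots> \<longleftrightarrow> (\<forall>w. unhit (cell w \<omega>) (birth w \<omega>) (birth w \<omega> + L w \<omega>) = 1)"
        unfolding unhit_eq_1 by (rule refl)
      also have "\<dots> \<longleftrightarrow> (\<forall>n. avoided n \<omega> = 1)"
        unfolding avoided_eq by (auto intro: lessI)
      finally show ?thesis .
    qed
    then show ?thesis by auto
  qed
  have "(\<lambda>n. emeasure M (?E n)) \<longlonglongrightarrow> emeasure M (\<Inter>n. ?E n)"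
  proof (rule Lim_emeasure_decseq)
    show "decseq ?E" unfolding decseq_def avoided_eq by auto
  qed (auto simp: M.emeasure_eq_measure)
  moreover have "emeasure M (?E n) = (\<integral>\<^sup>+\<omega>. avoided n \<omega> \<partial>M)" for n
  proof -
    have "(\<integral>\<^sup>+\<omega>. avoided n \<omega> \<partial>M) = (\<integral>\<^sup>+\<omega>. indicator (?E n) \<omega> \<partial>M)"
      by (intro nn_integral_cong) (auto simp: avoided_eq indicator_def)
    then show ?thesis by simp
  qed
  ultimately have "(\<lambda>n. \<integral>\<^sup>+\<omega>. avoided n \<omega> \<partial>M) \<longlonglongrightarrow> emeasure M (\<Inter>n. ?E n)" by simp
  then show ?thesis unfolding set_eq using avoided_tendsto by (rule LIMSEQ_unique)
qed

end

section \<open>The Mecke process\<close>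

lemma (in prob_space) distr_restrict_PiM:
  assumes indep: "indep_vars (\<lambda>_. S) X J" and I: "I \<subseteq> J"
  shows "distr M (Pi\<^sub>M I (\<lambda>_. S)) (\<lambda>\<omega>. \<lambda>i\<in>I. X i \<omega>) = Pi\<^sub>M I (\<lambda>i. distr M S (X i))"
proof (cases "I = {}")
  case False
  have "indep_vars (\<lambda>_. S) X I" by (rule indep_vars_subset[OF indep I])
  moreover from this have "random_variable S (X i)" if "i \<in> I" for i
    using that by (auto simp: indep_vars_def)
  ultimately show ?thesis
    using indep_vars_iff_distr_eq_PiM'[OF False, where M' = "\<lambda>_. S" and X = X] by simp
next
  case True
  have rv: "(\<lambda>\<omega>. \<lambda>i\<in>{}. X i \<omega>) \<in> measurable M (Pi\<^sub>M {} (\<lambda>_. S))" by (rule measurable_restrict) simp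
  show ?thesis unfolding True
  proof (rule measure_eqI)
    fix A assume "A \<in> sets (distr M (Pi\<^sub>M {} (\<lambda>_. S)) (\<lambda>\<omega>. \<lambda>i\<in>{}. X i \<omega>))"
    then have "A = {} \<or> A = {\<lambda>_. undefined}" by (auto simp: PiM_empty)
    then show "emeasure (distr M (Pi\<^sub>M {} (\<lambda>_. S)) (\<lambda>\<omega>. \<lambda>i\<in>{}. X i \<omega>)) A = emeasure (Pi\<^sub>M {} (\<lambda>i. distr M S (X i))) A"
      using rv by (auto simp: emeasure_distr PiM_empty emeasure_space_1 restrict_def cong: measurable_cong_sets)
  qed (simp add: PiM_empty)
qed

text \<open>By independence of \<open>X 1\<close>, ..., \<open>X (Suc n)\<close> the last coordinate
  may be resampled from its law while the others stay on the original space. \<open>inv\<close>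
  allows whole sequences as arguments of \<open>f\<close>.\<close>

lemma (in prob_space) nn_integral_peel:
  fixes X :: "nat \<Rightarrow> 'a \<Rightarrow> 'c"
  assumes indep: "indep_vars (\<lambda>_. S) X {1..}"
    and f: "f \<in> borel_measurable (Pi\<^sub>M {1..Suc n} (\<lambda>_. S))"
    and inv: "\<And>x y. (\<And>k. k \<in> {1..Suc n} \<Longrightarrow> x k = y k) \<Longrightarrow> f x = f y"
  shows "(\<integral>\<^sup>+\<omega>. f (\<lambda>k. X k \<omega>) \<partial>M) = (\<integral>\<^sup>+\<omega>. \<integral>\<^sup>+y. f ((\<lambda>k. X k \<omega>)(Suc n := y)) \<partial>distr M S (X (Suc n)) \<partial>M)"
proof -
  have rv: "random_variable S (X i)" if "i \<ge> 1" for i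
    using indep that by (auto simp: indep_vars_def)
  \<comment> \<open>\<open>max 1 i\<close> also gives index 0 a law, so that \<open>D\<close> is a
    family of probability measures over all of \<open>nat\<close>.\<close>
  define D where "D i = distr M S (X (max 1 i))" for i
  have D: "prob_space (D i)" "sets (D i) = sets S" for i
    unfolding D_def by (intro prob_space_distr rv) auto
  interpret D: product_prob_space D
    by (intro product_prob_spaceI D)
  have law: "distr M (Pi\<^sub>M I (\<lambda>_. S)) (\<lambda>\<omega>. \<lambda>i\<in>I. X i \<omega>) = Pi\<^sub>M I D" if "I \<subseteq> {1..}" for I
  proof -
    have "Pi\<^sub>M I D = Pi\<^sub>M I (\<lambda>i. distr M S (X i))"
      using that by (intro PiM_cong) (auto simp: D_def max_def)
    then show ?thesis using distr_restrict_PiM[OF indep that] by simp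
  qed
  have law1: "distr M (Pi\<^sub>M {1..Suc n} (\<lambda>_. S)) (\<lambda>\<omega>. \<lambda>i\<in>{1..Suc n}. X i \<omega>) = Pi\<^sub>M {1..Suc n} D"
    and law2: "distr M (Pi\<^sub>M {1..n} (\<lambda>_. S)) (\<lambda>\<omega>. \<lambda>i\<in>{1..n}. X i \<omega>) = Pi\<^sub>M {1..n} D"
    by (rule law; auto)+
  have map: "(\<lambda>\<omega>. \<lambda>i\<in>I. X i \<omega>) \<in> measurable M (Pi\<^sub>M I (\<lambda>_. S))" if "I \<subseteq> {1..}" for I
    using that rv by (intro measurable_restrict) auto
  have ins: "{1..Suc n} = insert (Suc n) {1..n}" by auto
  have setsPi: "sets (Pi\<^sub>M I D) = sets (Pi\<^sub>M I (\<lambda>_. S))" for I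
    by (intro sets_PiM_cong refl D)
  have fD: "f \<in> borel_measurable (Pi\<^sub>M (insert (Suc n) {1..n}) D)"
    using f unfolding ins by (simp only: measurable_cong_sets[OF setsPi refl])
  have inner: "(\<lambda>x. \<integral>\<^sup>+y. f (x(Suc n := y)) \<partial>D (Suc n)) \<in> borel_measurable (Pi\<^sub>M {1..n} (\<lambda>_. S))"
  proof -
    have "(\<lambda>p. (fst p)(Suc n := snd p)) \<in> measurable (Pi\<^sub>M {1..n} D \<Otimes>\<^sub>M D (Suc n)) (Pi\<^sub>M (insert (Suc n) {1..n}) D)"
      using measurable_add_dim[of "Suc n" "{1..n}" D] by (simp add: split_beta')
    from measurable_compose[OF this fD]
    have "(\<lambda>p. f ((fst p)(Suc n := snd p))) \<in> borel_measurable (Pi\<^sub>M {1..n} D \<Otimes>\<^sub>M D (Suc n))" by simp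
    then have "(\<lambda>x. \<integral>\<^sup>+y. f (x(Suc n := y)) \<partial>D (Suc n)) \<in> borel_measurable (Pi\<^sub>M {1..n} D)"
      using D.M.borel_measurable_nn_integral_fst[of "\<lambda>p. f ((fst p)(Suc n := snd p))" "Pi\<^sub>M {1..n} D" "Suc n"] by simp
    then show ?thesis by (simp only: measurable_cong_sets[OF setsPi refl])
  qed
  have "(\<integral>\<^sup>+\<omega>. f (\<lambda>k. X k \<omega>) \<partial>M) = (\<integral>\<^sup>+\<omega>. f (\<lambda>i\<in>{1..Suc n}. X i \<omega>) \<partial>M)"
    by (intro nn_integral_cong inv) simp
  also have "\<dots> = (\<integral>\<^sup>+x. f x \<partial>Pi\<^sub>M {1..Suc n} D)"
    unfolding law1[symmetric]
    using map[of "{1..Suc n}"] f by (subst nn_integral_distr) (simp_all only: measurable_distr_eq1, auto)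
  also have "\<dots> = (\<integral>\<^sup>+x. \<integral>\<^sup>+y. f (x(Suc n := y)) \<partial>D (Suc n) \<partial>Pi\<^sub>M {1..n} D)"
    unfolding ins by (rule D.product_nn_integral_insert) (use fD in auto)
  also have "\<dots> = (\<integral>\<^sup>+\<omega>. \<integral>\<^sup>+y. f ((\<lambda>i\<in>{1..n}. X i \<omega>)(Suc n := y)) \<partial>D (Suc n) \<partial>M)"
    unfolding law2[symmetric]
    using map[of "{1..n}"] inner by (subst nn_integral_distr) (simp_all only: measurable_distr_eq1, auto)
  also have "\<dots> = (\<integral>\<^sup>+\<omega>. \<integral>\<^sup>+y. f ((\<lambda>k. X k \<omega>)(Suc n := y)) \<partial>D (Suc n) \<partial>M)"
    by (intro nn_integral_cong inv) auto
  finally show ?thesis by (simp add: D_def)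
qed

lemma indep_rvs_distr_pair:
  assumes "prob_space M" and "indep_rvs M S X R Y"
  shows "distr M (S \<Otimes>\<^sub>M R) (\<lambda>\<omega>. (X \<omega>, Y \<omega>)) = distr M S X \<Otimes>\<^sub>M distr M R Y"
proof -
  interpret prob_space M by fact
  have X: "X \<in> measurable M S" and Y: "Y \<in> measurable M R"
    and ind: "indep_set {X -` A \<inter> space M |A. A \<in> sets S} {Y -` B \<inter> space M |B. B \<in> sets R}"
    using assms(2) by (auto simp: indep_rvs_def)
  interpret X: prob_space "distr M S X" by (rule prob_space_distr[OF X])
  interpret Y: prob_space "distr M R Y" by (rule prob_space_distr[OF Y])
  show ?thesis
  proof (rule pair_measure_eqI[symmetric])
    fix A B assume A: "A \<in> sets (distr M S X)" and B: "B \<in> sets (distr M R Y)"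
    have "emeasure (distr M (S \<Otimes>\<^sub>M R) (\<lambda>\<omega>. (X \<omega>, Y \<omega>))) (A \<times> B) = emeasure M ((\<lambda>\<omega>. (X \<omega>, Y \<omega>)) -` (A \<times> B) \<inter> space M)"
      using A B X Y by (intro emeasure_distr) auto
    also have "(\<lambda>\<omega>. (X \<omega>, Y \<omega>)) -` (A \<times> B) \<inter> space M = (X -` A \<inter> space M) \<inter> (Y -` B \<inter> space M)" by auto
    also have "emeasure M \<dots> = emeasure M (X -` A \<inter> space M) * emeasure M (Y -` B \<inter> space M)"
    proof -
      have "prob ((X -` A \<inter> space M) \<inter> (Y -` B \<inter> space M)) = prob (X -` A \<inter> space M) * prob (Y -` B \<inter> space M)"
        by (rule indep_setD[OF ind]) (use A B in auto)
      then show ?thesis by (simp add: emeasure_eq_measure ennreal_mult')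
    qed
    also have "\<dots> = emeasure (distr M S X) A * emeasure (distr M R Y) B"
      using A B X Y by (simp add: emeasure_distr)
    finally show "emeasure (distr M S X) A * emeasure (distr M R Y) B = emeasure (distr M (S \<Otimes>\<^sub>M R) (\<lambda>\<omega>. (X \<omega>, Y \<omega>))) (A \<times> B)" ..
  qed (auto intro: X.sigma_finite_measure_axioms Y.sigma_finite_measure_axioms)
qed

section \<open>Cells of the Mecke process as functions of the data\<close>

lemma mecke_cell_cong:
  "(\<And>k. k \<in> {1..n} \<Longrightarrow> g k = g' k) \<Longrightarrow> (\<And>k. k \<in> {1..n} \<Longrightarrow> a k = a' k) \<Longrightarrow> mecke_cell W g a n j = mecke_cell W g' a' n j"
proof (induction n arbitrary: j)
  case (Suc n)
  have IH: "mecke_cell W g a n i = mecke_cell W g' a' n i" for i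
    using Suc.prems by (intro Suc.IH) auto
  have "g (Suc n) = g' (Suc n)" "a (Suc n) = a' (Suc n)" using Suc.prems by auto
  then show ?case using IH by (cases n) (simp_all add: Let_def cong del: if_weak_cong)
qed simp

lemma measurable_mecke_cell:
  assumes g: "\<And>k. k \<in> {1..n} \<Longrightarrow> (\<lambda>x. g x k) \<in> measurable X line_space"
    and a: "\<And>k. k \<in> {1..n} \<Longrightarrow> (\<lambda>x. a x k) \<in> measurable X (count_space UNIV)"
    and W: "convex W"
  shows "(\<lambda>x. mecke_cell W (g x) (a x) n j) \<in> measurable X (cell_space W)"
  using g a
proof (induction n arbitrary: j)
  case 0
  then show ?case using W by (simp add: space_cell_space cells_top cells_empty)
next
  case (Suc n)
  have [measurable]: "(\<lambda>x. g x (Suc n)) \<in> measurable X line_space" "(\<lambda>x. a x (Suc n)) \<in> measurable X (count_space UNIV)"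
    using Suc.prems by auto
  have W' [measurable]: "(\<lambda>_. W) \<in> measurable X (cell_space W)" "(\<lambda>_. {}) \<in> measurable X (cell_space W)"
    using W by (simp_all add: space_cell_space cells_top cells_empty)
  have split: "(\<lambda>x. f x \<inter> plus_side (g x (Suc n))) \<in> measurable X (cell_space W)"
      "(\<lambda>x. f x \<inter> minus_side (g x (Suc n))) \<in> measurable X (cell_space W)"
    if "f \<in> measurable X (cell_space W)" for f
    using measurable_compose[OF measurable_Pair[OF that] measurable_split(1)]
      measurable_compose[OF measurable_Pair[OF that] measurable_split(2)] \<open>(\<lambda>x. g x (Suc n)) \<in> _\<close> by simp_all
  show ?case
  proof (cases n)
    case 0
    then show ?thesis using split[OF W'(1)] by (simp cong del: if_weak_cong)
  next
    case (Suc m)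
    have IH: "(\<lambda>x. mecke_cell W (g x) (a x) n i) \<in> measurable X (cell_space W)" for i
      using Suc.IH Suc.prems by auto
    \<comment> \<open>The label is random but has countably many values, which can be treated one at
      a time.\<close>
    have [measurable]: "(\<lambda>x. mecke_cell W (g x) (a x) n (a x (Suc n))) \<in> measurable X (cell_space W)"
      by (rule measurable_compose_countable[OF IH]) measurable
    note [measurable] = IH split[OF this]
    have "(\<lambda>x. if j = Suc n + 1 then mecke_cell W (g x) (a x) n (a x (Suc n)) \<inter> plus_side (g x (Suc n))
        else if j = a x (Suc n) then mecke_cell W (g x) (a x) n (a x (Suc n)) \<inter> minus_side (g x (Suc n))
        else mecke_cell W (g x) (a x) n j) \<in> measurable X (cell_space W)"
      by measurable
    moreover have "mecke_cell W (g x) (a x) (Suc n) j =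
       (if j = Suc n + 1 then mecke_cell W (g x) (a x) n (a x (Suc n)) \<inter> plus_side (g x (Suc n))
        else if j = a x (Suc n) then mecke_cell W (g x) (a x) n (a x (Suc n)) \<inter> minus_side (g x (Suc n))
        else mecke_cell W (g x) (a x) n j)" for x
      unfolding Suc mecke_cell.simps Let_def ..
    ultimately show ?thesis by (simp only:)
  qed
qed

text \<open>The factor of the chosen cell \<open>j\<close> is replaced by those of its two parts:
  after the first step, the new label receives the plus part and \<open>j\<close> keeps the minus
  part.\<close>

lemma prod_mecke_cell_Suc:
  assumes j: "j \<in> {1..Suc n}" and a: "a (Suc n) = j"
  shows "(\<Prod>i\<in>{1..Suc (Suc n)}. f (mecke_cell W g a (Suc n) i)) =
    f (mecke_cell W g a n j \<inter> plus_side (g (Suc n))) * f (mecke_cell W g a n j \<inter> minus_side (g (Suc n))) *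
    (\<Prod>i\<in>{1..Suc n} - {j}. f (mecke_cell W g a n i) :: 'b :: comm_monoid_mult)"
proof (cases n)
  case 0
  \<comment> \<open>In the first step it is label 1 that receives the plus part; the product does
    not see the exchange.\<close>
  have "{1..Suc (Suc 0)} = {1, 2::nat}" by auto
  then show ?thesis using j 0 by simp
next
  case (Suc m)
  have 1: "{1..Suc (Suc n)} = insert (Suc (Suc n)) (insert j ({1..Suc n} - {j}))" using j by auto
  have 2: "(\<Prod>i\<in>{1..Suc n} - {j}. f (mecke_cell W g a (Suc n) i)) = (\<Prod>i\<in>{1..Suc n} - {j}. f (mecke_cell W g a n i))"
    using a by (intro prod.cong) (auto simp: Suc Let_def)
  have 3: "mecke_cell W g a (Suc n) (Suc (Suc n)) = mecke_cell W g a n j \<inter> plus_side (g (Suc n))"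
    "mecke_cell W g a (Suc n) j = mecke_cell W g a n j \<inter> minus_side (g (Suc n))"
    using a j by (auto simp: Suc Let_def)
  have "(\<Prod>i\<in>{1..Suc (Suc n)}. f (mecke_cell W g a (Suc n) i)) =
      f (mecke_cell W g a (Suc n) (Suc (Suc n))) * (f (mecke_cell W g a (Suc n) j) * (\<Prod>i\<in>{1..Suc n} - {j}. f (mecke_cell W g a (Suc n) i)))"
    unfolding 1 using j by (subst prod.insert; (subst prod.insert)?) auto
  then show ?thesis unfolding 2 3 by (simp add: mult.assoc)
qed

lemma sum_nn_integral_divide:
  assumes "\<And>j. j \<in> I \<Longrightarrow> f j \<in> borel_measurable M"
  shows "(\<Sum>j\<in>I. \<integral>\<^sup>+x. f j x \<partial>M) / c = (\<integral>\<^sup>+x. (\<Sum>j\<in>I. f j x) / c \<partial>M)"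
proof -
  have "(\<Sum>j\<in>I. \<integral>\<^sup>+x. f j x \<partial>M) = (\<integral>\<^sup>+x. (\<Sum>j\<in>I. f j x) \<partial>M)"
    using assms by (intro nn_integral_sum[symmetric])
  then show ?thesis
    using assms by (subst nn_integral_divide) (auto intro: borel_measurable_sum)
qed

locale mecke_run = splitting W Q rate F T
  for W :: "(real^2) set" and Q :: "(real^2) set measure" and rate :: real
    and F :: "(real \<times> (real^2) set) set" and T :: real +
  fixes N :: "'b measure" and \<gamma> :: "nat \<Rightarrow> 'b \<Rightarrow> (real^2) set" and \<alpha> :: "nat \<Rightarrow> 'b \<Rightarrow> nat"
    and \<tau> :: "nat \<Rightarrow> 'b \<Rightarrow> real"
  assumes prob_N: "prob_space N"
    and \<gamma>_indep: "prob_space.indep_vars N (\<lambda>_. line_space) \<gamma> {1..}"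
    and \<gamma>_law: "\<And>j. j \<ge> 1 \<Longrightarrow> distr N line_space (\<gamma> j) = Q"
    and \<alpha>_indep: "prob_space.indep_vars N (\<lambda>_. count_space UNIV) \<alpha> {1..}"
    and \<alpha>_law: "\<And>j. j \<ge> 1 \<Longrightarrow> distr N (count_space UNIV) (\<alpha> j) = measure_pmf (pmf_of_set {1..j})"
    and \<gamma>_\<alpha>_indep: "indep_rvs N
       (Pi\<^sub>M {1..} (\<lambda>_. line_space)) (\<lambda>\<omega>. \<lambda>j\<in>{1..}. \<gamma> j \<omega>)
       (Pi\<^sub>M {1..} (\<lambda>_. count_space UNIV)) (\<lambda>\<omega>. \<lambda>j\<in>{1..}. \<alpha> j \<omega>)"
    and \<tau>_indep: "prob_space.indep_vars N (\<lambda>_. borel) \<tau> {1..}"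
    and \<tau>_law: "\<And>k. k \<ge> 1 \<Longrightarrow> distributed N lborel (\<tau> k) (exponential_density (real k * rate))"
    and jumps_indep: "indep_rvs N
       (Pi\<^sub>M {0..} (\<lambda>_. count_space UNIV)) (\<lambda>\<omega>. \<lambda>t\<in>{0..}. cowan_jumps (\<lambda>k. \<tau> k \<omega>) t)
       (Pi\<^sub>M {1..} (\<lambda>_. line_space) \<Otimes>\<^sub>M Pi\<^sub>M {1..} (\<lambda>_. count_space UNIV))
       (\<lambda>\<omega>. (\<lambda>j\<in>{1..}. \<gamma> j \<omega>, \<lambda>j\<in>{1..}. \<alpha> j \<omega>))"
    and F_nonneg: "\<And>p. p \<in> F \<Longrightarrow> 0 \<le> fst p"
begin

interpretation Q: prob_space Q by (rule prob_Q)
interpretation N: prob_space N by (rule prob_N)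

lemma rv [measurable]:
  assumes "k \<ge> 1"
  shows "\<gamma> k \<in> measurable N line_space" "\<alpha> k \<in> measurable N (count_space UNIV)" "\<tau> k \<in> borel_measurable N"
  using \<gamma>_indep \<alpha>_indep \<tau>_indep assms by (auto simp: N.indep_vars_def)

section \<open>Jump times and the martingale of the Mecke process\<close>

definition clock :: "(nat \<Rightarrow> real) \<Rightarrow> nat \<Rightarrow> real" where
  "clock t n = (\<Sum>k=1..n. t k)"

text \<open>\<open>clock t m\<close> is the time of the \<open>m\<close>-th jump, and until the next
  one the cells are those with labels 1 to \<open>Suc m\<close>. The product is the indicator that
  no cell is hit before the \<open>n\<close>-th jump.\<close>

definition mavoided :: "nat \<Rightarrow> (nat \<Rightarrow> real) \<Rightarrow> (nat \<Rightarrow> (real^2) set) \<Rightarrow> (nat \<Rightarrow> nat) \<Rightarrow> ennreal" where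
  "mavoided n t g a = (\<Prod>m<n. \<Prod>j\<in>{1..Suc m}. unhit (mecke_cell W g a m j) (clock t m) (clock t (Suc m)))"

definition mvalue :: "nat \<Rightarrow> (nat \<Rightarrow> real) \<Rightarrow> (nat \<Rightarrow> (real^2) set) \<Rightarrow> (nat \<Rightarrow> nat) \<Rightarrow> ennreal" where
  "mvalue n t g a = mavoided n t g a * (\<Prod>j\<in>{1..Suc n}. surv (mecke_cell W g a n j) (clock t n))"

lemma clock_cong: "(\<And>k. k \<in> {1..n} \<Longrightarrow> t k = t' k) \<Longrightarrow> clock t n = clock t' n"
  unfolding clock_def by (rule sum.cong) auto

lemma mavoided_cong:
  assumes "\<And>k. k \<in> {1..n} \<Longrightarrow> t k = t' k" "\<And>k. k \<in> {1..n} \<Longrightarrow> g k = g' k" "\<And>k. k \<in> {1..n} \<Longrightarrow> a k = a' k"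
  shows "mavoided n t g a = mavoided n t' g' a'"
  unfolding mavoided_def
proof (intro prod.cong refl arg_cong3[where f = unhit])
  fix m j assume m: "m \<in> {..<n}"
  show "mecke_cell W g a m j = mecke_cell W g' a' m j"
    using m assms by (intro mecke_cell_cong) auto
  show "clock t m = clock t' m" "clock t (Suc m) = clock t' (Suc m)"
    using m assms by (auto intro!: clock_cong)
qed

lemma mvalue_cong:
  assumes "\<And>k. k \<in> {1..n} \<Longrightarrow> t k = t' k" "\<And>k. k \<in> {1..n} \<Longrightarrow> g k = g' k" "\<And>k. k \<in> {1..n} \<Longrightarrow> a k = a' k"
  shows "mvalue n t g a = mvalue n t' g' a'"
proof -
  have "mecke_cell W g a n j = mecke_cell W g' a' n j" for j using assms by (intro mecke_cell_cong) auto
  moreover have "clock t n = clock t' n" using assms by (intro clock_cong) auto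
  moreover have "mavoided n t g a = mavoided n t' g' a'" using assms by (rule mavoided_cong)
  ultimately show ?thesis by (simp add: mvalue_def)
qed

lemma measurable_clock:
  assumes "\<And>k. k \<in> {1..n} \<Longrightarrow> (\<lambda>x. t x k) \<in> borel_measurable X"
  shows "(\<lambda>x. clock (t x) n) \<in> borel_measurable X"
  unfolding clock_def using assms by (intro borel_measurable_sum) auto

lemma measurable_mavoided:
  assumes "\<And>k. k \<in> {1..n} \<Longrightarrow> (\<lambda>x. t x k) \<in> borel_measurable X"
    and "\<And>k. k \<in> {1..n} \<Longrightarrow> (\<lambda>x. g x k) \<in> measurable X line_space"
    and "\<And>k. k \<in> {1..n} \<Longrightarrow> (\<lambda>x. a x k) \<in> measurable X (count_space UNIV)"
  shows "(\<lambda>x. mavoided n (t x) (g x) (a x)) \<in> borel_measurable X"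
  unfolding mavoided_def using assms
  by (intro borel_measurable_prod_ennreal measurable_unhit measurable_mecke_cell measurable_clock convex_W) auto

lemma measurable_mvalue:
  assumes "\<And>k. k \<in> {1..n} \<Longrightarrow> (\<lambda>x. t x k) \<in> borel_measurable X"
    and "\<And>k. k \<in> {1..n} \<Longrightarrow> (\<lambda>x. g x k) \<in> measurable X line_space"
    and "\<And>k. k \<in> {1..n} \<Longrightarrow> (\<lambda>x. a x k) \<in> measurable X (count_space UNIV)"
  shows "(\<lambda>x. mvalue n (t x) (g x) (a x)) \<in> borel_measurable X"
  unfolding mvalue_def using assms
  by (intro borel_measurable_times_ennreal borel_measurable_prod_ennreal measurable_surv measurable_mecke_cell
    measurable_clock measurable_mavoided convex_W) auto

definition wait :: "nat \<Rightarrow> real measure" where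
  "wait k = density lborel (exponential_density (real k * rate))"

lemma wait_law: "k \<ge> 1 \<Longrightarrow> distr N borel (\<tau> k) = wait k"
  using distributed_distr_eq_density[OF \<tau>_law, of k] unfolding wait_def
  by (metis distr_cong sets_lborel)

lemma prob_wait: "k \<ge> 1 \<Longrightarrow> prob_space (wait k)"
  unfolding wait_def using rate by (intro prob_space_exponential_density) simp

lemma sets_wait [measurable_cong]: "sets (wait k) = sets borel"
  by (simp add: wait_def)

lemma mecke_cell_in_cells:
  assumes "\<And>k. k \<in> {1..n} \<Longrightarrow> g k \<in> lines"
  shows "mecke_cell W g a n j \<in> cells W"
proof -
  have "(\<lambda>x::unit. mecke_cell W g a n j) \<in> measurable (count_space UNIV) (cell_space W)"
    using assms by (intro measurable_mecke_cell convex_W) (auto simp: space_line_space)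
  from measurable_space[OF this, of "()"] show ?thesis by (simp add: space_cell_space)
qed

lemma nn_integral_wait:
  assumes "f \<in> borel_measurable borel" "c = real k * rate"
  shows "(\<integral>\<^sup>+l. f l \<partial>wait k) = (\<integral>\<^sup>+l. ennreal c * decay c 0 l * indicator {0..} l * f l \<partial>lborel)"
proof -
  have "exponential_density (real k * rate) l = c * exp (- c * l) * indicator {0..} l" for l
    using assms(2) by (simp add: exponential_density_def indicator_def mult_ac)
  moreover have "c \<ge> 0" using assms(2) rate by simp
  ultimately have "ennreal (exponential_density (real k * rate) l) = ennreal c * decay c 0 l * indicator {0..} l" for l
    by (simp add: decay_def ennreal_mult' indicator_def)
  then show ?thesis
    unfolding wait_def using assms(1) by (subst nn_integral_density) simp_all
qed

text \<open>Averaging over the uniform label divides by \<open>Suc n\<close>, while the waiting time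
  of rate \<open>Suc n * rate\<close> brings a factor \<open>Suc n\<close> into the density. The two
  cancel and every label is left with rate \<open>rate\<close>, as in
  \<open>prod_surv_eq_mecke\<close>.\<close>

lemma mecke_step:
  assumes C: "\<And>i. i \<in> {1..Suc n} \<Longrightarrow> C i \<in> cells W"
  shows "(\<Sum>j\<in>{1..Suc n}. \<integral>\<^sup>+h. \<integral>\<^sup>+l. (\<Prod>i\<in>{1..Suc n}. unhit (C i) r (r + l)) *
      (surv (C j \<inter> plus_side h) (r + l) * surv (C j \<inter> minus_side h) (r + l) *
       (\<Prod>i\<in>{1..Suc n} - {j}. surv (C i) (r + l))) \<partial>wait (Suc n) \<partial>Q) / of_nat (Suc n) =
    (\<Prod>i\<in>{1..Suc n}. surv (C i) r)"
proof -
  let ?I = "{1..Suc n}"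
  define c where "c = real (Suc n) * rate"
  have c0: "c \<ge> 0" using rate by (simp add: c_def)
  define B where "B l = (\<Prod>i\<in>?I. unhit (C i) r (r + l))" for l
  define S where "S j l = (\<Prod>i\<in>?I - {j}. surv (C i) (r + l))" for j l
  have [measurable]: "B \<in> borel_measurable borel"
  proof -
    have "(\<lambda>l. unhit (C i) r (r + l)) \<in> borel_measurable borel" if "i \<in> ?I" for i
    proof -
      note [measurable] = const_cell[OF C[OF that]]
      show ?thesis by measurable
    qed
    then show ?thesis unfolding B_def by (intro borel_measurable_prod_ennreal) auto
  qed
  have [measurable]: "S j \<in> borel_measurable borel" for j
  proof -
    have "(\<lambda>l. surv (C i) (r + l)) \<in> borel_measurable borel" if "i \<in> ?I" for i
    proof -
      note [measurable] = const_cell[OF C[OF that]]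
      show ?thesis by measurable
    qed
    then show ?thesis unfolding S_def by (intro borel_measurable_prod_ennreal) auto
  qed
  interpret wait: prob_space "wait (Suc n)" by (rule prob_wait) simp
  interpret P: pair_sigma_finite "wait (Suc n)" Q ..
  have tm: "(\<lambda>l. try_gain (C j) (r + l)) \<in> borel_measurable borel" if j: "j \<in> ?I" for j
  proof -
    note [measurable] = const_cell[OF C[OF j]]
    show ?thesis unfolding try_gain_def by measurable
  qed
  have each: "(\<integral>\<^sup>+h. \<integral>\<^sup>+l. B l * (surv (C j \<inter> plus_side h) (r + l) * surv (C j \<inter> minus_side h) (r + l) * S j l) \<partial>wait (Suc n) \<partial>Q) =
      of_nat (Suc n) * (\<integral>\<^sup>+l. decay c 0 l * B l * (try_gain (C j) (r + l) * S j l) * indicator {0..} l \<partial>lborel)"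
    if j: "j \<in> ?I" for j
  proof -
    note [measurable] = const_cell[OF C[OF j]]
    \<comment> \<open>The waiting time is moved outside, so that the integral over lines inside
      becomes \<open>try_gain\<close>.\<close>
    have "(\<integral>\<^sup>+h. \<integral>\<^sup>+l. B l * (surv (C j \<inter> plus_side h) (r + l) * surv (C j \<inter> minus_side h) (r + l) * S j l) \<partial>wait (Suc n) \<partial>Q) =
        (\<integral>\<^sup>+l. \<integral>\<^sup>+h. B l * (surv (C j \<inter> plus_side h) (r + l) * surv (C j \<inter> minus_side h) (r + l) * S j l) \<partial>Q \<partial>wait (Suc n))"
      by (rule P.Fubini') measurable
    also have "\<dots> = (\<integral>\<^sup>+l. B l * S j l * (\<integral>\<^sup>+h. surv (C j \<inter> plus_side h) (r + l) * surv (C j \<inter> minus_side h) (r + l) \<partial>Q) \<partial>wait (Suc n))"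
      by (subst nn_integral_cmult[symmetric]) (auto intro!: nn_integral_cong simp: mult_ac)
    also have "\<dots> = (\<integral>\<^sup>+l. ennreal c * decay c 0 l * indicator {0..} l *
        (B l * S j l * (\<integral>\<^sup>+h. surv (C j \<inter> plus_side h) (r + l) * surv (C j \<inter> minus_side h) (r + l) \<partial>Q)) \<partial>lborel)"
      by (rule nn_integral_wait[OF _ c_def]) measurable
    also have "\<dots> = (\<integral>\<^sup>+l. of_nat (Suc n) * (decay c 0 l * B l * (try_gain (C j) (r + l) * S j l) * indicator {0..} l) \<partial>lborel)"
    proof (rule nn_integral_cong)
      fix l
      have "ennreal c = of_nat (Suc n) * ennreal rate"
        unfolding c_def using rate by (simp add: ennreal_mult del: of_nat_Suc flip: ennreal_of_nat_eq_real_of_nat)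
      then show "ennreal c * decay c 0 l * indicator {0..} l *
        (B l * S j l * (\<integral>\<^sup>+h. surv (C j \<inter> plus_side h) (r + l) * surv (C j \<inter> minus_side h) (r + l) \<partial>Q)) =
        of_nat (Suc n) * (decay c 0 l * B l * (try_gain (C j) (r + l) * S j l) * indicator {0..} l)"
        unfolding try_gain_def by (simp only: mult_ac)
    qed
    also have "\<dots> = of_nat (Suc n) * (\<integral>\<^sup>+l. decay c 0 l * B l * (try_gain (C j) (r + l) * S j l) * indicator {0..} l \<partial>lborel)"
    proof (rule nn_integral_cmult)
      note [measurable] = tm[OF j]
      show "(\<lambda>l. decay c 0 l * B l * (try_gain (C j) (r + l) * S j l) * indicator {0..} l) \<in> borel_measurable lborel"
        by measurable
    qed
    finally show ?thesis .
  qed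
  have "(\<Sum>j\<in>?I. \<integral>\<^sup>+h. \<integral>\<^sup>+l. B l * (surv (C j \<inter> plus_side h) (r + l) * surv (C j \<inter> minus_side h) (r + l) * S j l) \<partial>wait (Suc n) \<partial>Q) =
     of_nat (Suc n) * (\<Sum>j\<in>?I. \<integral>\<^sup>+l. decay c 0 l * B l * (try_gain (C j) (r + l) * S j l) * indicator {0..} l \<partial>lborel)"
    by (simp only: each sum_distrib_left cong: sum.cong)
  also have "(\<Sum>j\<in>?I. \<integral>\<^sup>+l. decay c 0 l * B l * (try_gain (C j) (r + l) * S j l) * indicator {0..} l \<partial>lborel) =
     (\<integral>\<^sup>+l. (\<Sum>j\<in>?I. decay c 0 l * B l * (try_gain (C j) (r + l) * S j l) * indicator {0..} l) \<partial>lborel)"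
  proof (rule nn_integral_sum[symmetric])
    fix j assume "j \<in> ?I"
    note [measurable] = tm[OF this]
    show "(\<lambda>l. decay c 0 l * B l * (try_gain (C j) (r + l) * S j l) * indicator {0..} l) \<in> borel_measurable lborel"
      by measurable
  qed
  also have "\<dots> = (\<integral>\<^sup>+l. decay c r (r + l) * B l * (\<Sum>j\<in>?I. try_gain (C j) (r + l) * S j l) * indicator {r..} (r + l) \<partial>lborel)"
  proof (rule nn_integral_cong)
    fix l
    have ind: "(indicator {r..} (r + l) :: ennreal) = indicator {0..} l" by (simp add: indicator_def)
    show "(\<Sum>j\<in>?I. decay c 0 l * B l * (try_gain (C j) (r + l) * S j l) * indicator {0..} l) =
        decay c r (r + l) * B l * (\<Sum>j\<in>?I. try_gain (C j) (r + l) * S j l) * indicator {r..} (r + l)"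
      by (simp only: decay_shift sum_distrib_left sum_distrib_right ind)
  qed
  \<comment> \<open>Substitution \<open>s = r + l\<close>, from the waiting time to the time of the
    jump.\<close>
  also have "\<dots> = (\<integral>\<^sup>+s. decay c r s * (\<Prod>i\<in>?I. unhit (C i) r s) *
      (\<Sum>j\<in>?I. try_gain (C j) s * (\<Prod>i\<in>?I - {j}. surv (C i) s)) * indicator {r..} s \<partial>lborel)"
  proof -
    have "(\<lambda>s. decay c r s * (\<Prod>i\<in>?I. unhit (C i) r s) *
      (\<Sum>j\<in>?I. try_gain (C j) s * (\<Prod>i\<in>?I - {j}. surv (C i) s)) * indicator {r..} s) \<in> borel_measurable borel"
    proof -
      have "(\<lambda>l. decay c 0 l * B l * (\<Sum>j\<in>?I. try_gain (C j) (r + l) * S j l) * indicator {0..} l) \<in> borel_measurable borel"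
        using tm by measurable
      from measurable_compose[OF _ this, of "\<lambda>s. s - r"] show ?thesis
        using decay_shift[of c r "s - r" for s] by (simp add: B_def S_def indicator_def)
    qed
    from nn_integral_real_affine[OF this, of 1 r] show ?thesis by (simp add: B_def S_def)
  qed
  also have "\<dots> = (\<Prod>i\<in>?I. surv (C i) r)"
    using prod_surv_eq_mecke[of ?I C r] C by (simp add: c_def)
  finally have "(\<Sum>j\<in>?I. \<integral>\<^sup>+h. \<integral>\<^sup>+l. B l * (surv (C j \<inter> plus_side h) (r + l) * surv (C j \<inter> minus_side h) (r + l) * S j l) \<partial>wait (Suc n) \<partial>Q) =
     of_nat (Suc n) * (\<Prod>i\<in>?I. surv (C i) r)" .
  moreover have "of_nat (Suc n) * x / of_nat (Suc n) = x" for x :: ennreal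
    by (subst mult.commute) (rule ennreal_mult_divide_eq; simp)
  ultimately show ?thesis by (simp only: B_def S_def)
qed

lemma mvalue_Suc_upd:
  assumes "j \<in> {1..Suc n}"
  shows "mvalue (Suc n) (t(Suc n := l)) (g(Suc n := h)) (a(Suc n := j)) = mavoided n t g a *
    ((\<Prod>i\<in>{1..Suc n}. unhit (mecke_cell W g a n i) (clock t n) (clock t n + l)) *
     (surv (mecke_cell W g a n j \<inter> plus_side h) (clock t n + l) *
      surv (mecke_cell W g a n j \<inter> minus_side h) (clock t n + l) *
      (\<Prod>i\<in>{1..Suc n} - {j}. surv (mecke_cell W g a n i) (clock t n + l))))"
proof -
  let ?t = "t(Suc n := l)" and ?g = "g(Suc n := h)" and ?a = "a(Suc n := j)"
  have cell: "mecke_cell W ?g ?a n i = mecke_cell W g a n i" for i by (rule mecke_cell_cong) auto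
  have clock_n: "clock ?t n = clock t n" by (rule clock_cong) auto
  have clock_Suc: "clock ?t (Suc n) = clock t n + l" using clock_n by (simp add: clock_def)
  have av: "mavoided n ?t ?g ?a = mavoided n t g a" by (rule mavoided_cong) auto
  have "mavoided (Suc n) ?t ?g ?a = mavoided n t g a *
      (\<Prod>i\<in>{1..Suc n}. unhit (mecke_cell W g a n i) (clock t n) (clock t n + l))"
    using av by (simp only: mavoided_def prod.lessThan_Suc cell clock_n clock_Suc)
  moreover have "(\<Prod>i\<in>{1..Suc (Suc n)}. surv (mecke_cell W ?g ?a (Suc n) i) (clock ?t (Suc n))) =
     surv (mecke_cell W g a n j \<inter> plus_side h) (clock t n + l) *
      surv (mecke_cell W g a n j \<inter> minus_side h) (clock t n + l) *
      (\<Prod>i\<in>{1..Suc n} - {j}. surv (mecke_cell W g a n i) (clock t n + l))"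
    using prod_mecke_cell_Suc[OF assms, of ?a "\<lambda>C. surv C (clock t n + l)" W ?g]
    by (simp only: clock_Suc cell fun_upd_same)
  ultimately show ?thesis unfolding mvalue_def by (simp only: mult.assoc)
qed

text \<open>Clocks, lines and labels are read off at independent points \<open>x\<close>,
  \<open>y\<close>, \<open>z\<close>. \<open>mecke_avoids\<close> transports the result back to a
  single point, where the independence of the jump process from lines and labels is given.\<close>

definition tri :: "((nat \<Rightarrow> real) \<Rightarrow> (nat \<Rightarrow> (real^2) set) \<Rightarrow> (nat \<Rightarrow> nat) \<Rightarrow> ennreal) \<Rightarrow> ennreal" where
  "tri f = (\<integral>\<^sup>+z. \<integral>\<^sup>+y. \<integral>\<^sup>+x. f (\<lambda>k. \<tau> k x) (\<lambda>k. \<gamma> k y) (\<lambda>k. \<alpha> k z) \<partial>N \<partial>N \<partial>N)"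

text \<open>\<open>nn_integral_peel\<close> is applied to the waiting times, the lines and the
  labels in turn; the integrals are ordered so that the last line and the last waiting time are
  innermost, with the past fixed.\<close>

lemma peel_mvalue:
  "tri (mvalue (Suc n)) =
    (\<integral>\<^sup>+z. \<integral>\<^sup>+j. \<integral>\<^sup>+y. \<integral>\<^sup>+x. \<integral>\<^sup>+h. \<integral>\<^sup>+l. mvalue (Suc n) ((\<lambda>k. \<tau> k x)(Suc n := l)) ((\<lambda>k. \<gamma> k y)(Suc n := h)) ((\<lambda>k. \<alpha> k z)(Suc n := j))
       \<partial>wait (Suc n) \<partial>Q \<partial>N \<partial>N \<partial>measure_pmf (pmf_of_set {1..Suc n}) \<partial>N)"
proof -
  let ?v = "\<lambda>x y h l a. mvalue (Suc n) ((\<lambda>k. \<tau> k x)(Suc n := l)) ((\<lambda>k. \<gamma> k y)(Suc n := h)) a"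
  interpret wait: prob_space "wait (Suc n)" by (rule prob_wait) simp
  interpret P: pair_sigma_finite N Q ..
  have 1: "(\<integral>\<^sup>+x. mvalue (Suc n) (\<lambda>k. \<tau> k x) g a \<partial>N) =
      (\<integral>\<^sup>+x. \<integral>\<^sup>+l. mvalue (Suc n) ((\<lambda>k. \<tau> k x)(Suc n := l)) g a \<partial>wait (Suc n) \<partial>N)"
    if "\<And>k. k \<in> {1..Suc n} \<Longrightarrow> g k \<in> lines" for g a
  proof -
    have "(\<integral>\<^sup>+x. mvalue (Suc n) (\<lambda>k. \<tau> k x) g a \<partial>N) =
        (\<integral>\<^sup>+x. \<integral>\<^sup>+l. mvalue (Suc n) ((\<lambda>k. \<tau> k x)(Suc n := l)) g a \<partial>distr N borel (\<tau> (Suc n)) \<partial>N)"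
      by (rule N.nn_integral_peel[OF \<tau>_indep])
         (use that in \<open>auto intro!: measurable_mvalue mvalue_cong simp: space_line_space\<close>)
    then show ?thesis by (simp only: wait_law[of "Suc n", simplified])
  qed
  have 2: "(\<integral>\<^sup>+y. (\<integral>\<^sup>+x. \<integral>\<^sup>+l. mvalue (Suc n) ((\<lambda>k. \<tau> k x)(Suc n := l)) (\<lambda>k. \<gamma> k y) a \<partial>wait (Suc n) \<partial>N) \<partial>N) =
      (\<integral>\<^sup>+y. \<integral>\<^sup>+h. (\<integral>\<^sup>+x. \<integral>\<^sup>+l. ?v x y h l a \<partial>wait (Suc n) \<partial>N) \<partial>Q \<partial>N)"
    for a
  proof -
    have "(\<integral>\<^sup>+y. (\<integral>\<^sup>+x. \<integral>\<^sup>+l. mvalue (Suc n) ((\<lambda>k. \<tau> k x)(Suc n := l)) (\<lambda>k. \<gamma> k y) a \<partial>wait (Suc n) \<partial>N) \<partial>N) =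
      (\<integral>\<^sup>+y. \<integral>\<^sup>+h. (\<integral>\<^sup>+x. \<integral>\<^sup>+l. ?v x y h l a \<partial>wait (Suc n) \<partial>N)
        \<partial>distr N line_space (\<gamma> (Suc n)) \<partial>N)"
    proof (rule N.nn_integral_peel[OF \<gamma>_indep])
      have "(\<lambda>p. mvalue (Suc n) ((\<lambda>k. \<tau> k (snd (fst p)))(Suc n := snd p)) (fst (fst p)) a)
        \<in> borel_measurable ((Pi\<^sub>M {1..Suc n} (\<lambda>_. line_space) \<Otimes>\<^sub>M N) \<Otimes>\<^sub>M wait (Suc n))"
        by (rule measurable_mvalue) (auto simp: fun_upd_def)
      then show "(\<lambda>g. \<integral>\<^sup>+x. \<integral>\<^sup>+l. mvalue (Suc n) ((\<lambda>k. \<tau> k x)(Suc n := l)) g a \<partial>wait (Suc n) \<partial>N)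
          \<in> borel_measurable (Pi\<^sub>M {1..Suc n} (\<lambda>_. line_space))"
        by (simp add: split_beta')
    qed (auto intro!: nn_integral_cong mvalue_cong)
    then show ?thesis by (simp only: \<gamma>_law[of "Suc n", simplified])
  qed
  \<comment> \<open>Only the past clocks \<open>x\<close> and the new line \<open>h\<close> have to
    change places.\<close>
  have 3: "(\<integral>\<^sup>+y. \<integral>\<^sup>+h. (\<integral>\<^sup>+x. \<integral>\<^sup>+l. ?v x y h l a \<partial>wait (Suc n) \<partial>N) \<partial>Q \<partial>N) =
      (\<integral>\<^sup>+y. (\<integral>\<^sup>+x. \<integral>\<^sup>+h. \<integral>\<^sup>+l. ?v x y h l a \<partial>wait (Suc n) \<partial>Q \<partial>N) \<partial>N)"
    for a
  proof (rule nn_integral_cong)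
    fix y assume y: "y \<in> space N"
    have "(\<lambda>p. mvalue (Suc n) ((\<lambda>k. \<tau> k (fst (fst p)))(Suc n := snd p)) ((\<lambda>k. \<gamma> k y)(Suc n := snd (fst p))) a)
      \<in> borel_measurable ((N \<Otimes>\<^sub>M Q) \<Otimes>\<^sub>M wait (Suc n))"
      by (rule measurable_mvalue) (use measurable_space[OF rv(1) y] in \<open>auto simp: fun_upd_def space_line_space\<close>)
    then show "(\<integral>\<^sup>+h. (\<integral>\<^sup>+x. \<integral>\<^sup>+l. ?v x y h l a \<partial>wait (Suc n) \<partial>N) \<partial>Q) =
      (\<integral>\<^sup>+x. \<integral>\<^sup>+h. \<integral>\<^sup>+l. ?v x y h l a \<partial>wait (Suc n) \<partial>Q \<partial>N)"
      by (intro P.Fubini') (simp add: split_beta')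
  qed
  have "tri (mvalue (Suc n)) = (\<integral>\<^sup>+z. (\<integral>\<^sup>+y. (\<integral>\<^sup>+x. \<integral>\<^sup>+h. \<integral>\<^sup>+l.
      ?v x y h l (\<lambda>k. \<alpha> k z) \<partial>wait (Suc n) \<partial>Q \<partial>N) \<partial>N) \<partial>N)"
    unfolding tri_def 3[symmetric] 2[symmetric]
    by (intro nn_integral_cong 1) (use measurable_space[OF rv(1)] in \<open>auto simp: space_line_space\<close>)
  also have "\<dots> = (\<integral>\<^sup>+z. \<integral>\<^sup>+j. \<integral>\<^sup>+y. \<integral>\<^sup>+x. \<integral>\<^sup>+h. \<integral>\<^sup>+l. ?v x y h l ((\<lambda>k. \<alpha> k z)(Suc n := j))
       \<partial>wait (Suc n) \<partial>Q \<partial>N \<partial>N \<partial>distr N (count_space UNIV) (\<alpha> (Suc n)) \<partial>N)"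
  proof (rule N.nn_integral_peel[OF \<alpha>_indep])
    have "(\<lambda>p. mvalue (Suc n) ((\<lambda>k. \<tau> k (snd (fst (fst p))))(Suc n := snd p)) ((\<lambda>k. \<gamma> k (snd (fst (fst (fst p)))))(Suc n := snd (fst p))) (fst (fst (fst (fst p)))))
      \<in> borel_measurable ((((Pi\<^sub>M {1..Suc n} (\<lambda>_. count_space UNIV) \<Otimes>\<^sub>M N) \<Otimes>\<^sub>M N) \<Otimes>\<^sub>M Q) \<Otimes>\<^sub>M wait (Suc n))"
      by (rule measurable_mvalue) (auto simp: fun_upd_def)
    then show "(\<lambda>a. \<integral>\<^sup>+y. \<integral>\<^sup>+x. \<integral>\<^sup>+h. \<integral>\<^sup>+l. ?v x y h l a
       \<partial>wait (Suc n) \<partial>Q \<partial>N \<partial>N) \<in> borel_measurable (Pi\<^sub>M {1..Suc n} (\<lambda>_. count_space UNIV))"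
      by (simp add: split_beta')
  qed (auto intro!: nn_integral_cong mvalue_cong)
  finally have "tri (mvalue (Suc n)) = (\<integral>\<^sup>+z. \<integral>\<^sup>+j. \<integral>\<^sup>+y. \<integral>\<^sup>+x. \<integral>\<^sup>+h. \<integral>\<^sup>+l.
      ?v x y h l ((\<lambda>k. \<alpha> k z)(Suc n := j))
       \<partial>wait (Suc n) \<partial>Q \<partial>N \<partial>N \<partial>distr N (count_space UNIV) (\<alpha> (Suc n)) \<partial>N)" .
  moreover have "distr N (count_space UNIV) (\<alpha> (Suc n)) = measure_pmf (pmf_of_set {1..Suc n})"
    by (rule \<alpha>_law) simp
  ultimately show ?thesis by (simp only:)
qed

text \<open>With the past fixed, the integrals over the last label, line and waiting time are those
  of \<open>mecke_step\<close> for the cells after \<open>n\<close> jumps.\<close>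

lemma mecke_martingale: "tri (mvalue n) = surv W 0"
proof (induction n)
  case 0
  then show ?case
    by (simp add: tri_def mvalue_def mavoided_def clock_def N.emeasure_space_1)
next
  case (Suc n)
  interpret wait: prob_space "wait (Suc n)" by (rule prob_wait) simp
  let ?v = "\<lambda>x y z j h l. mvalue (Suc n) ((\<lambda>k. \<tau> k x)(Suc n := l)) ((\<lambda>k. \<gamma> k y)(Suc n := h)) ((\<lambda>k. \<alpha> k z)(Suc n := j))"
  have m: "(\<lambda>p. ?v (snd (fst (fst p))) (fst (fst (fst p))) z j (snd (fst p)) (snd p))
      \<in> borel_measurable (((N \<Otimes>\<^sub>M N) \<Otimes>\<^sub>M Q) \<Otimes>\<^sub>M wait (Suc n))" for z j
    by (rule measurable_mvalue) (auto simp: fun_upd_def)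
  then have m2: "(\<lambda>p. \<integral>\<^sup>+h. \<integral>\<^sup>+l. ?v (snd p) (fst p) z j h l \<partial>wait (Suc n) \<partial>Q) \<in> borel_measurable (N \<Otimes>\<^sub>M N)" for z j
    by (simp add: split_beta')
  have "tri (mvalue (Suc n)) =
     (\<integral>\<^sup>+z. \<integral>\<^sup>+j. \<integral>\<^sup>+y. \<integral>\<^sup>+x. \<integral>\<^sup>+h. \<integral>\<^sup>+l. ?v x y z j h l
       \<partial>wait (Suc n) \<partial>Q \<partial>N \<partial>N \<partial>measure_pmf (pmf_of_set {1..Suc n}) \<partial>N)"
    by (rule peel_mvalue)
  also have "\<dots> = (\<integral>\<^sup>+z. \<integral>\<^sup>+y. \<integral>\<^sup>+x. (\<Sum>j\<in>{1..Suc n}. \<integral>\<^sup>+h. \<integral>\<^sup>+l. ?v x y z j h l \<partial>wait (Suc n) \<partial>Q) / of_nat (Suc n) \<partial>N \<partial>N \<partial>N)"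
  proof (rule nn_integral_cong)
    fix z
    \<comment> \<open>The expectation over the uniform label is a mean of finitely many terms, which
      is then moved inside the integrals over the past.\<close>
    have "(\<integral>\<^sup>+j. \<integral>\<^sup>+y. \<integral>\<^sup>+x. \<integral>\<^sup>+h. \<integral>\<^sup>+l. ?v x y z j h l \<partial>wait (Suc n) \<partial>Q \<partial>N \<partial>N \<partial>measure_pmf (pmf_of_set {1..Suc n})) =
        (\<Sum>j\<in>{1..Suc n}. \<integral>\<^sup>+y. \<integral>\<^sup>+x. \<integral>\<^sup>+h. \<integral>\<^sup>+l. ?v x y z j h l \<partial>wait (Suc n) \<partial>Q \<partial>N \<partial>N) / of_nat (Suc n)"
      by (subst nn_integral_pmf_of_set) auto
    also have "\<dots> = (\<integral>\<^sup>+y. (\<Sum>j\<in>{1..Suc n}. \<integral>\<^sup>+x. \<integral>\<^sup>+h. \<integral>\<^sup>+l. ?v x y z j h l \<partial>wait (Suc n) \<partial>Q \<partial>N) / of_nat (Suc n) \<partial>N)"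
      using N.borel_measurable_nn_integral_fst[OF m2] by (intro sum_nn_integral_divide) simp_all
    also have "\<dots> = (\<integral>\<^sup>+y. \<integral>\<^sup>+x. (\<Sum>j\<in>{1..Suc n}. \<integral>\<^sup>+h. \<integral>\<^sup>+l. ?v x y z j h l \<partial>wait (Suc n) \<partial>Q) / of_nat (Suc n) \<partial>N \<partial>N)"
    proof (intro nn_integral_cong sum_nn_integral_divide)
      fix y j assume y: "y \<in> space N"
      show "(\<lambda>x. \<integral>\<^sup>+h. \<integral>\<^sup>+l. ?v x y z j h l \<partial>wait (Suc n) \<partial>Q) \<in> borel_measurable N"
        using measurable_compose[OF measurable_Pair1'[OF y, of N] m2[of z j]] by simp
    qed
    finally show "(\<integral>\<^sup>+j. \<integral>\<^sup>+y. \<integral>\<^sup>+x. \<integral>\<^sup>+h. \<integral>\<^sup>+l. ?v x y z j h l \<partial>wait (Suc n) \<partial>Q \<partial>N \<partial>N \<partial>measure_pmf (pmf_of_set {1..Suc n})) =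
      (\<integral>\<^sup>+y. \<integral>\<^sup>+x. (\<Sum>j\<in>{1..Suc n}. \<integral>\<^sup>+h. \<integral>\<^sup>+l. ?v x y z j h l \<partial>wait (Suc n) \<partial>Q) / of_nat (Suc n) \<partial>N \<partial>N)" .
  qed
  also have "\<dots> = tri (mvalue n)"
    unfolding tri_def
  proof (intro nn_integral_cong)
    fix x y z assume y: "y \<in> space N"
    let ?C = "\<lambda>i. mecke_cell W (\<lambda>k. \<gamma> k y) (\<lambda>k. \<alpha> k z) n i" and ?r = "clock (\<lambda>k. \<tau> k x) n"
    let ?m = "mavoided n (\<lambda>k. \<tau> k x) (\<lambda>k. \<gamma> k y) (\<lambda>k. \<alpha> k z)"
    let ?f = "\<lambda>j h l. (\<Prod>i\<in>{1..Suc n}. unhit (?C i) ?r (?r + l)) *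
      (surv (?C j \<inter> plus_side h) (?r + l) * surv (?C j \<inter> minus_side h) (?r + l) *
       (\<Prod>i\<in>{1..Suc n} - {j}. surv (?C i) (?r + l)))"
    have C: "?C i \<in> cells W" for i
      using measurable_space[OF rv(1) y] by (intro mecke_cell_in_cells) (auto simp: space_line_space)
    have fm: "(\<lambda>p. ?f j (fst p) (snd p)) \<in> borel_measurable (Q \<Otimes>\<^sub>M wait (Suc n))" for j
    proof -
      note [measurable] = const_cell[OF C]
      show ?thesis by measurable
    qed
    have "(\<integral>\<^sup>+h. \<integral>\<^sup>+l. ?v x y z j h l \<partial>wait (Suc n) \<partial>Q) = ?m * (\<integral>\<^sup>+h. \<integral>\<^sup>+l. ?f j h l \<partial>wait (Suc n) \<partial>Q)" if "j \<in> {1..Suc n}" for j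
    proof -
      have "(\<integral>\<^sup>+h. \<integral>\<^sup>+l. ?v x y z j h l \<partial>wait (Suc n) \<partial>Q) = (\<integral>\<^sup>+h. \<integral>\<^sup>+l. ?m * ?f j h l \<partial>wait (Suc n) \<partial>Q)"
        by (simp only: mvalue_Suc_upd[OF that])
      also have "\<dots> = (\<integral>\<^sup>+h. ?m * (\<integral>\<^sup>+l. ?f j h l \<partial>wait (Suc n)) \<partial>Q)"
      proof (intro nn_integral_cong nn_integral_cmult)
        fix h assume "h \<in> space Q"
        from measurable_compose[OF measurable_Pair1'[OF this, of "wait (Suc n)"] fm[of j]]
        show "(\<lambda>l. ?f j h l) \<in> borel_measurable (wait (Suc n))" by simp
      qed
      also have "\<dots> = ?m * (\<integral>\<^sup>+h. \<integral>\<^sup>+l. ?f j h l \<partial>wait (Suc n) \<partial>Q)"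
        using wait.borel_measurable_nn_integral_fst[OF fm[of j]] by (intro nn_integral_cmult) simp
      finally show ?thesis .
    qed
    then have "(\<Sum>j\<in>{1..Suc n}. \<integral>\<^sup>+h. \<integral>\<^sup>+l. ?v x y z j h l \<partial>wait (Suc n) \<partial>Q) / of_nat (Suc n) =
        ?m * ((\<Sum>j\<in>{1..Suc n}. \<integral>\<^sup>+h. \<integral>\<^sup>+l. ?f j h l \<partial>wait (Suc n) \<partial>Q) / of_nat (Suc n))"
      by (simp only: sum_distrib_left[symmetric] ennreal_times_divide cong: sum.cong)
    also have "\<dots> = mvalue n (\<lambda>k. \<tau> k x) (\<lambda>k. \<gamma> k y) (\<lambda>k. \<alpha> k z)"
      unfolding mecke_step[OF C] mvalue_def ..
    finally show "(\<Sum>j\<in>{1..Suc n}. \<integral>\<^sup>+h. \<integral>\<^sup>+l. ?v x y z j h l \<partial>wait (Suc n) \<partial>Q) / of_nat (Suc n) =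
      mvalue n (\<lambda>k. \<tau> k x) (\<lambda>k. \<gamma> k y) (\<lambda>k. \<alpha> k z)" .
  qed
  finally show ?case using Suc.IH by simp
qed

section \<open>Non-explosion and passage to the limit\<close>

interpretation NN: pair_prob_space N N ..
interpretation NNN: pair_prob_space N "N \<Otimes>\<^sub>M N" ..

abbreviation Om :: "('b \<times> 'b \<times> 'b) measure" where "Om \<equiv> N \<Otimes>\<^sub>M (N \<Otimes>\<^sub>M N)"

text \<open>The independence of clocks, lines and labels is made explicit by evaluating them at the three
  components of a point of \<open>Om\<close>.\<close>

definition on_Om :: "((nat \<Rightarrow> real) \<Rightarrow> (nat \<Rightarrow> (real^2) set) \<Rightarrow> (nat \<Rightarrow> nat) \<Rightarrow> 'c) \<Rightarrow> 'b \<times> 'b \<times> 'b \<Rightarrow> 'c" where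
  "on_Om f w = f (\<lambda>k. \<tau> k (fst w)) (\<lambda>k. \<gamma> k (fst (snd w))) (\<lambda>k. \<alpha> k (snd (snd w)))"

lemma tri_eq:
  assumes [measurable]: "on_Om f \<in> borel_measurable Om"
  shows "tri f = (\<integral>\<^sup>+w. on_Om f w \<partial>Om)"
proof -
  have "(\<integral>\<^sup>+w. on_Om f w \<partial>Om) = (\<integral>\<^sup>+v. \<integral>\<^sup>+x. on_Om f (x, v) \<partial>N \<partial>(N \<Otimes>\<^sub>M N))"
    by (subst NNN.nn_integral_snd) simp_all
  also have "\<dots> = (\<integral>\<^sup>+z. \<integral>\<^sup>+y. \<integral>\<^sup>+x. on_Om f (x, (y, z)) \<partial>N \<partial>N \<partial>N)"
    by (subst NN.nn_integral_snd[symmetric]) (simp_all add: split_beta')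
  finally show ?thesis by (simp add: tri_def on_Om_def)
qed

lemma measurable_on_Om_mavoided [measurable]: "on_Om (mavoided n) \<in> borel_measurable Om"
  unfolding on_Om_def[abs_def] by (rule measurable_mavoided) auto

lemma measurable_on_Om_mvalue [measurable]: "on_Om (mvalue n) \<in> borel_measurable Om"
  unfolding on_Om_def[abs_def] by (rule measurable_mvalue) auto

lemma measurable_clock_tau [measurable]: "(\<lambda>x. clock (\<lambda>k. \<tau> k x) n) \<in> borel_measurable N"
  by (rule measurable_clock) auto

text \<open>The Laplace transform of \<open>\<tau> k\<close> at \<open>rate\<close> is
  \<open>k / (k + 1)\<close>, and the product over \<open>k = 1..n\<close> telescopes. Its
  convergence to 0 is the absence of explosion.\<close>

lemma clock_decay: "(\<integral>\<^sup>+\<omega>. decay rate 0 (clock (\<lambda>k. \<tau> k \<omega>) n) \<partial>N) = ennreal (1 / real (Suc n))"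
proof -
  have each: "(\<integral>\<^sup>+\<omega>. decay rate 0 (\<tau> k \<omega>) \<partial>N) = ennreal (real k / real (Suc k))" if k: "k \<in> {1..n}" for k
  proof -
    let ?c = "real k * rate"
    have pos: "?c + rate > 0" using rate k by (simp add: add_pos_nonneg)
    have "(\<integral>\<^sup>+\<omega>. decay rate 0 (\<tau> k \<omega>) \<partial>N) = (\<integral>\<^sup>+l. decay rate 0 l \<partial>distr N borel (\<tau> k))"
      using k by (intro nn_integral_distr[symmetric]) auto
    also have "\<dots> = (\<integral>\<^sup>+l. decay rate 0 l \<partial>wait k)" using k by (simp add: wait_law)
    also have "\<dots> = (\<integral>\<^sup>+l. ennreal ?c * decay ?c 0 l * indicator {0..} l * decay rate 0 l \<partial>lborel)"
      by (rule nn_integral_wait) simp_all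
    also have "\<dots> = (\<integral>\<^sup>+l. ennreal (real k / real (Suc k)) * (ennreal (?c + rate) * decay (?c + rate) 0 l * indicator {0..} l) \<partial>lborel)"
    proof (rule nn_integral_cong)
      fix l
      have e: "ennreal ?c = ennreal (real k / real (Suc k)) * ennreal (?c + rate)"
        using rate by (subst ennreal_mult'[symmetric]) (simp_all add: field_simps)
      show "ennreal ?c * decay ?c 0 l * indicator {0..} l * decay rate 0 l =
         ennreal (real k / real (Suc k)) * (ennreal (?c + rate) * decay (?c + rate) 0 l * indicator {0..} l)"
        unfolding e decay_add[symmetric] by (simp only: mult_ac)
    qed
    also have "\<dots> = ennreal (real k / real (Suc k)) * 1"
      using decay_integral_inf[OF pos, of 0] by (subst nn_integral_cmult) simp_all
    finally show ?thesis by simp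
  qed
  have "(\<integral>\<^sup>+\<omega>. decay rate 0 (clock (\<lambda>k. \<tau> k \<omega>) n) \<partial>N) = (\<integral>\<^sup>+\<omega>. (\<Prod>k\<in>{1..n}. decay rate 0 (\<tau> k \<omega>)) \<partial>N)"
  proof (rule nn_integral_cong)
    fix \<omega>
    have "decay rate 0 (\<Sum>k\<in>A. \<tau> k \<omega>) = (\<Prod>k\<in>A. decay rate 0 (\<tau> k \<omega>))" if "finite A" for A
      using that
    proof (induction A rule: finite_induct)
      case (insert k A)
      have "decay rate 0 (\<tau> k \<omega> + (\<Sum>k\<in>A. \<tau> k \<omega>)) = decay rate 0 (\<tau> k \<omega>) * decay rate 0 (\<Sum>k\<in>A. \<tau> k \<omega>)"
        by (simp add: decay_def ennreal_mult'[symmetric] exp_add[symmetric] distrib_left)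
      then show ?case using insert by simp
    qed (simp add: decay_def)
    then show "decay rate 0 (clock (\<lambda>k. \<tau> k \<omega>) n) = (\<Prod>k\<in>{1..n}. decay rate 0 (\<tau> k \<omega>))"
      by (simp add: clock_def)
  qed
  also have "\<dots> = (\<Prod>k\<in>{1..n}. \<integral>\<^sup>+\<omega>. decay rate 0 (\<tau> k \<omega>) \<partial>N)"
  proof (rule N.indep_vars_nn_integral)
    have "N.indep_vars (\<lambda>_. borel) \<tau> {1..n}"
      by (rule N.indep_vars_subset[OF \<tau>_indep]) auto
    then show "N.indep_vars (\<lambda>_. borel) (\<lambda>k \<omega>. decay rate 0 (\<tau> k \<omega>)) {1..n}"
      by (rule N.indep_vars_compose2) measurable
  qed auto
  also have "\<dots> = (\<Prod>k\<in>{1..n}. ennreal (real k / real (Suc k)))"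
    by (rule prod.cong) (simp_all only: each)
  also have "\<dots> = ennreal (1 / real (Suc n))"
  proof (induction n)
    case (Suc n)
    have "(\<Prod>k\<in>{1..Suc n}. ennreal (real k / real (Suc k))) = ennreal (1 / real (Suc n)) * ennreal (real (Suc n) / real (Suc (Suc n)))"
      using Suc.IH by (simp only: prod.nat_ivl_Suc' mult.commute)
    also have "\<dots> = ennreal (1 / real (Suc (Suc n)))"
      by (subst ennreal_mult'[symmetric]) (simp_all add: field_simps)
    finally show ?case .
  qed simp
  finally show ?thesis .
qed

lemma early_clock: "(\<integral>\<^sup>+\<omega>. of_bool (clock (\<lambda>k. \<tau> k \<omega>) n < T) \<partial>N) \<le> ennreal (exp (rate * T) / real (Suc n))"
proof -
  have "(\<integral>\<^sup>+\<omega>. of_bool (clock (\<lambda>k. \<tau> k \<omega>) n < T) \<partial>N) \<le>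
     (\<integral>\<^sup>+\<omega>. ennreal (exp (rate * T)) * decay rate 0 (clock (\<lambda>k. \<tau> k \<omega>) n) \<partial>N)"
  proof (rule nn_integral_mono)
    fix \<omega>
    have "ennreal (exp (rate * T)) * decay rate 0 (clock (\<lambda>k. \<tau> k \<omega>) n) = ennreal (exp (rate * T + - rate * clock (\<lambda>k. \<tau> k \<omega>) n))"
      by (simp only: decay_def ennreal_mult'[symmetric] exp_add exp_ge_zero diff_0_right)
    moreover have "1 \<le> ennreal (exp (rate * T + - rate * clock (\<lambda>k. \<tau> k \<omega>) n))" if "clock (\<lambda>k. \<tau> k \<omega>) n < T"
      using that rate by simp
    ultimately show "of_bool (clock (\<lambda>k. \<tau> k \<omega>) n < T) \<le> ennreal (exp (rate * T)) * decay rate 0 (clock (\<lambda>k. \<tau> k \<omega>) n)"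
      by (auto simp: of_bool_def)
  qed
  also have "\<dots> = ennreal (exp (rate * T)) * ennreal (1 / real (Suc n))"
    by (subst nn_integral_cmult) (simp_all only: clock_decay, measurable)
  also have "\<dots> = ennreal (exp (rate * T) / real (Suc n))"
    by (subst ennreal_mult'[symmetric]) simp_all
  finally show ?thesis .
qed

lemma clock_bound_tendsto: "(\<lambda>n. ennreal (exp (rate * T) / real (Suc n))) \<longlonglongrightarrow> 0"
proof -
  have "(\<lambda>n. exp (rate * T) * inverse (real (Suc n))) \<longlonglongrightarrow> exp (rate * T) * 0"
    by (intro tendsto_mult tendsto_const LIMSEQ_inverse_real_of_nat)
  then have "(\<lambda>n. exp (rate * T) / real (Suc n)) \<longlonglongrightarrow> 0" by (simp only: divide_inverse mult_zero_right)
  from tendsto_ennrealI[OF this] show ?thesis by simp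
qed

lemma mavoided_eq: "mavoided n t g a =
  of_bool (\<forall>m<n. \<forall>j\<in>{1..Suc m}. unhit (mecke_cell W g a m j) (clock t m) (clock t (Suc m)) = 1)"
proof (cases "\<forall>m<n. \<forall>j\<in>{1..Suc m}. unhit (mecke_cell W g a m j) (clock t m) (clock t (Suc m)) = 1")
  case True
  then have "(\<Prod>m<n. \<Prod>j\<in>{1..Suc m}. unhit (mecke_cell W g a m j) (clock t m) (clock t (Suc m))) = 1"
    by (intro prod.neutral ballI) auto
  then have "mavoided n t g a = 1" by (simp only: mavoided_def)
  then show ?thesis unfolding of_bool_def if_P[OF True] .
next
  case False
  then obtain m j where mj: "m < n" "j \<in> {1..Suc m}" "unhit (mecke_cell W g a m j) (clock t m) (clock t (Suc m)) \<noteq> 1"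
    by blast
  then have "unhit (mecke_cell W g a m j) (clock t m) (clock t (Suc m)) = 0" by (simp add: unhit_def split: if_splits)
  then have "(\<Prod>j\<in>{1..Suc m}. unhit (mecke_cell W g a m j) (clock t m) (clock t (Suc m))) = 0"
    using mj(2) by (intro prod_zero) auto
  then have "mavoided n t g a = 0" unfolding mavoided_def using mj(1) by (intro prod_zero) auto
  then show ?thesis unfolding of_bool_def if_not_P[OF False] .
qed

text \<open>As on the STIT tree: the product of \<open>surv\<close> over the cells after
  \<open>n\<close> jumps is at most 1, and equal to 1 once the \<open>n\<close>-th jump is past
  \<open>T\<close>.\<close>

lemma mavoided_tendsto: "(\<lambda>n. \<integral>\<^sup>+w. on_Om (mavoided n) w \<partial>Om) \<longlonglongrightarrow> surv W 0"
proof (rule tendsto_sandwich)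
  let ?Z = "\<lambda>n t g a. \<Prod>j\<in>{1..Suc n}. surv (mecke_cell W g a n j) (clock t n)"
  have mart: "(\<integral>\<^sup>+w. on_Om (mvalue n) w \<partial>Om) = surv W 0" for n
    using mecke_martingale[of n] tri_eq[OF measurable_on_Om_mvalue] by simp
  have cell: "mecke_cell W (\<lambda>k. \<gamma> k (fst (snd w))) (\<lambda>k. \<alpha> k (snd (snd w))) n j \<in> cells W" if "w \<in> space Om" for w n j
    using that measurable_space[OF rv(1)]
    by (intro mecke_cell_in_cells) (auto simp: space_line_space space_pair_measure)
  have Z1: "on_Om (?Z n) w \<le> 1" if "w \<in> space Om" for n w
    unfolding on_Om_def using cell[OF that] by (intro prod_le_1) (auto simp: surv_le_1)
  have split: "on_Om (mvalue n) w = on_Om (mavoided n) w * on_Om (?Z n) w" for n w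
    by (simp only: on_Om_def mvalue_def)
  show "\<forall>\<^sub>F n in sequentially. surv W 0 \<le> (\<integral>\<^sup>+w. on_Om (mavoided n) w \<partial>Om)"
  proof (rule always_eventually, rule allI)
    fix n
    have "(\<integral>\<^sup>+w. on_Om (mvalue n) w \<partial>Om) \<le> (\<integral>\<^sup>+w. on_Om (mavoided n) w \<partial>Om)"
    proof (rule nn_integral_mono)
      fix w assume "w \<in> space Om"
      from mult_left_mono[OF Z1[OF this, of n], of "on_Om (mavoided n) w"]
      show "on_Om (mvalue n) w \<le> on_Om (mavoided n) w" by (simp only: split mult_1_right zero_le)
    qed
    then show "surv W 0 \<le> (\<integral>\<^sup>+w. on_Om (mavoided n) w \<partial>Om)" by (simp only: mart)
  qed
  show "\<forall>\<^sub>F n in sequentially. (\<integral>\<^sup>+w. on_Om (mavoided n) w \<partial>Om) \<le> surv W 0 + ennreal (exp (rate * T) / real (Suc n))"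
  proof (rule always_eventually, rule allI)
    fix n
    let ?L = "\<lambda>w. of_bool (clock (\<lambda>k. \<tau> k (fst w)) n < T) :: ennreal"
    have "(\<integral>\<^sup>+w. on_Om (mavoided n) w \<partial>Om) \<le> (\<integral>\<^sup>+w. on_Om (mvalue n) w + ?L w \<partial>Om)"
    proof (rule nn_integral_mono)
      fix w assume w: "w \<in> space Om"
      show "on_Om (mavoided n) w \<le> on_Om (mvalue n) w + ?L w"
      proof (cases "clock (\<lambda>k. \<tau> k (fst w)) n < T")
        case True
        have "on_Om (mavoided n) w \<le> 1"
          unfolding on_Om_def mavoided_eq by simp
        then show ?thesis using True by (simp add: add_increasing)
      next
        case False
        then have "on_Om (?Z n) w = 1"
          unfolding on_Om_def using cell[OF w] by (intro prod.neutral) (auto simp: surv_after not_less)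
        then show ?thesis by (simp only: split mult_1_right) simp
      qed
    qed
    also have "\<dots> = (\<integral>\<^sup>+w. on_Om (mvalue n) w \<partial>Om) + (\<integral>\<^sup>+w. ?L w \<partial>Om)"
      by (rule nn_integral_add) measurable
    also have "(\<integral>\<^sup>+w. ?L w \<partial>Om) = (\<integral>\<^sup>+x. of_bool (clock (\<lambda>k. \<tau> k x) n < T) \<partial>N)"
      by (subst NN.P.nn_integral_fst[symmetric]) (simp_all add: NN.P.emeasure_space_1)
    also have "(\<integral>\<^sup>+w. on_Om (mvalue n) w \<partial>Om) + (\<integral>\<^sup>+x. of_bool (clock (\<lambda>k. \<tau> k x) n < T) \<partial>N) \<le>
        surv W 0 + ennreal (exp (rate * T) / real (Suc n))"
      unfolding mart by (rule add_left_mono[OF early_clock])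
    finally show "(\<integral>\<^sup>+w. on_Om (mavoided n) w \<partial>Om) \<le> surv W 0 + ennreal (exp (rate * T) / real (Suc n))" .
  qed
  have "(\<lambda>n. surv W 0 + ennreal (exp (rate * T) / real (Suc n))) \<longlonglongrightarrow> surv W 0 + 0"
    by (intro tendsto_add tendsto_const clock_bound_tendsto)
  then show "(\<lambda>n. surv W 0 + ennreal (exp (rate * T) / real (Suc n))) \<longlonglongrightarrow> surv W 0" by simp
qed simp

lemma all_avoided: "emeasure Om {w \<in> space Om. \<forall>n. on_Om (mavoided n) w = 1} = surv W 0"
proof -
  let ?E = "\<lambda>n. {w \<in> space Om. on_Om (mavoided n) w = 1}"
  have "(\<lambda>n. emeasure Om (?E n)) \<longlonglongrightarrow> emeasure Om (\<Inter>n. ?E n)"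
  proof (rule Lim_emeasure_decseq)
    show "decseq ?E" unfolding decseq_def on_Om_def mavoided_eq by (auto split: if_splits)
    show "emeasure Om (?E n) \<noteq> \<infinity>" for n by (simp add: NNN.P.emeasure_eq_measure)
  qed auto
  moreover have "emeasure Om (?E n) = (\<integral>\<^sup>+w. on_Om (mavoided n) w \<partial>Om)" for n
  proof -
    have "(\<integral>\<^sup>+w. on_Om (mavoided n) w \<partial>Om) = (\<integral>\<^sup>+w. indicator (?E n) w \<partial>Om)"
      by (intro nn_integral_cong) (simp add: on_Om_def mavoided_eq indicator_def)
    then show ?thesis by simp
  qed
  ultimately have "(\<lambda>n. \<integral>\<^sup>+w. on_Om (mavoided n) w \<partial>Om) \<longlonglongrightarrow> emeasure Om (\<Inter>n. ?E n)" by simp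
  then have "emeasure Om (\<Inter>n. ?E n) = surv W 0" using mavoided_tendsto by (rule LIMSEQ_unique)
  moreover have "{w \<in> space Om. \<forall>n. on_Om (mavoided n) w = 1} = (\<Inter>n. ?E n)" by auto
  ultimately show ?thesis by simp
qed

section \<open>Avoidance in terms of the jump times\<close>

definition missed :: "(nat \<Rightarrow> (real^2) set) \<Rightarrow> (nat \<Rightarrow> nat) \<Rightarrow> nat \<Rightarrow> (real^2) set \<Rightarrow> bool" where
  "missed g a n U \<longleftrightarrow> (\<forall>j\<in>{1..Suc n}. frontier (mecke_cell W g a n j) \<inter> (U - frontier W) = {})"

lemma mecke_discrete_misses_iff:
  assumes "open U"
  shows "mecke_discrete W g a n \<inter> U = {} \<longleftrightarrow> missed g a n U"
proof -
  have "mecke_discrete W g a n \<inter> U = {} \<longleftrightarrow>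
      U \<inter> ((\<Union>j\<in>{1..n+1}. frontier (mecke_cell W g a n j)) - frontier W) = {}"
    unfolding mecke_discrete_def Int_commute[of "closure _"] by (rule open_Int_closure_eq_empty[OF assms])
  also have "\<dots> \<longleftrightarrow> missed g a n U" unfolding missed_def by auto
  finally show ?thesis .
qed

lemma clock_mono: "(\<And>k. k \<ge> 1 \<Longrightarrow> 0 \<le> t k) \<Longrightarrow> m \<le> n \<Longrightarrow> clock t m \<le> clock t n"
  unfolding clock_def by (intro sum_mono2) auto

text \<open>\<open>Max\<close> has its meaning only on finite non-empty sets:
  \<open>clock t 0 = 0\<close> provides an element, and the monotone clock has passed
  \<open>T > s\<close> at \<open>n0\<close>, which bounds the set.\<close>

lemma cowan_jumps_iff:
  assumes t: "\<And>k. k \<ge> 1 \<Longrightarrow> 0 \<le> t k" and n0: "T \<le> clock t n0" and s: "0 \<le> s" "s < T"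
  shows "cowan_jumps t s = m \<longleftrightarrow> clock t m \<le> s \<and> s < clock t (Suc m)"
proof -
  let ?S = "{n. clock t n \<le> s}"
  have "?S \<subseteq> {..n0}"
  proof
    fix n assume n: "n \<in> ?S"
    show "n \<in> {..n0}"
    proof (rule ccontr)
      assume "n \<notin> {..n0}"
      then have "clock t n0 \<le> clock t n" using t by (intro clock_mono) auto
      then show False using n n0 s by simp
    qed
  qed
  then have fin: "finite ?S" by (rule finite_subset) simp
  have ne: "?S \<noteq> {}" using s by (auto simp: clock_def intro!: exI[of _ 0])
  have jumps: "cowan_jumps t s = Max ?S" by (simp add: cowan_jumps_def clock_def)
  show ?thesis
  proof
    assume "cowan_jumps t s = m"
    then have m: "m = Max ?S" using jumps by simp
    have "clock t m \<le> s" using Max_in[OF fin ne] m by auto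
    moreover have "\<not> clock t (Suc m) \<le> s"
    proof
      assume "clock t (Suc m) \<le> s"
      then have "Suc m \<le> Max ?S" using fin by (intro Max_ge) auto
      then show False using m by simp
    qed
    ultimately show "clock t m \<le> s \<and> s < clock t (Suc m)" by simp
  next
    assume m: "clock t m \<le> s \<and> s < clock t (Suc m)"
    have "Max ?S = m"
    proof (rule Max_eqI[OF fin])
      fix n assume n: "n \<in> ?S"
      show "n \<le> m"
      proof (rule ccontr)
        assume "\<not> n \<le> m"
        then have "clock t (Suc m) \<le> clock t n" using t by (intro clock_mono) auto
        then show False using n m by simp
      qed
    qed (use m in auto)
    then show "cowan_jumps t s = m" using jumps by simp
  qed
qed

text \<open>Every test time lies in exactly one interval between consecutive jumps, so the
  conditions at the test times can be sorted by these intervals.\<close>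

lemma missed_iff_avoided:
  assumes t: "\<And>k. k \<ge> 1 \<Longrightarrow> 0 \<le> t k" and n0: "T \<le> clock t n0"
  shows "(\<forall>p\<in>F. missed g a (cowan_jumps t (fst p)) (snd p)) \<longleftrightarrow> (\<forall>n. mavoided n t g a = 1)"
proof -
  have "(\<forall>p\<in>F. missed g a (cowan_jumps t (fst p)) (snd p)) \<longleftrightarrow>
      (\<forall>p\<in>F. \<forall>m. clock t m \<le> fst p \<and> fst p < clock t (Suc m) \<longrightarrow> missed g a m (snd p))"
    using cowan_jumps_iff[OF t n0 F_nonneg F_before] by (intro ball_cong refl) metis
  also have "\<dots> \<longleftrightarrow> (\<forall>m. \<forall>j\<in>{1..Suc m}. unhit (mecke_cell W g a m j) (clock t m) (clock t (Suc m)) = 1)"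
    unfolding unhit_eq_1 missed_def by meson
  also have "\<dots> \<longleftrightarrow> (\<forall>n. mavoided n t g a = 1)"
  proof -
    have "(\<forall>m. P m) \<longleftrightarrow> (\<forall>n. \<forall>m<n. P m)" for P :: "nat \<Rightarrow> bool" by auto
    moreover have "of_bool b = (1 :: ennreal) \<longleftrightarrow> b" for b by simp
    ultimately show ?thesis unfolding mavoided_eq by (simp only:)
  qed
  finally show ?thesis .
qed

text \<open>These are the conditions of \<open>missed_iff_avoided\<close>. The bound of
  \<open>early_clock\<close> holds for every \<open>n\<close> and tends to 0, so the clock almost
  surely passes \<open>T\<close>.\<close>

lemma AE_clock: "AE x in N. (\<forall>k\<ge>1. 0 \<le> \<tau> k x) \<and> (\<exists>n. T \<le> clock (\<lambda>k. \<tau> k x) n)"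
proof (rule AE_conjI)
  have "AE x in N. 0 \<le> \<tau> k x" if k: "k \<ge> 1" for k
  proof -
    have "AE l in wait k. 0 \<le> l"
      unfolding wait_def by (subst AE_density) (auto simp: exponential_density_def)
    then have "AE l in distr N borel (\<tau> k). 0 \<le> l" unfolding wait_law[OF k] .
    then show ?thesis by (rule AE_distrD[OF rv(3)[OF k]])
  qed
  then show "AE x in N. \<forall>k\<ge>1. 0 \<le> \<tau> k x" by (simp add: AE_all_countable)
  let ?B = "{x \<in> space N. \<forall>n. clock (\<lambda>k. \<tau> k x) n < T}"
  have "emeasure N ?B \<le> ennreal (exp (rate * T) / real (Suc n))" for n
  proof -
    have "emeasure N ?B = (\<integral>\<^sup>+x. indicator ?B x \<partial>N)" by simp
    also have "\<dots> \<le> (\<integral>\<^sup>+x. of_bool (clock (\<lambda>k. \<tau> k x) n < T) \<partial>N)"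
      by (intro nn_integral_mono) (auto simp: indicator_def)
    finally show ?thesis using early_clock[of n] by (rule order_trans)
  qed
  then have "emeasure N ?B \<le> 0"
    by (intro LIMSEQ_le_const[OF clock_bound_tendsto]) auto
  then show "AE x in N. \<exists>n. T \<le> clock (\<lambda>k. \<tau> k x) n"
    by (intro AE_I[of _ _ ?B]) (auto simp: not_le)
qed

lemma pred_missed:
  assumes "open U"
    and g: "\<And>k. k \<ge> 1 \<Longrightarrow> (\<lambda>x. g x k) \<in> measurable X line_space"
    and a: "\<And>k. k \<ge> 1 \<Longrightarrow> (\<lambda>x. a x k) \<in> measurable X (count_space UNIV)"
    and n: "n \<in> measurable X (count_space UNIV)"
  shows "Measurable.pred X (\<lambda>x. missed (g x) (a x) (n x) U)"
proof (rule measurable_compose_countable[OF _ n])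
  fix m
  have "Measurable.pred X (\<lambda>x. frontier (mecke_cell W (g x) (a x) m j) \<inter> (U - frontier W) = {})" for j
    using assms(1) g a
    by (intro measurable_compose[OF measurable_mecke_cell pred_frontier_disjoint] open_Diff frontier_closed convex_W) auto
  then show "Measurable.pred X (\<lambda>x. missed (g x) (a x) m U)"
    unfolding missed_def by (intro pred_intros_finite) auto
qed

lemma missed_cong:
  assumes "\<And>k. k \<ge> 1 \<Longrightarrow> g k = g' k" "\<And>k. k \<ge> 1 \<Longrightarrow> a k = a' k"
  shows "missed g a n U = missed g' a' n U"
proof -
  have "mecke_cell W g a n j = mecke_cell W g' a' n j" for j using assms by (intro mecke_cell_cong) auto
  then show ?thesis by (simp add: missed_def)
qed

text \<open>The process depends on the waiting times only through the jump process, which is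
  independent of lines and labels. So the joint law of the three is a product, and the event may be
  computed on \<open>Om\<close>.\<close>

lemma mecke_avoids:
  "emeasure N {\<omega> \<in> space N. \<forall>p\<in>F. mecke_continuous W (\<lambda>j. \<gamma> j \<omega>) (\<lambda>j. \<alpha> j \<omega>) (\<lambda>k. \<tau> k \<omega>) (fst p) \<inter> snd p = {}} = surv W 0"
proof -
  let ?A = "Pi\<^sub>M {0::real..} (\<lambda>_. count_space (UNIV :: nat set))"
  let ?B = "Pi\<^sub>M {1::nat..} (\<lambda>_. line_space)"
  let ?C = "Pi\<^sub>M {1::nat..} (\<lambda>_. count_space (UNIV :: nat set))"
  let ?X = "\<lambda>\<omega>. \<lambda>t\<in>{0..}. cowan_jumps (\<lambda>k. \<tau> k \<omega>) t"
  let ?Y = "\<lambda>\<omega>. \<lambda>j\<in>{1..}. \<gamma> j \<omega>" and ?Z = "\<lambda>\<omega>. \<lambda>j\<in>{1..}. \<alpha> j \<omega>"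
  let ?S = "?A \<Otimes>\<^sub>M (?B \<Otimes>\<^sub>M ?C)"
  let ?g = "\<lambda>\<omega>. (?X \<omega>, (?Y \<omega>, ?Z \<omega>))"
  let ?h = "\<lambda>(x, v). (?X x, (\<lambda>(y, z). (?Y y, ?Z z)) v)"
  define K where "K = {q \<in> space ?S. \<forall>p\<in>F. missed (fst (snd q)) (snd (snd q)) (fst q (fst p)) (snd p)}"
  have K: "K \<in> sets ?S"
  proof -
    have "Measurable.pred ?S (\<lambda>q. \<forall>p\<in>F. missed (fst (snd q)) (snd (snd q)) (fst q (fst p)) (snd p))"
      by (intro pred_intros_finite finite_F pred_missed) (auto simp: open_F F_nonneg)
    then show ?thesis unfolding K_def by (simp add: pred_def)
  qed
  have X: "?X \<in> measurable N ?A" and Y: "?Y \<in> measurable N ?B" and Z: "?Z \<in> measurable N ?C"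
    using jumps_indep \<gamma>_\<alpha>_indep by (auto simp: indep_rvs_def)
  interpret DX: prob_space "distr N ?A ?X" by (rule N.prob_space_distr[OF X])
  interpret DY: prob_space "distr N ?B ?Y" by (rule N.prob_space_distr[OF Y])
  interpret DZ: prob_space "distr N ?C ?Z" by (rule N.prob_space_distr[OF Z])
  have YZ: "(\<lambda>(y, z). (?Y y, ?Z z)) \<in> measurable (N \<Otimes>\<^sub>M N) (?B \<Otimes>\<^sub>M ?C)" using Y Z by measurable
  have "distr N ?S ?g = distr N ?A ?X \<Otimes>\<^sub>M distr N (?B \<Otimes>\<^sub>M ?C) (\<lambda>\<omega>. (?Y \<omega>, ?Z \<omega>))"
    by (rule indep_rvs_distr_pair[OF prob_N jumps_indep])
  also have "distr N (?B \<Otimes>\<^sub>M ?C) (\<lambda>\<omega>. (?Y \<omega>, ?Z \<omega>)) = distr N ?B ?Y \<Otimes>\<^sub>M distr N ?C ?Z"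
    by (rule indep_rvs_distr_pair[OF prob_N \<gamma>_\<alpha>_indep])
  also have "distr N ?B ?Y \<Otimes>\<^sub>M distr N ?C ?Z = distr (N \<Otimes>\<^sub>M N) (?B \<Otimes>\<^sub>M ?C) (\<lambda>(y, z). (?Y y, ?Z z))"
    by (rule pair_measure_distr[OF Y Z DZ.sigma_finite_measure_axioms])
  also have "distr N ?A ?X \<Otimes>\<^sub>M distr (N \<Otimes>\<^sub>M N) (?B \<Otimes>\<^sub>M ?C) (\<lambda>(y, z). (?Y y, ?Z z)) =
      distr Om ?S ?h"
    by (rule pair_measure_distr[OF X YZ prob_space_imp_sigma_finite[OF NN.P.prob_space_distr[OF YZ]]])
  finally have law: "distr N ?S ?g =
      distr Om ?S ?h" .
  let ?ev = "\<lambda>w. \<forall>p\<in>F. missed (\<lambda>k. \<gamma> k (fst (snd w))) (\<lambda>k. \<alpha> k (snd (snd w))) (cowan_jumps (\<lambda>k. \<tau> k (fst w)) (fst p)) (snd p)"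
  have m1: "?g \<in> measurable N ?S" using X Y Z by (intro measurable_Pair)
  have m2: "?h \<in> measurable Om ?S" using X YZ by measurable
  have inK: "(?X x, (?Y y, ?Z z)) \<in> K \<longleftrightarrow> ?ev (x, (y, z))" if "x \<in> space N" "y \<in> space N" "z \<in> space N" for x y z
  proof -
    have "(?X x, (?Y y, ?Z z)) \<in> space ?S"
      using measurable_space[OF X that(1)] measurable_space[OF Y that(2)] measurable_space[OF Z that(3)]
      by (simp add: space_pair_measure)
    moreover have "missed (?Y y) (?Z z) (?X x (fst p)) (snd p) \<longleftrightarrow>
        missed (\<lambda>k. \<gamma> k y) (\<lambda>k. \<alpha> k z) (cowan_jumps (\<lambda>k. \<tau> k x) (fst p)) (snd p)" if "p \<in> F" for p
    proof -
      have "?X x (fst p) = cowan_jumps (\<lambda>k. \<tau> k x) (fst p)" using F_nonneg[OF that] by simp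
      then show ?thesis by (simp only:) (rule missed_cong; simp)
    qed
    ultimately show ?thesis unfolding K_def by simp
  qed
  have "{\<omega> \<in> space N. \<forall>p\<in>F. mecke_continuous W (\<lambda>j. \<gamma> j \<omega>) (\<lambda>j. \<alpha> j \<omega>) (\<lambda>k. \<tau> k \<omega>) (fst p) \<inter> snd p = {}} =
      ?g -` K \<inter> space N"
    using inK by (auto simp: mecke_continuous_def mecke_discrete_misses_iff open_F)
  then have "emeasure N {\<omega> \<in> space N. \<forall>p\<in>F. mecke_continuous W (\<lambda>j. \<gamma> j \<omega>) (\<lambda>j. \<alpha> j \<omega>) (\<lambda>k. \<tau> k \<omega>) (fst p) \<inter> snd p = {}} =
      emeasure (distr N ?S ?g) K"
    using m1 K by (simp add: emeasure_distr)
  also have "\<dots> = emeasure Om (?h -` K \<inter> space Om)"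
    unfolding law by (rule emeasure_distr[OF m2 K])
  \<comment> \<open>Outside the null set of \<open>AE_clock\<close> the two events agree by
    \<open>missed_iff_avoided\<close>.\<close>
  also have "\<dots> = emeasure Om {w \<in> space Om. \<forall>n. on_Om (mavoided n) w = 1}"
  proof (rule emeasure_eq_AE)
    have "AE w in Om. (\<forall>k\<ge>1. 0 \<le> \<tau> k (fst w)) \<and> (\<exists>n. T \<le> clock (\<lambda>k. \<tau> k (fst w)) n)"
    proof -
      have "AE x in distr Om N fst. (\<forall>k\<ge>1. 0 \<le> \<tau> k x) \<and> (\<exists>n. T \<le> clock (\<lambda>k. \<tau> k x) n)"
        unfolding NN.P.distr_pair_fst by (rule AE_clock)
      then show ?thesis by (rule AE_distrD[OF measurable_fst])
    qed
    then show "AE w in Om. w \<in> ?h -` K \<inter> space Om \<longleftrightarrow>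
        w \<in> {w \<in> space Om. \<forall>n. on_Om (mavoided n) w = 1}"
      using AE_space
    proof eventually_elim
      case (elim w)
      obtain x y z where w: "w = (x, (y, z))" by (metis prod_cases3)
      have sp: "x \<in> space N" "y \<in> space N" "z \<in> space N" using elim(2) by (auto simp: w space_pair_measure)
      obtain n0 where n0: "T \<le> clock (\<lambda>k. \<tau> k x) n0" using elim(1) by (auto simp: w)
      have nn: "\<And>k. k \<ge> 1 \<Longrightarrow> 0 \<le> \<tau> k x" using elim(1) by (simp add: w)
      have "?ev w \<longleftrightarrow> (\<forall>n. on_Om (mavoided n) w = 1)"
        unfolding on_Om_def w fst_conv snd_conv by (rule missed_iff_avoided[OF nn n0])
      then show ?case using inK[OF sp] elim(2) by (simp add: w)
    qed
  qed (use m2 K in \<open>auto intro!: measurable_sets\<close>)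
  also have "\<dots> = surv W 0" by (rule all_avoided)
  finally show ?thesis .
qed

end

section \<open>Equality of the laws\<close>

lemma space_closed_set_space: "space closed_set_space = {F. closed F}"
  unfolding closed_set_space_def by (rule space_measure_of) auto

lemma sets_closed_set_space:
  "sets closed_set_space = sigma_sets {F. closed F} {{F. closed F \<and> F \<inter> K \<noteq> {}} |K. compact K}"
  unfolding closed_set_space_def by (rule sets_measure_of) auto

text \<open>Disjoint closed and compact sets have positive distance, so a small open neighbourhood
  of \<open>K\<close> is missed as well. Hitting compact sets is thereby expressed by open
  sets.\<close>

lemma closed_meets_compact_iff:
  fixes K :: "'a :: heine_borel set"
  assumes "compact K" "closed F"
  shows "F \<inter> K \<noteq> {} \<longleftrightarrow> (\<forall>n::nat. F \<inter> (\<Union>x\<in>K. ball x (1 / Suc n)) \<noteq> {})"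
proof
  assume "F \<inter> K \<noteq> {}"
  then obtain x where "x \<in> F" "x \<in> K" by auto
  moreover have "x \<in> ball x (1 / Suc n)" for n :: nat by simp
  ultimately have "x \<in> F \<inter> (\<Union>x\<in>K. ball x (1 / Suc n))" for n :: nat by blast
  then show "\<forall>n::nat. F \<inter> (\<Union>x\<in>K. ball x (1 / Suc n)) \<noteq> {}" by blast
next
  assume all: "\<forall>n::nat. F \<inter> (\<Union>x\<in>K. ball x (1 / Suc n)) \<noteq> {}"
  show "F \<inter> K \<noteq> {}"
  proof
    assume "F \<inter> K = {}"
    then obtain d where d: "d > 0" "\<forall>x\<in>K. \<forall>y\<in>F. d \<le> dist x y"
      using separate_compact_closed[OF assms] by (auto simp: inf_commute)
    obtain n :: nat where n: "1 / Suc n < d"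
      using reals_Archimedean[OF d(1)] by (auto simp: inverse_eq_divide)
    obtain x y where "x \<in> K" "y \<in> F" "dist x y < 1 / Suc n" using all by (fastforce simp: disjoint_iff)
    then show False using d n by force
  qed
qed

lemma measurable_closed_set_spaceI:
  assumes closed: "\<And>x. x \<in> space M \<Longrightarrow> closed (f x)"
    and misses: "\<And>U. open U \<Longrightarrow> Measurable.pred M (\<lambda>x. f x \<inter> U = {})"
  shows "f \<in> measurable M closed_set_space"
proof (rule measurable_sigma_sets[OF sets_closed_set_space])
  fix A assume "A \<in> {{F :: (real^2) set. closed F \<and> F \<inter> K \<noteq> {}} |K. compact K}"
  then obtain K where K: "compact K" "A = {F. closed F \<and> F \<inter> K \<noteq> {}}" by auto
  define V where "V n = (\<Union>x\<in>K. ball x (1 / real (Suc n)))" for n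
  have "open (V n)" for n unfolding V_def by (intro open_UN ballI open_ball)
  then have [measurable]: "Measurable.pred M (\<lambda>x. f x \<inter> V n = {})" for n by (rule misses)
  have "f -` A \<inter> space M = {x \<in> space M. f x \<inter> K \<noteq> {}}" using closed K(2) by auto
  also have "\<dots> = {x \<in> space M. \<forall>n. \<not> f x \<inter> V n = {}}"
    unfolding V_def using closed closed_meets_compact_iff[OF K(1)] by (intro Collect_cong conj_cong refl) simp
  also have "\<dots> \<in> sets M" by measurable
  finally show "f -` A \<inter> space M \<in> sets M" .
qed (use closed in auto)

text \<open>The opposite passage: an open set is a countable union of compact sets, and missing it
  is missing all of these.\<close>

lemma closed_set_misses_measurable:
  assumes "open U"
  shows "Measurable.pred closed_set_space (\<lambda>F. F \<inter> U = {})"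
proof -
  obtain C where C: "\<And>n::nat. compact (C n)" "\<Union>(range C) = U"
    using open_Union_compact_subsets[OF assms] by metis
  have "{F \<in> space closed_set_space. F \<inter> C n \<noteq> {}} \<in> sets closed_set_space" for n
    unfolding sets_closed_set_space space_closed_set_space using C(1) by (intro sigma_sets.Basic) auto
  then have "Measurable.pred closed_set_space (\<lambda>F. F \<inter> C n \<noteq> {})" for n by (simp add: pred_def)
  then have "Measurable.pred closed_set_space (\<lambda>F. \<forall>n. \<not> F \<inter> C n \<noteq> {})" by measurable
  moreover have "(\<lambda>F. \<forall>n. \<not> F \<inter> C n \<noteq> {}) = (\<lambda>F. F \<inter> U = {})"
    unfolding C(2)[symmetric] by (intro ext) blast
  ultimately show ?thesis by simp
qed

section \<open>Laws of processes of closed sets\<close>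

abbreviation path_space :: "(real \<Rightarrow> (real^2) set) measure" where
  "path_space \<equiv> Pi\<^sub>M {0..} (\<lambda>_. closed_set_space)"

text \<open>Several open sets may be prescribed at one time; so the family is stable under
  intersection, by taking the union of the index sets.\<close>

definition void_events :: "(real \<Rightarrow> (real^2) set) set set" where
  "void_events = {{f \<in> space path_space. \<forall>p\<in>F. f (fst p) \<inter> snd p = {}} | F.
     finite F \<and> (\<forall>p\<in>F. 0 \<le> fst p \<and> open (snd p))}"

lemma sets_path_space: "sets path_space = sigma_sets (space path_space) void_events"
proof (rule sets_eq_sigma_of_measurable_ident[OF refl])
  show sub: "void_events \<subseteq> sets path_space"
  proof
    fix A assume "A \<in> void_events"
    then obtain F where F: "finite F" "\<And>p. p \<in> F \<Longrightarrow> 0 \<le> fst p \<and> open (snd p)"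
      and A: "A = {f \<in> space path_space. \<forall>p\<in>F. f (fst p) \<inter> snd p = {}}"
      unfolding void_events_def by auto
    have "Measurable.pred path_space (\<lambda>f. f (fst p) \<inter> snd p = {})" if "p \<in> F" for p
      using F(2)[OF that] measurable_compose[OF measurable_component_singleton[of "fst p" "{0..}" "\<lambda>_. closed_set_space"]
        closed_set_misses_measurable[of "snd p"]] by simp
    then have "Measurable.pred path_space (\<lambda>f. \<forall>p\<in>F. f (fst p) \<inter> snd p = {})"
      by (intro pred_intros_finite F(1))
    then show "A \<in> sets path_space" unfolding A by (simp add: pred_def)
  qed
  show Pow: "void_events \<subseteq> Pow (space path_space)" unfolding void_events_def by auto
  define S where "S = sigma (space path_space) void_events"
  have spS: "space S = space path_space" using Pow by (simp add: S_def space_measure_of)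
  have "(\<lambda>f. f) \<in> measurable S path_space"
  proof (rule measurable_PiM_single')
    fix t :: real assume t: "t \<in> {0..}"
    show "(\<lambda>f. f t) \<in> measurable S closed_set_space"
    proof (rule measurable_closed_set_spaceI)
      fix f assume "f \<in> space S"
      then show "closed (f t)" using t by (auto simp: spS space_PiM space_closed_set_space PiE_iff)
    next
      fix U :: "(real^2) set" assume "open U"
      then have "{f \<in> space path_space. \<forall>p\<in>{(t, U)}. f (fst p) \<inter> snd p = {}} \<in> void_events"
        unfolding void_events_def using t by (intro CollectI exI[of _ "{(t, U)}"]) auto
      then have "{f \<in> space S. f t \<inter> U = {}} \<in> sets S"
        unfolding spS using Pow by (simp add: S_def sets_measure_of sigma_sets.Basic)
      then show "Measurable.pred S (\<lambda>f. f t \<inter> U = {})" by (simp add: pred_def)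
    qed
  qed (auto simp: spS space_PiM)
  then show "(\<lambda>f. f) \<in> measurable (sigma (space path_space) void_events) path_space" by (simp only: S_def)
qed

text \<open>The void events generate the \<sigma>-algebra of paths and are stable under
  intersection, so the \<pi>-\<lambda> theorem applies; \<open>F = {}\<close> gives the whole
  space.\<close>

lemma path_law_eqI:
  assumes M: "prob_space M" "X \<in> measurable M path_space" and N: "prob_space N" "Y \<in> measurable N path_space"
    and eq: "\<And>F. finite F \<Longrightarrow> (\<And>p. p \<in> F \<Longrightarrow> 0 \<le> fst p) \<Longrightarrow> (\<And>p. p \<in> F \<Longrightarrow> open (snd p)) \<Longrightarrow>
      emeasure M {\<omega> \<in> space M. \<forall>p\<in>F. X \<omega> (fst p) \<inter> snd p = {}} =
      emeasure N {\<omega> \<in> space N. \<forall>p\<in>F. Y \<omega> (fst p) \<inter> snd p = {}}"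
  shows "distr M path_space X = distr N path_space Y"
proof (rule measure_eqI_generator_eq[where E = void_events and \<Omega> = "space path_space" and A = "\<lambda>_. space path_space"])
  interpret M: prob_space M by (rule M(1))
  show "Int_stable void_events"
  proof (rule Int_stableI)
    fix A B assume "A \<in> void_events" "B \<in> void_events"
    then obtain F F' where "finite F" "\<forall>p\<in>F. 0 \<le> fst p \<and> open (snd p)" "finite F'" "\<forall>p\<in>F'. 0 \<le> fst p \<and> open (snd p)"
      and AB: "A = {f \<in> space path_space. \<forall>p\<in>F. f (fst p) \<inter> snd p = {}}"
        "B = {f \<in> space path_space. \<forall>p\<in>F'. f (fst p) \<inter> snd p = {}}"
      unfolding void_events_def by auto
    moreover have "A \<inter> B = {f \<in> space path_space. \<forall>p\<in>F \<union> F'. f (fst p) \<inter> snd p = {}}"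
      unfolding AB by blast
    ultimately show "A \<inter> B \<in> void_events"
      unfolding void_events_def by (intro CollectI exI[of _ "F \<union> F'"]) auto
  qed
  show "void_events \<subseteq> Pow (space path_space)" unfolding void_events_def by auto
  show "sets (distr M path_space X) = sigma_sets (space path_space) void_events"
    "sets (distr N path_space Y) = sigma_sets (space path_space) void_events"
    using sets_path_space by simp_all
  show "range (\<lambda>_. space path_space) \<subseteq> void_events"
    unfolding void_events_def by (auto intro!: exI[of _ "{}"])
  show "emeasure (distr M path_space X) (space path_space) \<noteq> \<infinity>"
    using prob_space.emeasure_space_1[OF M.prob_space_distr[OF M(2)]] by simp
  fix A assume A: "A \<in> void_events"
  then obtain F where F: "finite F" "\<And>p. p \<in> F \<Longrightarrow> 0 \<le> fst p" "\<And>p. p \<in> F \<Longrightarrow> open (snd p)"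
    and AF: "A = {f \<in> space path_space. \<forall>p\<in>F. f (fst p) \<inter> snd p = {}}"
    unfolding void_events_def by auto
  have As: "A \<in> sets path_space" using A sets_path_space by (auto intro: sigma_sets.Basic)
  have "X -` A \<inter> space M = {\<omega> \<in> space M. \<forall>p\<in>F. X \<omega> (fst p) \<inter> snd p = {}}"
    "Y -` A \<inter> space N = {\<omega> \<in> space N. \<forall>p\<in>F. Y \<omega> (fst p) \<inter> snd p = {}}"
    using measurable_space[OF M(2)] measurable_space[OF N(2)] unfolding AF by auto
  then show "emeasure (distr M path_space X) A = emeasure (distr N path_space Y) A"
    using eq[OF F] As by (simp add: emeasure_distr M(2) N(2))
qed auto

text \<open>A cell is \<open>W\<close> intersected with an open set, hence a countable union of
  compact sets.\<close>

lemma hitting_cell_measurable: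
  assumes "compact W" "C \<in> cells W"
  shows "hitting C \<in> sets line_space"
proof -
  obtain V where V: "open V" "C = W \<inter> V" using assms(2) by (auto simp: cells_def openin_open)
  obtain K where K: "\<And>n::nat. compact (K n)" "\<Union>(range K) = V"
    using open_Union_compact_subsets[OF V(1)] by metis
  have "hitting C = (\<Union>n. hitting (W \<inter> K n))"
    unfolding V(2) K(2)[symmetric] hitting_def by blast
  also have "\<dots> \<in> sets line_space"
    using hitting_compact_measurable[OF compact_Int[OF assms(1) K(1)]] by (intro sets.countable_UN) auto
  finally show ?thesis .
qed

text \<open>A line missing \<open>C\<close> leaves it inside the union of the two sides; one meeting
  \<open>C\<close> without cutting it would contain an extreme point. Conversely \<open>C\<close> is
  connected, so a line with parts of \<open>C\<close> on both sides meets it.\<close>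

lemma cuts_cases:
  assumes W: "compact W" "convex W" and C: "C \<in> cells W" and g: "g \<in> lines" "0 \<notin> g"
    and ext: "\<And>v. v extreme_point_of W \<Longrightarrow> v \<notin> g"
  shows "cuts C g \<or> C \<inter> plus_side g = {} \<and> C \<inter> minus_side g = C \<or> C \<inter> minus_side g = {} \<and> C \<inter> plus_side g = C"
    and "g \<in> hitting C \<longleftrightarrow> cuts C g"
proof -
  have un: "plus_side g \<union> minus_side g = - g" using plus_side_facts(8)[OF g] .
  have hit: "cuts C g" if "g \<inter> C \<noteq> {}"
    using touching_contains_extreme_point[OF W _ g that] C ext by (auto simp: cuts_def cells_def)
  show "cuts C g \<or> C \<inter> plus_side g = {} \<and> C \<inter> minus_side g = C \<or> C \<inter> minus_side g = {} \<and> C \<inter> plus_side g = C"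
  proof (cases "g \<inter> C = {}")
    case True
    then have "C \<subseteq> plus_side g \<union> minus_side g" using un by blast
    then show ?thesis unfolding cuts_def by blast
  qed (use hit in auto)
  show "g \<in> hitting C \<longleftrightarrow> cuts C g"
  proof
    assume c: "cuts C g"
    show "g \<in> hitting C"
    proof (rule ccontr)
      assume "g \<notin> hitting C"
      then have "C \<subseteq> plus_side g \<union> minus_side g" using un g by (auto simp: hitting_def)
      moreover have "connected C" using C by (auto simp: cells_def convex_connected)
      ultimately show False
        using c connectedD[of C "plus_side g" "minus_side g"] plus_side_facts[OF g(1)]
        by (auto simp: cuts_def)
    qed
  qed (use hit in \<open>auto simp: hitting_def\<close>)
qed

text \<open>A polytope has finitely many extreme points, and the lines through one of them or
  through the origin form a null set.\<close>

lemma AE_cuts_cases: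
  assumes W: "polytope W" and sets: "sets \<Lambda> = sets line_space" and lf: "locally_finite_lines \<Lambda>"
    and ti: "translation_invariant_lines \<Lambda>" and C: "C \<in> cells W"
  shows "AE g in \<Lambda>. (cuts C g \<or> C \<inter> plus_side g = {} \<and> C \<inter> minus_side g = C \<or>
      C \<inter> minus_side g = {} \<and> C \<inter> plus_side g = C) \<and> (g \<in> hitting C \<longleftrightarrow> cuts C g)"
proof -
  have cc: "compact W" "convex W" using W by (auto intro: polytope_imp_compact polytope_imp_convex)
  have sp: "space \<Lambda> = lines" using sets_eq_imp_space_eq[OF sets] by (simp add: space_line_space)
  have "finite {v. v extreme_point_of W}"
    using W by (intro finite_polyhedron_extreme_points polytope_imp_polyhedron)
  then have "AE g in \<Lambda>. \<forall>v\<in>{v. v extreme_point_of W}. v \<notin> g"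
    by (intro AE_finite_allI null_lines_through_point[OF sets lf ti])
  then show ?thesis
    using null_lines_through_point[OF sets lf ti, of 0] AE_space
  proof eventually_elim
    case (elim g)
    then show ?case using cuts_cases[OF cc C, of g] sp by auto
  qed
qed

text \<open>Rate 0 yields the zero density, whose measure is not a probability. This is how both
  kinds of data force positive rates.\<close>

lemma exponential_density_0: "exponential_density 0 = (\<lambda>_. 0)"
  by (simp add: exponential_density_def fun_eq_iff)

section \<open>Rates and laws in terms of \<Lambda>\<close>

locale line_measure =
  fixes W :: "(real^2) set" and \<Lambda> :: "(real^2) set measure"
  assumes polytope_W: "polytope W" and sets_\<Lambda>: "sets \<Lambda> = sets line_space"
    and loc_fin: "locally_finite_lines \<Lambda>" and transl_inv: "translation_invariant_lines \<Lambda>"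
    and hitting_pos: "0 < measure \<Lambda> (hitting W)"
begin

abbreviation Q :: "(real^2) set measure" where "Q \<equiv> uniform_measure \<Lambda> (hitting W)"
abbreviation rate :: real where "rate \<equiv> measure \<Lambda> (hitting W)"

lemma compact_W: "compact W" and convex_W: "convex W"
  using polytope_W by (auto intro: polytope_imp_compact polytope_imp_convex)

lemma emeasure_hitting_W: "emeasure \<Lambda> (hitting W) = ennreal rate"
  using loc_fin compact_W by (intro emeasure_eq_ennreal_measure) (auto simp: locally_finite_lines_def)

lemma emeasure_hitting_W_bounds: "emeasure \<Lambda> (hitting W) \<noteq> 0" "emeasure \<Lambda> (hitting W) < \<infinity>"
  using hitting_pos by (simp_all add: emeasure_hitting_W)

lemma hitting_sets: "C \<in> cells W \<Longrightarrow> hitting C \<in> sets \<Lambda>"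
  using hitting_cell_measurable[OF compact_W] by (simp add: sets_\<Lambda>)

lemma hitting_mono: "C \<in> cells W \<Longrightarrow> hitting C \<subseteq> hitting W"
  using cells_subset by (auto simp: hitting_def)

lemma W_cell: "W \<in> cells W"
  by (rule cells_top[OF convex_W])

lemma prob_Q: "prob_space Q"
  using emeasure_hitting_W_bounds by (intro prob_space_uniform_measure) auto

lemma sets_Q: "sets Q = sets line_space"
  by (simp add: sets_\<Lambda>)

lemma space_\<Lambda>: "space \<Lambda> = lines"
  using sets_eq_imp_space_eq[OF sets_\<Lambda>] by (simp add: space_line_space)

lemma AE_Q:
  assumes "AE g in \<Lambda>. P g" shows "AE g in Q. P g"
proof (rule AE_uniform_measureI[OF hitting_sets[OF W_cell]])
  show "AE g in \<Lambda>. g \<in> hitting W \<longrightarrow> P g" using assms by eventually_elim (rule impI)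
qed

lemma splitting:
  assumes "finite F" "\<And>p. p \<in> F \<Longrightarrow> open (snd p)" "\<And>p. p \<in> F \<Longrightarrow> fst p < T"
  shows "splitting W Q rate F T"
proof (rule splitting.intro)
  fix C assume C: "C \<in> cells W"
  have "AE g in \<Lambda>. cuts C g \<or> C \<inter> plus_side g = {} \<and> C \<inter> minus_side g = C \<or> C \<inter> minus_side g = {} \<and> C \<inter> plus_side g = C"
    using AE_cuts_cases[OF polytope_W sets_\<Lambda> loc_fin transl_inv C] by eventually_elim auto
  then show "AE g in Q. cuts C g \<or> C \<inter> plus_side g = {} \<and> C \<inter> minus_side g = C \<or> C \<inter> minus_side g = {} \<and> C \<inter> plus_side g = C"
    by (rule AE_Q)
qed (rule prob_Q sets_Q convex_W hitting_pos assms; assumption?)+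

text \<open>Cutting and hitting agree almost everywhere, and
  \<open>hitting C \<subseteq> hitting W\<close>; so \<open>rate * Q\<close> on the lines cutting
  \<open>C\<close> is \<Lambda> on the lines hitting it.\<close>

lemma emeasure_Q_cuts:
  assumes C: "C \<in> cells W" and B: "B \<in> sets line_space"
  shows "ennreal rate * (\<integral>\<^sup>+g. of_bool (cuts C g) * indicator B g \<partial>Q) = emeasure \<Lambda> (hitting C \<inter> B)"
proof -
  interpret S: splitting W Q rate "{}" 0 by (rule splitting) auto
  have B': "B \<in> sets \<Lambda>" using B by (simp add: sets_\<Lambda>)
  have "(\<integral>\<^sup>+g. of_bool (cuts C g) * indicator B g \<partial>Q) = (\<integral>\<^sup>+g. indicator (hitting C \<inter> B) g \<partial>Q)"
  proof (rule nn_integral_cong_AE)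
    have "AE g in \<Lambda>. g \<in> hitting C \<longleftrightarrow> cuts C g"
      using AE_cuts_cases[OF polytope_W sets_\<Lambda> loc_fin transl_inv C] by eventually_elim auto
    then have "AE g in Q. g \<in> hitting C \<longleftrightarrow> cuts C g" by (rule AE_Q)
    then show "AE g in Q. of_bool (cuts C g) * indicator B g = (indicator (hitting C \<inter> B) g :: ennreal)"
      by eventually_elim (simp add: indicator_def)
  qed
  also have "\<dots> = emeasure Q (hitting C \<inter> B)"
    using hitting_sets[OF C] B' by simp
  also have "\<dots> = emeasure \<Lambda> (hitting W \<inter> (hitting C \<inter> B)) / emeasure \<Lambda> (hitting W)"
    using hitting_sets[OF C] hitting_sets[OF W_cell] B' by (intro emeasure_uniform_measure) auto
  also have "hitting W \<inter> (hitting C \<inter> B) = hitting C \<inter> B" using hitting_mono[OF C] by blast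
  finally have "(\<integral>\<^sup>+g. of_bool (cuts C g) * indicator B g \<partial>Q) = emeasure \<Lambda> (hitting C \<inter> B) / ennreal rate"
    by (simp add: emeasure_hitting_W)
  then show ?thesis
    using hitting_pos by (simp only: ennreal_times_divide mult.commute[of "ennreal rate"])
      (rule mult_divide_eq_ennreal; simp)
qed

lemma split_rate_hitting:
  assumes C: "C \<in> cells W"
  shows "splitting.split_rate Q rate C = measure \<Lambda> (hitting C)"
proof -
  interpret S: splitting W Q rate "{}" 0 by (rule splitting) auto
  have "ennreal (S.split_rate C) = ennreal rate * (\<integral>\<^sup>+g. of_bool (cuts C g) * indicator lines g \<partial>Q)"
    unfolding S.split_rate_eq[OF C]
    by (intro arg_cong2[where f = times] nn_integral_cong refl) (auto simp: space_\<Lambda>)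
  also have "\<dots> = emeasure \<Lambda> (hitting C \<inter> lines)"
    using sets.top[of line_space] by (intro emeasure_Q_cuts C) (simp add: space_line_space)
  also have "hitting C \<inter> lines = hitting C" by (auto simp: hitting_def)
  finally have "measure \<Lambda> (hitting C) = enn2real (ennreal (S.split_rate C))" by (simp add: measure_def)
  then show ?thesis using S.split_rate_nonneg[of C] by simp
qed

text \<open>The left side is \<open>J * b\<close>, where \<open>J\<close> integrates the exponential
  tail over \<open>I\<close> and \<open>b\<close> is the \<Lambda>-measure of the lines of
  \<open>B\<close> hitting \<open>C\<close>. On the right side the factor \<open>a\<close> of the
  exponential density cancels the normalisation of the law of the line.\<close>

lemma split_law_rect:
  assumes C: "C \<in> cells W" and I: "I \<in> sets borel" and B: "B \<in> sets line_space"
  shows "(\<integral>\<^sup>+p\<in>I \<times> B. ennreal rate * decay (splitting.split_rate Q rate C) 0 (fst p) * indicator {0..} (fst p) *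
      of_bool (cuts C (snd p)) \<partial>(lborel \<Otimes>\<^sub>M Q)) =
    ennreal (measure (density lborel (exponential_density (measure \<Lambda> (hitting C)))) I *
      measure (uniform_measure \<Lambda> (hitting C)) B)"
proof -
  interpret S: splitting W Q rate "{}" 0 by (rule splitting) auto
  interpret Q: prob_space Q by (rule prob_Q)
  note [measurable] = S.const_cell[OF C] I
  have [measurable]: "B \<in> sets Q" using B by (simp add: sets_\<Lambda>)
  define a where "a = measure \<Lambda> (hitting C)"
  define b where "b = emeasure \<Lambda> (hitting C \<inter> B)"
  define J where "J = (\<integral>\<^sup>+l. decay a 0 l * indicator {0..} l * indicator I l \<partial>lborel)"
  have a0: "a \<ge> 0" by (simp add: a_def)
  have H: "hitting C \<in> sets \<Lambda>" by (rule hitting_sets[OF C])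
  have eH: "emeasure \<Lambda> (hitting C) = ennreal a"
  proof -
    have "emeasure \<Lambda> (hitting C) \<le> emeasure \<Lambda> (hitting W)"
      using hitting_mono[OF C] hitting_sets[OF W_cell] by (rule emeasure_mono)
    then have "emeasure \<Lambda> (hitting C) \<noteq> \<infinity>" using emeasure_hitting_W_bounds(2) by (auto simp: top_unique)
    then show ?thesis unfolding a_def by (intro emeasure_eq_ennreal_measure) simp
  qed
  have "(\<integral>\<^sup>+p\<in>I \<times> B. ennreal rate * decay (S.split_rate C) 0 (fst p) * indicator {0..} (fst p) *
      of_bool (cuts C (snd p)) \<partial>(lborel \<Otimes>\<^sub>M Q)) =
      (\<integral>\<^sup>+l. \<integral>\<^sup>+g. (ennreal rate * (decay a 0 l * indicator {0..} l * indicator I l)) * (of_bool (cuts C g) * indicator B g) \<partial>Q \<partial>lborel)"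
    unfolding split_rate_hitting[OF C] a_def[symmetric]
    by (subst Q.nn_integral_fst[symmetric]) (simp_all add: indicator_times mult_ac)
  also have "\<dots> = (\<integral>\<^sup>+l. decay a 0 l * indicator {0..} l * indicator I l * b \<partial>lborel)"
    unfolding b_def emeasure_Q_cuts[OF C B, symmetric]
    by (subst nn_integral_cmult) (simp_all add: mult_ac)
  also have "\<dots> = J * b"
    unfolding J_def by (rule nn_integral_multc) measurable
  also have "\<dots> = ennreal (measure (density lborel (exponential_density a)) I * measure (uniform_measure \<Lambda> (hitting C)) B)"
  proof (cases "a = 0")
    \<comment> \<open>Here \<open>b\<close> is 0 as the measure of a part of a null set, and the
      exponential density vanishes.\<close>
    case True
    have "b \<le> emeasure \<Lambda> (hitting C)" unfolding b_def using H by (intro emeasure_mono) auto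
    then have "b = 0" using True eH by simp
    moreover have "measure (density lborel (exponential_density a)) I = 0"
      using True by (simp add: measure_def emeasure_density exponential_density_0)
    ultimately show ?thesis by simp
  next
    case False
    then have a: "a > 0" using a0 by simp
    interpret E: prob_space "density lborel (exponential_density a)" by (rule prob_space_exponential_density[OF a])
    interpret U: prob_space "uniform_measure \<Lambda> (hitting C)"
      using a eH by (intro prob_space_uniform_measure) auto
    have "ennreal (exponential_density a l) = ennreal a * (decay a 0 l * indicator {0..} l)" for l
      using a0 by (simp add: exponential_density_def decay_def indicator_def ennreal_mult'[symmetric] mult.commute)
    then have "emeasure (density lborel (exponential_density a)) I = (\<integral>\<^sup>+l. ennreal a * (decay a 0 l * indicator {0..} l * indicator I l) \<partial>lborel)"
      by (simp add: emeasure_density mult.assoc)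
    also have "\<dots> = ennreal a * J" unfolding J_def by (rule nn_integral_cmult) measurable
    finally have 1: "ennreal (measure (density lborel (exponential_density a)) I) = ennreal a * J"
      by (simp add: E.emeasure_eq_measure)
    have 2: "ennreal (measure (uniform_measure \<Lambda> (hitting C)) B) = b / ennreal a"
      unfolding b_def using H B by (simp add: U.emeasure_eq_measure[symmetric] eH sets_\<Lambda>)
    have "ennreal (measure (density lborel (exponential_density a)) I * measure (uniform_measure \<Lambda> (hitting C)) B) =
        (ennreal a * J) * (b / ennreal a)"
      by (simp add: ennreal_mult 1 2)
    also have "\<dots> = (J * b) * ennreal a / ennreal a"
      by (simp add: ennreal_times_divide mult_ac)
    also have "\<dots> = J * b" using a by (intro mult_divide_eq_ennreal) auto
    finally show ?thesis by simp
  qed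
  finally show ?thesis unfolding a_def .
qed

lemma stit_cell_in_cells: "(\<And>u. g u \<in> lines) \<Longrightarrow> stit_cell W g w \<in> cells W"
  by (induction w) (auto simp: W_cell cells_plus_side cells_minus_side)

text \<open>Integrating the conditional expectation of \<open>stit_data\<close> over an event
  \<open>A\<close> of the history gives \<open>law\<close>, where \<open>split_law_rect\<close>
  turns each factor into an integral of the density.\<close>

lemma stit_run:
  fixes M :: "'a measure"
  assumes data: "stit_data \<Lambda> W M L G"
    and F: "finite F" "\<And>p. p \<in> F \<Longrightarrow> open (snd p)" "\<And>p. p \<in> F \<Longrightarrow> fst p < T"
  shows "stit_run W Q rate F T M L G"
proof -
  interpret S: splitting W Q rate F T by (rule splitting[OF F])
  have prob_M: "prob_space M" and L [measurable]: "\<And>w. L w \<in> borel_measurable M"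
    and G [measurable]: "\<And>w. G w \<in> measurable M line_space"
    using data by (auto simp: stit_data_def)
  interpret M: prob_space M by (rule prob_M)
  let ?C = "\<lambda>w \<omega>. stit_cell W (\<lambda>u. G u \<omega>) w"
  let ?q = "\<lambda>w \<omega> I B. measure (density lborel (exponential_density (measure \<Lambda> (hitting (?C w \<omega>))))) I *
      measure (uniform_measure \<Lambda> (hitting (?C w \<omega>))) B"
  have cell: "?C w \<omega> \<in> cells W" if "\<omega> \<in> space M" for w \<omega>
    using measurable_space[OF G that] by (intro stit_cell_in_cells) (simp add: space_line_space)
  have cond: "AE \<omega> in M. real_cond_exp M (stit_history M L G n)
       (indicator {\<omega> \<in> space M. \<forall>w. length w = n \<longrightarrow> L w \<omega> \<in> I w \<and> G w \<omega> \<in> B w}) \<omega> =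
       (\<Prod>w\<in>level n. ?q w \<omega> (I w) (B w))"
    if "\<And>w. length w = n \<Longrightarrow> I w \<in> sets borel" "\<And>w. length w = n \<Longrightarrow> B w \<in> sets line_space" for n I B
    using data that unfolding stit_data_def Let_def by blast
  have sub: "subalgebra M (stit_history M L G n)" for n
    by (rule subalgebra_stit_history[OF L G])
  have sf: "sigma_finite_subalgebra M (stit_history M L G n)" for n
    using sub by (intro finite_measure_subalgebra_is_sigma_finite finite_measure_subalgebra.intro
      finite_measure_subalgebra_axioms.intro M.finite_measure_axioms)
  show ?thesis
  proof (intro stit_run.intro stit_run_axioms.intro S.splitting_axioms prob_M L G)
    fix n :: nat and I :: "bool list \<Rightarrow> real set" and B :: "bool list \<Rightarrow> (real^2) set set" and A
    assume I: "\<And>w. length w = n \<Longrightarrow> I w \<in> sets borel" and B: "\<And>w. length w = n \<Longrightarrow> B w \<in> sets line_space"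
      and A: "A \<in> sets (stit_history M L G n)"
    let ?X = "{\<omega> \<in> space M. \<forall>w. length w = n \<longrightarrow> L w \<omega> \<in> I w \<and> G w \<omega> \<in> B w}"
    let ?S = "\<lambda>\<omega>. \<Prod>w\<in>level n. \<integral>\<^sup>+p\<in>I w \<times> B w.
           ennreal rate * decay (S.split_rate (?C w \<omega>)) 0 (fst p) * indicator {0..} (fst p) *
             of_bool (cuts (?C w \<omega>) (snd p)) \<partial>(lborel \<Otimes>\<^sub>M Q)"
    interpret sigma_finite_subalgebra M "stit_history M L G n" by (rule sf)
    have X: "?X \<in> sets M"
    proof -
      have "{\<omega> \<in> space M. \<forall>w\<in>level n. L w \<omega> \<in> I w \<and> G w \<omega> \<in> B w} \<in> sets M"
      proof (rule sets.sets_Collect_finite_All[OF _ finite_level])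
        fix w assume "w \<in> level n"
        then have "L w -` I w \<inter> space M \<in> sets M" "G w -` B w \<inter> space M \<in> sets M"
          using measurable_sets[OF L I[of w]] measurable_sets[OF G B[of w]] by simp_all
        then have "(L w -` I w \<inter> space M) \<inter> (G w -` B w \<inter> space M) \<in> sets M" by (rule sets.Int)
        also have "(L w -` I w \<inter> space M) \<inter> (G w -` B w \<inter> space M) = {\<omega> \<in> space M. L w \<omega> \<in> I w \<and> G w \<omega> \<in> B w}" by blast
        finally show "{\<omega> \<in> space M. L w \<omega> \<in> I w \<and> G w \<omega> \<in> B w} \<in> sets M" .
      qed
      then show ?thesis unfolding Ball_def mem_Collect_eq .
    qed
    define X where "X = ?X"
    have XM: "X \<in> sets M" using X by (simp only: X_def)
    have AM: "A \<in> sets M" using A sub[of n] unfolding subalgebra_def by blast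
    have int: "integrable M (indicator X :: 'a \<Rightarrow> real)"
      using XM by (simp add: M.emeasure_eq_measure)
    let ?E = "real_cond_exp M (stit_history M L G n) (indicator X)"
    have condX: "AE \<omega> in M. ?E \<omega> = (\<Prod>w\<in>level n. ?q w \<omega> (I w) (B w))"
      unfolding X_def by (rule cond) (rule I B; assumption)+
    have pos: "AE \<omega> in M. 0 \<le> ?E \<omega>"
      using XM by (intro real_cond_exp_pos) simp_all
    have intE: "integrable M (\<lambda>\<omega>. ?E \<omega> * indicator A \<omega>)"
      using real_cond_exp_int(1)[OF int] AM by (rule integrable_real_mult_indicator[rotated])
    have "{\<omega> \<in> A. \<forall>w. length w = n \<longrightarrow> L w \<omega> \<in> I w \<and> G w \<omega> \<in> B w} = A \<inter> X"
      using sets.sets_into_space[OF AM] unfolding X_def by blast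
    then have "emeasure M {\<omega> \<in> A. \<forall>w. length w = n \<longrightarrow> L w \<omega> \<in> I w \<and> G w \<omega> \<in> B w} = emeasure M (A \<inter> X)"
      by (simp only:)
    also have "\<dots> = ennreal (\<integral>\<omega>\<in>A. indicator X \<omega> \<partial>M)"
      using XM AM by (simp add: set_lebesgue_integral_def indicator_inter_arith[symmetric] M.emeasure_eq_measure)
    also have "(\<integral>\<omega>\<in>A. indicator X \<omega> \<partial>M) = (\<integral>\<omega>\<in>A. ?E \<omega> \<partial>M)"
      by (rule real_cond_exp_intA[OF int A])
    also have "\<dots> = (\<integral>\<omega>. ?E \<omega> * indicator A \<omega> \<partial>M)"
      by (simp add: set_lebesgue_integral_def mult.commute)
    also have "ennreal \<dots> = (\<integral>\<^sup>+\<omega>. ennreal (?E \<omega> * indicator A \<omega>) \<partial>M)"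
      using pos by (intro nn_integral_eq_integral[symmetric] intE) (auto simp: indicator_def)
    also have "\<dots> = (\<integral>\<^sup>+\<omega>\<in>A. ?S \<omega> \<partial>M)"
    proof (rule nn_integral_cong_AE)
      show "AE \<omega> in M. ennreal (?E \<omega> * indicator A \<omega>) = ?S \<omega> * indicator A \<omega>"
        using condX AE_space
      proof eventually_elim
        case (elim \<omega>)
        have "ennreal (\<Prod>w\<in>level n. ?q w \<omega> (I w) (B w)) = (\<Prod>w\<in>level n. ennreal (?q w \<omega> (I w) (B w)))"
          by (rule prod_ennreal[symmetric]) simp
        also have "\<dots> = ?S \<omega>"
          by (intro prod.cong refl split_law_rect[symmetric] cell elim(2) I B) simp_all
        finally show ?case unfolding elim(1) by (simp add: ennreal_mult'' ennreal_indicator)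
      qed
    qed
    finally show "emeasure M {\<omega> \<in> A. \<forall>w. length w = n \<longrightarrow> L w \<omega> \<in> I w \<and> G w \<omega> \<in> B w} =
        (\<integral>\<^sup>+\<omega>\<in>A. ?S \<omega> \<partial>M)" .
  next
    fix w :: "bool list"
    let ?n = "length w"
    interpret sigma_finite_subalgebra M "stit_history M L G ?n" by (rule sf)
    \<comment> \<open>Without any restriction on this generation the conditional probability is 1,
      whereas a cell of rate 0 would contribute the factor 0.\<close>
    let ?X = "{\<omega> \<in> space M. \<forall>w. length w = ?n \<longrightarrow> L w \<omega> \<in> UNIV \<and> G w \<omega> \<in> lines}"
    have lines: "lines \<in> sets line_space" using sets.top[of line_space] by (simp add: space_line_space)
    have X: "?X = space M" using measurable_space[OF G] by (auto simp: space_line_space)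
    have "AE \<omega> in M. real_cond_exp M (stit_history M L G ?n) (indicator (space M)) \<omega> = indicator (space M) \<omega>"
    proof (rule real_cond_exp_F_meas)
      have "space M \<in> sets (stit_history M L G ?n)" using sets.top[of "stit_history M L G ?n"] by (simp add: stit_history_def)
      then show "(indicator (space M) :: 'a \<Rightarrow> real) \<in> borel_measurable (stit_history M L G ?n)" by simp
    qed (simp add: M.emeasure_eq_measure)
    moreover have "AE \<omega> in M. real_cond_exp M (stit_history M L G ?n) (indicator (space M)) \<omega> =
        (\<Prod>v\<in>level ?n. ?q v \<omega> UNIV lines)"
      using cond[of ?n "\<lambda>_. UNIV" "\<lambda>_. lines"] lines unfolding X by simp
    ultimately show "AE \<omega> in M. 0 < S.split_rate (?C w \<omega>)"
      using AE_space
    proof eventually_elim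
      case (elim \<omega>)
      then have "(\<Prod>v\<in>level ?n. ?q v \<omega> UNIV lines) \<noteq> 0" by simp
      then have "?q w \<omega> UNIV lines \<noteq> 0" by (subst (asm) prod_zero_iff) auto
      moreover have "?q w \<omega> UNIV lines = 0" if "measure \<Lambda> (hitting (?C w \<omega>)) = 0"
        unfolding that by (simp add: measure_def emeasure_density exponential_density_0)
      ultimately have "measure \<Lambda> (hitting (?C w \<omega>)) \<noteq> 0" by blast
      then have "0 < measure \<Lambda> (hitting (?C w \<omega>))" by (simp add: less_le)
      then show ?case using split_rate_hitting[OF cell[OF elim(3)]] by simp
    qed
  qed
qed

lemma mecke_run:
  fixes N :: "'b measure"
  assumes data: "mecke_data \<Lambda> W N \<gamma> \<alpha> \<tau>"
    and F: "finite F" "\<And>p. p \<in> F \<Longrightarrow> open (snd p)" "\<And>p. p \<in> F \<Longrightarrow> fst p < T" "\<And>p. p \<in> F \<Longrightarrow> 0 \<le> fst p"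
  shows "mecke_run W Q rate F T N \<gamma> \<alpha> \<tau>"
  using data F(4) splitting[OF F(1-3)] unfolding mecke_data_def
  by (intro mecke_run.intro mecke_run_axioms.intro) auto

end

text \<open>The first waiting time has a probability law, which rules out the zero density of rate
  0.\<close>

lemma hitting_pos_of_mecke_data:
  assumes "mecke_data \<Lambda> W N \<gamma> \<alpha> \<tau>"
  shows "0 < measure \<Lambda> (hitting W)"
proof (rule ccontr)
  assume "\<not> 0 < measure \<Lambda> (hitting W)"
  then have m0: "measure \<Lambda> (hitting W) = 0" using measure_nonneg[of \<Lambda> "hitting W"] by linarith
  interpret N: prob_space N using assms by (simp add: mecke_data_def)
  have "distributed N lborel (\<tau> 1) (exponential_density (real 1 * measure \<Lambda> (hitting W)))"
    using assms unfolding mecke_data_def by blast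
  then have "distr N lborel (\<tau> 1) = density lborel (exponential_density 0)" and m: "\<tau> 1 \<in> measurable N lborel"
    using m0 distributed_distr_eq_density[of N lborel "\<tau> 1"] distributed_measurable[of N lborel "\<tau> 1"] by simp_all
  then have "emeasure (distr N lborel (\<tau> 1)) UNIV = 0"
    by (simp add: emeasure_density exponential_density_0)
  moreover have "emeasure (distr N lborel (\<tau> 1)) UNIV = 1"
    using N.emeasure_space_1 by (subst emeasure_distr[OF m]) simp_all
  ultimately show False by simp
qed

lemma bounded_times:
  fixes F :: "(real \<times> 'a) set"
  assumes "finite F" obtains T where "\<And>p. p \<in> F \<Longrightarrow> fst p < T"
proof -
  have le: "fst p \<le> Max (insert 0 (fst ` F))" if "p \<in> F" for p
    using that assms by (intro Max_ge) auto
  have "fst p < Max (insert 0 (fst ` F)) + 1" if "p \<in> F" for p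
    using le[OF that] by simp
  then show thesis by (rule that)
qed

theorem theorem2:
  fixes W :: "(real^2) set" and \<Lambda> :: "(real^2) set measure"
    and M :: "'a measure" and L :: "bool list \<Rightarrow> 'a \<Rightarrow> real" and G :: "bool list \<Rightarrow> 'a \<Rightarrow> (real^2) set"
    and N :: "'b measure" and \<gamma> :: "nat \<Rightarrow> 'b \<Rightarrow> (real^2) set" and \<alpha> :: "nat \<Rightarrow> 'b \<Rightarrow> nat"
    and T :: "nat \<Rightarrow> 'b \<Rightarrow> real"
  assumes "polytope W" and "interior W \<noteq> {}"
    and "sets \<Lambda> = sets line_space" and "emeasure \<Lambda> (space \<Lambda>) \<noteq> 0"
    and "locally_finite_lines \<Lambda>" and "translation_invariant_lines \<Lambda>"
    and "\<not> concentrated_on_one_direction \<Lambda>"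
    and "stit_data \<Lambda> W M L G"
    and "mecke_data \<Lambda> W N \<gamma> \<alpha> T"
  shows "eq_in_distribution (Pi\<^sub>M {0..} (\<lambda>_. closed_set_space))
    M (\<lambda>\<omega>. \<lambda>t\<in>{0..}. stit W (\<lambda>w. L w \<omega>) (\<lambda>w. G w \<omega>) t)
    N (\<lambda>\<omega>. \<lambda>t\<in>{0..}. mecke_continuous W (\<lambda>j. \<gamma> j \<omega>) (\<lambda>j. \<alpha> j \<omega>) (\<lambda>k. T k \<omega>) t)"
proof -
  interpret line_measure W \<Lambda>
    using assms hitting_pos_of_mecke_data[OF assms(9)] by unfold_locales auto
  let ?X = "\<lambda>\<omega>. \<lambda>t\<in>{0..}. stit W (\<lambda>w. L w \<omega>) (\<lambda>w. G w \<omega>) t"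
  let ?Y = "\<lambda>\<omega>. \<lambda>t\<in>{0..}. mecke_continuous W (\<lambda>j. \<gamma> j \<omega>) (\<lambda>j. \<alpha> j \<omega>) (\<lambda>k. T k \<omega>) t"
  have prob: "prob_space M" "prob_space N"
    using assms(8,9) by (simp_all add: stit_data_def mecke_data_def)
  \<comment> \<open>Measurability of the two processes involves no tests, so \<open>F = {}\<close>
    and horizon 0 suffice here.\<close>
  interpret S: stit_run W Q rate "{}" 0 M L G by (rule stit_run[OF assms(8)]) auto
  interpret K: mecke_run W Q rate "{}" 0 N \<gamma> \<alpha> T by (rule mecke_run[OF assms(9)]) auto
  have X: "?X \<in> measurable M path_space"
  proof (rule measurable_restrict)
    fix t :: real
    show "(\<lambda>\<omega>. stit W (\<lambda>w. L w \<omega>) (\<lambda>w. G w \<omega>) t) \<in> measurable M closed_set_space"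
    proof (rule measurable_closed_set_spaceI)
      fix U :: "(real^2) set" assume U: "open U"
      have [measurable]: "Measurable.pred M (\<lambda>\<omega>. frontier (stit_cell W (\<lambda>u. G u \<omega>) w) \<inter> (U - frontier W) = {})" for w
        by (intro measurable_compose[OF S.measurable_cell pred_frontier_disjoint] open_Diff U frontier_closed)
      have "Measurable.pred M (\<lambda>\<omega>. \<forall>w. stit_birth (\<lambda>u. L u \<omega>) w \<le> t \<and> t < stit_birth (\<lambda>u. L u \<omega>) w + L w \<omega> \<longrightarrow>
          frontier (stit_cell W (\<lambda>u. G u \<omega>) w) \<inter> (U - frontier W) = {})"
        using S.L_meas by measurable
      then show "Measurable.pred M (\<lambda>\<omega>. stit W (\<lambda>w. L w \<omega>) (\<lambda>w. G w \<omega>) t \<inter> U = {})"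
        by (simp only: stit_misses_iff[OF U])
    qed (simp add: stit_def)
  qed
  have Y: "?Y \<in> measurable N path_space"
  proof (rule measurable_restrict)
    fix t :: real assume t: "t \<in> {0..}"
    have jumps: "(\<lambda>\<omega>. cowan_jumps (\<lambda>k. T k \<omega>) t) \<in> measurable N (count_space UNIV)"
      using K.jumps_indep t measurable_compose[OF _ measurable_component_singleton[OF t], of
          "\<lambda>\<omega>. \<lambda>t\<in>{0..}. cowan_jumps (\<lambda>k. T k \<omega>) t" N "\<lambda>_. count_space UNIV"]
      by (simp add: indep_rvs_def)
    show "(\<lambda>\<omega>. mecke_continuous W (\<lambda>j. \<gamma> j \<omega>) (\<lambda>j. \<alpha> j \<omega>) (\<lambda>k. T k \<omega>) t) \<in> measurable N closed_set_space"
    proof (rule measurable_closed_set_spaceI)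
      fix U :: "(real^2) set" assume U: "open U"
      show "Measurable.pred N (\<lambda>\<omega>. mecke_continuous W (\<lambda>j. \<gamma> j \<omega>) (\<lambda>j. \<alpha> j \<omega>) (\<lambda>k. T k \<omega>) t \<inter> U = {})"
        unfolding mecke_continuous_def K.mecke_discrete_misses_iff[OF U]
        by (intro K.pred_missed U jumps) (auto intro: K.rv)
    qed (simp add: mecke_continuous_def mecke_discrete_def)
  qed
  have "distr M path_space ?X = distr N path_space ?Y"
  proof (rule path_law_eqI[OF prob(1) X prob(2) Y])
    fix F :: "(real \<times> (real^2) set) set"
    assume F: "finite F" "\<And>p. p \<in> F \<Longrightarrow> 0 \<le> fst p" "\<And>p. p \<in> F \<Longrightarrow> open (snd p)"
    obtain b where b: "\<And>p. p \<in> F \<Longrightarrow> fst p < b" using bounded_times[OF F(1)] by metis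
    interpret SF: stit_run W Q rate F b M L G by (rule stit_run[OF assms(8) F(1,3) b])
    interpret KF: mecke_run W Q rate F b N \<gamma> \<alpha> T by (rule mecke_run[OF assms(9) F(1,3) b F(2)])
    have "{\<omega> \<in> space M. \<forall>p\<in>F. ?X \<omega> (fst p) \<inter> snd p = {}} =
        {\<omega> \<in> space M. \<forall>p\<in>F. stit W (\<lambda>w. L w \<omega>) (\<lambda>w. G w \<omega>) (fst p) \<inter> snd p = {}}"
      using F(2) by (intro Collect_cong conj_cong ball_cong refl) simp
    moreover have "{\<omega> \<in> space N. \<forall>p\<in>F. ?Y \<omega> (fst p) \<inter> snd p = {}} =
        {\<omega> \<in> space N. \<forall>p\<in>F. mecke_continuous W (\<lambda>j. \<gamma> j \<omega>) (\<lambda>j. \<alpha> j \<omega>) (\<lambda>k. T k \<omega>) (fst p) \<inter> snd p = {}}"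
      using F(2) by (intro Collect_cong conj_cong ball_cong refl) simp
    \<comment> \<open>Both interpretations share \<open>W\<close>, \<open>Q\<close>,
      \<open>rate\<close>, \<open>F\<close> and \<open>b\<close>, so their \<open>surv W 0\<close>
      is one and the same number.\<close>
    ultimately show "emeasure M {\<omega> \<in> space M. \<forall>p\<in>F. ?X \<omega> (fst p) \<inter> snd p = {}} =
        emeasure N {\<omega> \<in> space N. \<forall>p\<in>F. ?Y \<omega> (fst p) \<inter> snd p = {}}"
      using SF.stit_avoids KF.mecke_avoids by simp
  qed
  then show ?thesis using X Y by (simp add: eq_in_distribution_def)
qed

end
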